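(* Let $(W,S)$ be a Coxeter system with $W$ finite and let $w_0\in W$ be the longest element. Then there exists a constant $N\leq 8\,l(w_0)^3$ such that any weight function on $W$ (with positive values on $S$) is equivalent to a weight function $L$ such that $1\leq L(s)\leq N$ for all $s\in S$.
   Context: **General setting.** $(W,S)$ is a Coxeter system with length function $l$ and Bruhat--Chevalley order $\leq$. $\Gamma$ is an abelian group, written multiplicatively; a total order on it is specified by a multiplicatively closed subset $\Gamma_+\subseteq\Gamma\setminus\{1\}$ with $\Gamma=\Gamma_+\amalg\{1\}\amalg\Gamma_-$, $\Gamma_-=\{g^{-1}\mid g\in\Gamma_+\}$. Parameters $v_s\in\Gamma_+$ ($s\in S$) are given with $v_s=v_t$ whenever $s,t\in S$ are conjugate in $W$. $\mathbf{H}$ is the $\mathbb{Z}[\Gamma]$-algebra with basis $\{\mathbf{T}_w\mid w\in W\}$ and, for $s\in S$, $\mathbf{T}_s\mathbf{T}_w=\mathbf{T}_{sw}$ if $l(sw)>l(w)$, $\mathbf{T}_s\mathbf{T}_w=\mathbf{T}_{sw}+(v_s-v_s^{-1})\mathbf{T}_w$ if $l(sw)<l(w)$. Let $h\mapsto\overline{h}$ be the ring involution of $\mathbf{H}$ with $\overline{g}=g^{-1}$ ($g\in\Gamma$) and $\overline{\mathbf{T}_w}=\mathbf{T}_{w^{-1}}^{-1}$. For each $w\in W$ there is a unique $\mathbf{C}_w$ with $\overline{\mathbf{C}_w}=\mathbf{C}_w$ and $\mathbf{C}_w=\mathbf{T}_w+\sum_{y<w}\mathbf{P}^*_{y,w}\mathbf{T}_y$,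 where $\mathbf{P}^*_{y,w}\in\mathbb{Z}[\Gamma_-]$ (the $\mathbb{Z}$-span of $\Gamma_-$). For $s\in S$ with $sw>w$, $$\mathbf{T}_s\mathbf{C}_w=\mathbf{C}_{sw}-v_s^{-1}\mathbf{C}_w+\sum_{y<w,\;sy<y}\mathbf{M}^s_{y,w}\mathbf{C}_y,$$ which defines $\mathbf{M}^s_{y,w}\in\mathbb{Z}[\Gamma]$ for $sy<y<w<sw$. **The set $\Gamma_+(W)$.** Let $\Gamma_+^{(a)}(W)$ be the set of all $\gamma\in\Gamma_+$ such that $\gamma^{-1}$ occurs with non-zero coefficient in $\mathbf{P}^*_{y,w}$ for some $y<w$. For $y,w,s$ with $sy<y<w<sw$ and $\mathbf{M}^s_{y,w}\neq0$, write $\mathbf{M}^s_{y,w}=n_1\gamma_1+\cdots+n_r\gamma_r$ with $0\neq n_i\in\mathbb{Z}$, $\gamma_i\in\Gamma$ and $\gamma_{i-1}^{-1}\gamma_i\in\Gamma_+$ for $2\leq i\leq r$; $\Gamma_+^{(b)}(W)$ is the set of all elements $\gamma_{i-1}^{-1}\gamma_i$ arising in this way. $\Gamma_+(W)=\Gamma_+^{(a)}(W)\cup\Gamma_+^{(b)}(W)$. **Equivalence of weight functions.** A weight function is a map $L\colon W\to\mathbb{Z}$ with $L(ww')=L(w)+L(w')$ whenever $l(ww')=l(w)+l(w')$; only weight functions with $L(s)>0$ for all $s\in S$ are considered. Given an abelian group $\Gamma$, a total order on $\Gamma$ specified by $\Gamma_+\subset\Gamma$, and parameters $\{v_s\mid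 s\in S\}\subset\Gamma_+$ with $v_s=v_t$ whenever $s,t\in S$ are conjugate in $W$, weight functions $L,L'$ are $\Gamma_+$-equivalent if there are ring homomorphisms $\sigma,\sigma'\colon\mathbb{Z}[\Gamma]\to\mathbb{Z}[v,v^{-1}]$ ($v$ an indeterminate) with $\sigma(v_s)=v^{L(s)}$, $\sigma'(v_s)=v^{L'(s)}$ for all $s\in S$, $\sigma(\Gamma_+(W))\subseteq\{v^n\mid n>0\}$ and $\sigma'(\Gamma_+(W))\subseteq\{v^n\mid n>0\}$. $L,L'$ are equivalent if $L=L'$ or there is a sequence $L=L_0,L_1,\ldots,L_n=L'$ of weight functions and totally ordered abelian groups $(\Gamma_i)_+\subset\Gamma_i$ (with parameters in $(\Gamma_i)_+$) such that $L_{i-1},L_i$ are $(\Gamma_i)_+$-equivalent for $1\leq i\leq n$. *)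

theory Defs
  imports "HOL-Algebra.Algebra" "HOL-Library.Poly_Mapping"
begin

section \<open>Coxeter systems\<close>

definition word_prod :: "('w, 'b) monoid_scheme \<Rightarrow> 'w list \<Rightarrow> 'w"
  where "word_prod W ss = foldr (\<otimes>\<^bsub>W\<^esub>) ss \<one>\<^bsub>W\<^esub>"

text \<open>
  The congruence on the free monoid of words over \<open>S\<close> generated by the Coxeter relations
  \<open>(st)\<^sup>m = 1\<close>, where \<open>m\<close> is the order of \<open>st\<close>. For \<open>st\<close> of infinite order, \<open>group.ord\<close> is \<open>0\<close>
  and the relator is the empty word. The case \<open>s = t\<close> gives \<open>ss = 1\<close>, so the quotient of the
  free monoid is already the group presented by these relations.
\<close>

inductive coxeter_congruent :: "('w, 'b) monoid_scheme \<Rightarrow> 'w set \<Rightarrow> 'w list \<Rightarrow> 'w list \<Rightarrow> bool"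
  for W :: "('w, 'b) monoid_scheme" and S :: "'w set"
  where
    relator: "s \<in> S \<Longrightarrow> t \<in> S \<Longrightarrow>
      coxeter_congruent W S (concat (replicate (group.ord W (s \<otimes>\<^bsub>W\<^esub> t)) [s, t])) []"
  | refl: "set xs \<subseteq> S \<Longrightarrow> coxeter_congruent W S xs xs"
  | sym: "coxeter_congruent W S xs ys \<Longrightarrow> coxeter_congruent W S ys xs"
  | trans: "coxeter_congruent W S xs ys \<Longrightarrow> coxeter_congruent W S ys zs \<Longrightarrow>
      coxeter_congruent W S xs zs"
  | append: "coxeter_congruent W S xs xs' \<Longrightarrow> coxeter_congruent W S ys ys' \<Longrightarrow>
      coxeter_congruent W S (xs @ ys) (xs' @ ys')"

locale coxeter_system = group W for W :: "('w, 'b) monoid_scheme" +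
  fixes S :: "'w set"
  assumes S_subset: "S \<subseteq> carrier W"
    and S_order_2: "s \<in> S \<Longrightarrow> ord s = 2"
    and S_generates: "generate W S = carrier W"
    and presentation: "set xs \<subseteq> S \<Longrightarrow> set ys \<subseteq> S \<Longrightarrow> word_prod W xs = word_prod W ys \<Longrightarrow>
      coxeter_congruent W S xs ys"

definition cox_length :: "('w, 'b) monoid_scheme \<Rightarrow> 'w set \<Rightarrow> 'w \<Rightarrow> nat"
  where "cox_length W S w = (LEAST n. \<exists>ss. set ss \<subseteq> S \<and> length ss = n \<and> word_prod W ss = w)"

definition reflections :: "('w, 'b) monoid_scheme \<Rightarrow> 'w set \<Rightarrow> 'w set"
  where "reflections W S = {x \<otimes>\<^bsub>W\<^esub> s \<otimes>\<^bsub>W\<^esub> inv\<^bsub>W\<^esub> x | x s. x \<in> carrier W \<and> s \<in> S}"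

definition bruhat_less :: "('w, 'b) monoid_scheme \<Rightarrow> 'w set \<Rightarrow> 'w \<Rightarrow> 'w \<Rightarrow> bool"
  where "bruhat_less W S y w \<longleftrightarrow>
    (y, w) \<in> {(x, t \<otimes>\<^bsub>W\<^esub> x) | x t. x \<in> carrier W \<and> t \<in> reflections W S \<and>
      cox_length W S x < cox_length W S (t \<otimes>\<^bsub>W\<^esub> x)}\<^sup>+"

section \<open>Integral group rings\<close>

text \<open>
  Elements of \<open>\<int>[G]\<close> are the finitely supported integer functions on \<open>carrier G\<close>, with the
  convolution product; \<open>frag_of g\<close> is the group element \<open>g\<close> viewed in \<open>\<int>[G]\<close>.
\<close>

definition group_ring :: "('g, 'c) monoid_scheme \<Rightarrow> ('g \<Rightarrow>\<^sub>0 int) ring"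
  where "group_ring G =
    \<lparr>carrier = {a. Poly_Mapping.keys a \<subseteq> carrier G},
     monoid.mult = (\<lambda>a b. frag_extend (\<lambda>g. frag_extend (\<lambda>h. frag_of (g \<otimes>\<^bsub>G\<^esub> h)) b) a),
     monoid.one = frag_of \<one>\<^bsub>G\<^esub>,
     ring.zero = 0,
     ring.add = (+)\<rparr>"

text \<open>\<open>\<int>[v, v\<^sup>-\<^sup>1]\<close> as the group ring of the infinite cyclic group; \<open>v\<^sup>n\<close> is \<open>vpow n\<close>.\<close>

definition laurent_ring :: "(int \<Rightarrow>\<^sub>0 int) ring"
  where "laurent_ring = group_ring integer_group"

abbreviation vpow :: "int \<Rightarrow> (int \<Rightarrow>\<^sub>0 int)"
  where "vpow n \<equiv> frag_of n"

section \<open>The generic Hecke algebra and its Kazhdan--Lusztig basis\<close>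

locale ordered_abelian_group = comm_group \<Gamma> for \<Gamma> :: "('g, 'c) monoid_scheme" +
  fixes \<Gamma>p :: "'g set"
  assumes pos_subset: "\<Gamma>p \<subseteq> carrier \<Gamma> - {\<one>\<^bsub>\<Gamma>\<^esub>}"
    and pos_mult: "a \<in> \<Gamma>p \<Longrightarrow> b \<in> \<Gamma>p \<Longrightarrow> a \<otimes>\<^bsub>\<Gamma>\<^esub> b \<in> \<Gamma>p"
    and pos_neg_cover: "carrier \<Gamma> = \<Gamma>p \<union> {\<one>\<^bsub>\<Gamma>\<^esub>} \<union> m_inv \<Gamma> ` \<Gamma>p"
    and pos_neg_disjoint: "\<Gamma>p \<inter> m_inv \<Gamma> ` \<Gamma>p = {}"

text \<open>
  The elements of the \<open>\<int>[\<Gamma>]\<close>-algebra \<open>H\<close> are represented by their coordinates with respect to the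
  basis \<open>T\<^sub>w\<close>. So the underlying module of \<open>H\<close> is the free module on \<open>carrier W\<close>, and only the
  product, which is determined by the stated relations, carries further information. \<open>v\<close> is
  relevant only on \<open>S\<close>.
\<close>

definition T_basis :: "('g, 'c) monoid_scheme \<Rightarrow> 'w \<Rightarrow> ('w \<Rightarrow>\<^sub>0 ('g \<Rightarrow>\<^sub>0 int))"
  where "T_basis \<Gamma> w = Poly_Mapping.single w (frag_of \<one>\<^bsub>\<Gamma>\<^esub>)"

locale hecke_algebra =
  W: coxeter_system W S + \<Gamma>: ordered_abelian_group \<Gamma> \<Gamma>p
  for W :: "('w, 'b) monoid_scheme" and S :: "'w set"
    and \<Gamma> :: "('g, 'c) monoid_scheme" and \<Gamma>p :: "'g set" +
  fixes v :: "'w \<Rightarrow> 'g"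
    and H :: "('g \<Rightarrow>\<^sub>0 int, 'w \<Rightarrow>\<^sub>0 ('g \<Rightarrow>\<^sub>0 int)) module"
    and bar :: "('w \<Rightarrow>\<^sub>0 ('g \<Rightarrow>\<^sub>0 int)) \<Rightarrow> ('w \<Rightarrow>\<^sub>0 ('g \<Rightarrow>\<^sub>0 int))"
  assumes param_pos: "s \<in> S \<Longrightarrow> v s \<in> \<Gamma>p"
    and param_conj: "s \<in> S \<Longrightarrow> t \<in> S \<Longrightarrow> x \<in> carrier W \<Longrightarrow>
      t = x \<otimes>\<^bsub>W\<^esub> s \<otimes>\<^bsub>W\<^esub> inv\<^bsub>W\<^esub> x \<Longrightarrow> v s = v t"
    and H_carrier: "carrier H = {h. Poly_Mapping.keys h \<subseteq> carrier W \<and>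
      (\<forall>w. Poly_Mapping.lookup h w \<in> carrier (group_ring \<Gamma>))}"
    and H_zero: "\<zero>\<^bsub>H\<^esub> = 0"
    and H_add: "a \<in> carrier H \<Longrightarrow> b \<in> carrier H \<Longrightarrow> a \<oplus>\<^bsub>H\<^esub> b = a + b"
    and H_smult: "c \<in> carrier (group_ring \<Gamma>) \<Longrightarrow> a \<in> carrier H \<Longrightarrow>
      Poly_Mapping.lookup (c \<odot>\<^bsub>H\<^esub> a) w = c \<otimes>\<^bsub>group_ring \<Gamma>\<^esub> Poly_Mapping.lookup a w"
    and H_module: "module (group_ring \<Gamma>) H"
    and H_ring: "ring H"
    and H_smult_left: "c \<in> carrier (group_ring \<Gamma>) \<Longrightarrow> a \<in> carrier H \<Longrightarrow> b \<in> carrier H \<Longrightarrow>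
      (c \<odot>\<^bsub>H\<^esub> a) \<otimes>\<^bsub>H\<^esub> b = c \<odot>\<^bsub>H\<^esub> (a \<otimes>\<^bsub>H\<^esub> b)"
    and H_smult_right: "c \<in> carrier (group_ring \<Gamma>) \<Longrightarrow> a \<in> carrier H \<Longrightarrow> b \<in> carrier H \<Longrightarrow>
      a \<otimes>\<^bsub>H\<^esub> (c \<odot>\<^bsub>H\<^esub> b) = c \<odot>\<^bsub>H\<^esub> (a \<otimes>\<^bsub>H\<^esub> b)"
    and H_one: "\<one>\<^bsub>H\<^esub> = T_basis \<Gamma> \<one>\<^bsub>W\<^esub>"
    and T_mult_up: "s \<in> S \<Longrightarrow> w \<in> carrier W \<Longrightarrow>
      cox_length W S (s \<otimes>\<^bsub>W\<^esub> w) > cox_length W S w \<Longrightarrow>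
      T_basis \<Gamma> s \<otimes>\<^bsub>H\<^esub> T_basis \<Gamma> w = T_basis \<Gamma> (s \<otimes>\<^bsub>W\<^esub> w)"
    and T_mult_down: "s \<in> S \<Longrightarrow> w \<in> carrier W \<Longrightarrow>
      cox_length W S (s \<otimes>\<^bsub>W\<^esub> w) < cox_length W S w \<Longrightarrow>
      T_basis \<Gamma> s \<otimes>\<^bsub>H\<^esub> T_basis \<Gamma> w = T_basis \<Gamma> (s \<otimes>\<^bsub>W\<^esub> w)
        \<oplus>\<^bsub>H\<^esub> (frag_of (v s) - frag_of (inv\<^bsub>\<Gamma>\<^esub> (v s))) \<odot>\<^bsub>H\<^esub> T_basis \<Gamma> w"
    and bar_hom: "bar \<in> ring_hom H H"
    and bar_involution: "a \<in> carrier H \<Longrightarrow> bar (bar a) = a"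
    and bar_scalar: "g \<in> carrier \<Gamma> \<Longrightarrow>
      bar (frag_of g \<odot>\<^bsub>H\<^esub> \<one>\<^bsub>H\<^esub>) = frag_of (inv\<^bsub>\<Gamma>\<^esub> g) \<odot>\<^bsub>H\<^esub> \<one>\<^bsub>H\<^esub>"
    and bar_T: "w \<in> carrier W \<Longrightarrow> bar (T_basis \<Gamma> w) = inv\<^bsub>H\<^esub> (T_basis \<Gamma> (inv\<^bsub>W\<^esub> w))"
begin

abbreviation less :: "'w \<Rightarrow> 'w \<Rightarrow> bool"  (infix \<open>\<prec>\<close> 50)
  where "y \<prec> w \<equiv> bruhat_less W S y w"

abbreviation T :: "'w \<Rightarrow> ('w \<Rightarrow>\<^sub>0 ('g \<Rightarrow>\<^sub>0 int))"
  where "T w \<equiv> T_basis \<Gamma> w"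

definition C :: "'w \<Rightarrow> ('w \<Rightarrow>\<^sub>0 ('g \<Rightarrow>\<^sub>0 int))"
  where "C w = (THE c. c \<in> carrier H \<and> bar c = c \<and>
    (\<exists>P. (\<forall>y. Poly_Mapping.keys (P y) \<subseteq> m_inv \<Gamma> ` \<Gamma>p) \<and>
         c = T w \<oplus>\<^bsub>H\<^esub> (\<Oplus>\<^bsub>H\<^esub>y\<in>{y. y \<prec> w}. P y \<odot>\<^bsub>H\<^esub> T y)))"

definition Pstar :: "'w \<Rightarrow> 'w \<Rightarrow> ('g \<Rightarrow>\<^sub>0 int)"
  where "Pstar y w = Poly_Mapping.lookup (C w) y"

text \<open>Only meaningful for \<open>s \<in> S\<close> and \<open>s y \<prec> y \<prec> w \<prec> s w\<close>.\<close>

definition M :: "'w \<Rightarrow> 'w \<Rightarrow> 'w \<Rightarrow> ('g \<Rightarrow>\<^sub>0 int)"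
  where "M s y w = (THE m. (\<forall>z. m z \<in> carrier (group_ring \<Gamma>)) \<and>
      (\<forall>z. \<not> (z \<prec> w \<and> s \<otimes>\<^bsub>W\<^esub> z \<prec> z) \<longrightarrow> m z = 0) \<and>
      T s \<otimes>\<^bsub>H\<^esub> C w = C (s \<otimes>\<^bsub>W\<^esub> w) \<ominus>\<^bsub>H\<^esub> frag_of (inv\<^bsub>\<Gamma>\<^esub> (v s)) \<odot>\<^bsub>H\<^esub> C w
        \<oplus>\<^bsub>H\<^esub> (\<Oplus>\<^bsub>H\<^esub>z\<in>{z. z \<prec> w \<and> s \<otimes>\<^bsub>W\<^esub> z \<prec> z}. m z \<odot>\<^bsub>H\<^esub> C z)) y"

definition Gamma_a :: "'g set"
  where "Gamma_a = {\<gamma> \<in> \<Gamma>p. \<exists>y w. w \<in> carrier W \<and> y \<prec> w \<and>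
    Poly_Mapping.lookup (Pstar y w) (inv\<^bsub>\<Gamma>\<^esub> \<gamma>) \<noteq> 0}"

definition Gamma_b :: "'g set"
  where "Gamma_b = {inv\<^bsub>\<Gamma>\<^esub> (\<gamma> (i - 1)) \<otimes>\<^bsub>\<Gamma>\<^esub> \<gamma> i | s y w (r::nat) (n :: nat \<Rightarrow> int) \<gamma> i.
    s \<in> S \<and> s \<otimes>\<^bsub>W\<^esub> y \<prec> y \<and> y \<prec> w \<and> w \<prec> s \<otimes>\<^bsub>W\<^esub> w \<and> M s y w \<noteq> 0 \<and>
    M s y w = (\<Sum>j = 1..r. frag_cmul (n j) (frag_of (\<gamma> j))) \<and>
    (\<forall>j\<in>{1..r}. n j \<noteq> 0 \<and> \<gamma> j \<in> carrier \<Gamma>) \<and>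
    (\<forall>j\<in>{2..r}. inv\<^bsub>\<Gamma>\<^esub> (\<gamma> (j - 1)) \<otimes>\<^bsub>\<Gamma>\<^esub> \<gamma> j \<in> \<Gamma>p) \<and>
    i \<in> {2..r}}"

definition Gamma_plus_W :: "'g set"
  where "Gamma_plus_W = Gamma_a \<union> Gamma_b"

end

section \<open>Equivalence of weight functions\<close>

text \<open>Values outside \<open>carrier W\<close> are irrelevant.\<close>

definition pos_weight_function :: "('w, 'b) monoid_scheme \<Rightarrow> 'w set \<Rightarrow> ('w \<Rightarrow> int) \<Rightarrow> bool"
  where "pos_weight_function W S L \<longleftrightarrow>
    (\<forall>w\<in>carrier W. \<forall>w'\<in>carrier W.
      cox_length W S (w \<otimes>\<^bsub>W\<^esub> w') = cox_length W S w + cox_length W S w' \<longrightarrow>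
      L (w \<otimes>\<^bsub>W\<^esub> w') = L w + L w') \<and>
    (\<forall>s\<in>S. L s > 0)"

text \<open>
  \<open>specializes W S \<Gamma> \<Gamma>p v H bar L\<close>: a ring homomorphism \<open>\<int>[\<Gamma>] \<rightarrow> \<int>[v, v\<^sup>-\<^sup>1]\<close> as required of
  \<open>\<sigma>\<close> (resp. \<open>\<sigma>'\<close>) in the definition of \<open>\<Gamma>\<^sub>+\<close>-equivalence exists for \<open>L\<close>.
\<close>

definition specializes ::
  "('w, 'b) monoid_scheme \<Rightarrow> 'w set \<Rightarrow> ('g, 'c) monoid_scheme \<Rightarrow> 'g set \<Rightarrow> ('w \<Rightarrow> 'g) \<Rightarrow>
   ('g \<Rightarrow>\<^sub>0 int, 'w \<Rightarrow>\<^sub>0 ('g \<Rightarrow>\<^sub>0 int)) module \<Rightarrow>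
   (('w \<Rightarrow>\<^sub>0 ('g \<Rightarrow>\<^sub>0 int)) \<Rightarrow> ('w \<Rightarrow>\<^sub>0 ('g \<Rightarrow>\<^sub>0 int))) \<Rightarrow> ('w \<Rightarrow> int) \<Rightarrow> bool"
  where "specializes W S \<Gamma> \<Gamma>p v H bar L \<longleftrightarrow>
    (\<exists>\<sigma> \<in> ring_hom (group_ring \<Gamma>) laurent_ring.
      (\<forall>s\<in>S. \<sigma> (frag_of (v s)) = vpow (L s)) \<and>
      (\<forall>\<gamma>\<in>hecke_algebra.Gamma_plus_W W S \<Gamma> \<Gamma>p v H bar. \<exists>n>0. \<sigma> (frag_of \<gamma>) = vpow n))"

text \<open>
  \<open>H\<close> and \<open>bar\<close> are determined on the relevant carriers by \<open>W\<close>, \<open>S\<close>, \<open>\<Gamma>\<close> and \<open>v\<close>. The group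
  \<open>\<Gamma>\<close> ranges over all groups carried by subsets of \<open>'g\<close>.
\<close>

definition Gamma_equivalent ::
  "'g itself \<Rightarrow> ('w, 'b) monoid_scheme \<Rightarrow> 'w set \<Rightarrow> ('w \<Rightarrow> int) \<Rightarrow> ('w \<Rightarrow> int) \<Rightarrow> bool"
  where "Gamma_equivalent _ W S L L' \<longleftrightarrow>
    (\<exists>(\<Gamma> :: 'g monoid) \<Gamma>p v H bar. hecke_algebra W S \<Gamma> \<Gamma>p v H bar \<and>
      specializes W S \<Gamma> \<Gamma>p v H bar L \<and> specializes W S \<Gamma> \<Gamma>p v H bar L')"

text \<open>
  The ordered groups are taken in the type \<^typ>\<open>nat \<Rightarrow> int\<close>. This loses nothing when \<open>S\<close> is
  finite: \<open>\<Gamma>\<close> may be replaced by its subgroup generated by the parameters, since this subgroup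
  contains \<open>\<Gamma>\<^sub>+(W)\<close>, and countable groups have isomorphic copies carried by any infinite type.
\<close>

definition equivalent_weights ::
  "('w, 'b) monoid_scheme \<Rightarrow> 'w set \<Rightarrow> ('w \<Rightarrow> int) \<Rightarrow> ('w \<Rightarrow> int) \<Rightarrow> bool"
  where "equivalent_weights W S L L' \<longleftrightarrow>
    (\<forall>w\<in>carrier W. L w = L' w) \<or>
    (\<exists>(n::nat) Ls. Ls 0 = L \<and> Ls n = L' \<and> (\<forall>i\<le>n. pos_weight_function W S (Ls i)) \<and>
      (\<forall>i\<in>{1..n}. Gamma_equivalent TYPE(nat \<Rightarrow> int) W S (Ls (i - 1)) (Ls i)))"

end

theory Submission
  imports Defs "HOL-Library.Function_Algebras"
begin

text \<open>
  Take for \<open>\<Gamma>\<close> the group of integer sequences with the lexicographic order and the parameters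
  \<open>v\<^sub>s = (L s, L' s, 0, \<dots>)\<close>. The coordinate projections specialize \<open>v\<^sub>s\<close> to \<open>L s\<close> and \<open>L' s\<close>, so
  \<open>L\<close> and \<open>L'\<close> are equivalent as soon as the first two coordinates of every element of
  \<open>\<Gamma>\<^sub>+(W)\<close> are positive.

  The Kazhdan--Lusztig recursion bounds the exponents of \<open>P\<^sup>*\<close> and of the differences in \<open>M\<close> by
  \<open>2 l(w\<^sub>0)\<close> in each parameter, and \<open>C\<^bsub>xy\<^esub> = C\<^sub>x C\<^sub>y\<close> for \<open>x\<close> and \<open>y\<close> in commuting parabolic
  subgroups reduces everything to irreducible components. In a component the generators form at
  most two conjugacy classes: three of them would give a path whose Tits form is not positive
  definite, as in the affine diagrams of type \<open>C\<close>. So it suffices that \<open>a L(s) + b L(t)\<close> and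
  \<open>a L'(s) + b L'(t)\<close> have the same sign for all \<open>|a|, |b| \<le> 2 l(w\<^sub>0)\<close>, and a mediant of two Farey
  neighbours of \<open>L(s) / L(t)\<close> achieves this with values at most \<open>4 l(w\<^sub>0) \<le> 8 l(w\<^sub>0)\<^sup>3\<close>.
\<close>

section \<open>Reflections and the exchange condition\<close>

text \<open>The sign condition must cover the value 0. The lexicographic order looks at
  \<open>L\<close> first, so a positive combination that \<open>L\<close> kills would specialize to
  exponent 0, and one that only \<open>L'\<close> kills or reverses would fail for
  \<open>L'\<close>; equal signs in -1, 0, 1 exclude both. Components decide the size of the
  constant: with all classes in play several ratios would have to be approximated at once, whereas
  one component leaves a single ratio. Different components are never compared, because exponents of
  a product are sums and positivity in both coordinates survives sums, while \<open>M\<close> for a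
  generator \<open>s\<close> only sees the component of \<open>s\<close>. The exponent bound grows
  with the length, as each step of the recursion multiplies by one parameter. It is proved for the
  basis and for \<open>M\<close> together. Bar invariance separates the two: the unknown
  \<open>M\<close> plus an unknown element with negative exponents is a known sum, so the
  non-negative exponents of \<open>M\<close> can be read off and the others follow by
  symmetry.\<close>

fun refl_seq :: "('w, 'b) monoid_scheme \<Rightarrow> 'w list \<Rightarrow> 'w list"
  where
    "refl_seq W [] = []"
  | "refl_seq W (s # ss) = s # map (\<lambda>t. s \<otimes>\<^bsub>W\<^esub> t \<otimes>\<^bsub>W\<^esub> inv\<^bsub>W\<^esub> s) (refl_seq W ss)"

text \<open>The parity of the multiplicity of \<open>t\<close> among \<open>s\<^sub>1, s\<^sub>1s\<^sub>2s\<^sub>1, \<dots>\<close> depends only on the product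
  \<open>s\<^sub>1s\<^sub>2\<dots>\<close>, because in the sequence of a relator every reflection occurs an even number of times.\<close>

definition odd_refl :: "('w, 'b) monoid_scheme \<Rightarrow> 'w list \<Rightarrow> 'w \<Rightarrow> bool"
  where "odd_refl W ss t \<longleftrightarrow> odd (count_list (refl_seq W ss) t)"

locale coxeter = coxeter_system W S for W (structure) and S
begin

section \<open>Words and the length function\<close>

abbreviation len :: "'a \<Rightarrow> nat" (\<open>\<ell>\<close>)
  where "len \<equiv> cox_length W S"

abbreviation wp :: "'a list \<Rightarrow> 'a"
  where "wp \<equiv> word_prod W"

lemma S_carrier [simp, intro]: "s \<in> S \<Longrightarrow> s \<in> carrier W"
  using S_subset by blast

lemma S_square [simp]:
  assumes "s \<in> S"
  shows "s \<otimes> s = \<one>"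
proof -
  have "s [^] (2::nat) = \<one>"
    using pow_ord_eq_1[of s] S_order_2[OF assms] assms by auto
  then show ?thesis
    using assms by (simp add: numeral_2_eq_2)
qed

lemma S_neq_one:
  assumes "s \<in> S"
  shows "s \<noteq> \<one>"
  using S_order_2[OF assms] ord_id by (metis One_nat_def Suc_1 n_not_Suc_n)

lemma S_inv [simp]: "s \<in> S \<Longrightarrow> inv s = s"
  by (simp add: inv_equality)

lemma S_cancel [simp]: "s \<in> S \<Longrightarrow> x \<in> carrier W \<Longrightarrow> s \<otimes> (s \<otimes> x) = x"
  by (simp flip: m_assoc)

lemma S_cancel_right [simp]: "s \<in> S \<Longrightarrow> x \<in> carrier W \<Longrightarrow> x \<otimes> s \<otimes> s = x"
  by (simp add: m_assoc)

lemma wp_Nil [simp]: "wp [] = \<one>"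
  by (simp add: word_prod_def)

lemma wp_Cons [simp]: "wp (s # ss) = s \<otimes> wp ss"
  by (simp add: word_prod_def)

lemma wp_closed [simp, intro]: "set ss \<subseteq> carrier W \<Longrightarrow> wp ss \<in> carrier W"
  by (induction ss) auto

lemma words_carrier: "set ss \<subseteq> S \<Longrightarrow> set ss \<subseteq> carrier W"
  using S_subset by blast

lemma wp_closed_S [simp, intro]: "set ss \<subseteq> S \<Longrightarrow> wp ss \<in> carrier W"
  by (meson words_carrier wp_closed)

lemma wp_append: "set xs \<subseteq> carrier W \<Longrightarrow> set ys \<subseteq> carrier W \<Longrightarrow> wp (xs @ ys) = wp xs \<otimes> wp ys"
  by (induction xs) (auto simp: m_assoc)

lemma wp_rev: "set ss \<subseteq> S \<Longrightarrow> wp (rev ss) = inv (wp ss)"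
  by (induction ss) (auto simp: wp_append words_carrier inv_mult_group)

lemma ex_word:
  assumes "w \<in> carrier W"
  obtains ss where "set ss \<subseteq> S" "wp ss = w"
proof -
  have "w \<in> generate W S"
    using assms S_generates by simp
  then have "\<exists>ss. set ss \<subseteq> S \<and> wp ss = w"
  proof (induction rule: generate.induct)
    case one
    show ?case by (rule exI[of _ "[]"]) simp
  next
    case (incl h)
    then show ?case by (intro exI[of _ "[h]"]) simp
  next
    case (inv h)
    then show ?case by (intro exI[of _ "[h]"]) simp
  next
    case (eng h1 h2)
    then obtain xs ys where "set xs \<subseteq> S" "wp xs = h1" "set ys \<subseteq> S" "wp ys = h2"
      by blast
    then show ?case
      by (intro exI[of _ "xs @ ys"]) (auto simp: wp_append words_carrier)
  qed
  then show thesis using that by blast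
qed

lemma reduced_word:
  assumes "w \<in> carrier W"
  obtains ss where "set ss \<subseteq> S" "wp ss = w" "length ss = \<ell> w"
proof -
  obtain ss where "set ss \<subseteq> S" "wp ss = w"
    using ex_word[OF assms] by metis
  then have "\<exists>n ss. set ss \<subseteq> S \<and> length ss = n \<and> wp ss = w"
    by blast
  from LeastI_ex[OF this] show thesis
    using that unfolding cox_length_def by blast
qed

lemma len_wp_le: "set ss \<subseteq> S \<Longrightarrow> \<ell> (wp ss) \<le> length ss"
  unfolding cox_length_def by (rule Least_le) blast

lemma len_one [simp]: "\<ell> \<one> = 0"
  using len_wp_le[of "[]"] by simp

lemma len_eq_0_iff: "w \<in> carrier W \<Longrightarrow> \<ell> w = 0 \<longleftrightarrow> w = \<one>"
  by (metis len_one length_0_conv reduced_word wp_Nil)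

lemma len_S [simp]:
  assumes "s \<in> S"
  shows "\<ell> s = 1"
  using len_wp_le[of "[s]"] len_eq_0_iff[of s] S_neq_one[of s] assms by fastforce

lemma len_mult_le:
  assumes "x \<in> carrier W" "y \<in> carrier W"
  shows "\<ell> (x \<otimes> y) \<le> \<ell> x + \<ell> y"
proof -
  obtain xs ys where "set xs \<subseteq> S" "wp xs = x" "length xs = \<ell> x"
    "set ys \<subseteq> S" "wp ys = y" "length ys = \<ell> y"
    using reduced_word assms by metis
  then show ?thesis
    using len_wp_le[of "xs @ ys"] by (simp add: wp_append words_carrier)
qed

lemma inv_cancel [simp]:
  assumes "x \<in> carrier W" "z \<in> carrier W"
  shows "inv x \<otimes> (x \<otimes> z) = z" "x \<otimes> (inv x \<otimes> z) = z"
  using assms by (simp_all flip: m_assoc)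

lemma conj_eq_iff:
  assumes "x \<in> carrier W" "t \<in> carrier W" "u \<in> carrier W"
  shows "x \<otimes> u \<otimes> inv x = t \<longleftrightarrow> u = inv x \<otimes> t \<otimes> x"
  using assms by (auto simp: m_assoc)

section \<open>Reflections occurring in a word\<close>

lemma refl_seq_closed: "set ss \<subseteq> carrier W \<Longrightarrow> set (refl_seq W ss) \<subseteq> carrier W"
  by (induction ss) auto

lemma refl_seq_append:
  "set xs \<subseteq> carrier W \<Longrightarrow> set ys \<subseteq> carrier W \<Longrightarrow>
    refl_seq W (xs @ ys) =
      refl_seq W xs @ map (\<lambda>t. wp xs \<otimes> t \<otimes> inv (wp xs)) (refl_seq W ys)"
proof (induction xs)
  case Nil
  then show ?case
    using refl_seq_closed[of ys] by (auto intro!: map_idI[symmetric])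
next
  case (Cons s xs)
  have "s \<otimes> (wp xs \<otimes> t \<otimes> inv (wp xs)) \<otimes> inv s = s \<otimes> wp xs \<otimes> t \<otimes> inv (s \<otimes> wp xs)"
    if "t \<in> set (refl_seq W ys)" for t
    using that Cons.prems refl_seq_closed[of ys] by (auto simp: m_assoc inv_mult_group subset_iff)
  then show ?case
    using Cons by (auto simp: m_assoc)
qed

text \<open>The entries contributed by \<open>ys\<close> are those of its own sequence conjugated by
  the product of \<open>xs\<close>, so the parities form a cocycle for conjugation.\<close>

lemma odd_refl_append:
  assumes "set xs \<subseteq> carrier W" "set ys \<subseteq> carrier W" "t \<in> carrier W"
  shows "odd_refl W (xs @ ys) t \<longleftrightarrow>
    odd_refl W xs t \<noteq> odd_refl W ys (inv (wp xs) \<otimes> t \<otimes> wp xs)"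
proof -
  let ?x = "wp xs"
  have x: "?x \<in> carrier W" using assms by blast
  have "count_list (map (\<lambda>t. ?x \<otimes> t \<otimes> inv ?x) us) t = count_list us (inv ?x \<otimes> t \<otimes> ?x)"
    if "set us \<subseteq> carrier W" for us
    using that
  proof (induction us)
    case (Cons u us)
    then show ?case
      using conj_eq_iff[of ?x t u] x assms by simp
  qed simp
  then show ?thesis
    using assms refl_seq_closed[of ys] by (simp add: odd_refl_def refl_seq_append)
qed

lemma wp_replicate:
  assumes "s \<in> carrier W" "t \<in> carrier W"
  shows "wp (concat (replicate k [s, t])) = (s \<otimes> t) [^] k"
proof (induction k)
  case (Suc k)
  have "(s \<otimes> t) [^] Suc k = s \<otimes> t \<otimes> (s \<otimes> t) [^] k"
    using assms by (intro nat_pow_Suc2) simp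
  then show ?case
    using assms Suc by (simp add: m_assoc del: nat_pow_Suc)
qed simp

text \<open>These are the reflections of the dihedral group of \<open>s\<close> and
  \<open>t\<close>, listed as alternating words of odd length; prepending \<open>s, t\<close> shifts
  the index by two.\<close>

lemma refl_seq_replicate:
  assumes "s \<in> S" "t \<in> S"
  shows "refl_seq W (concat (replicate k [s, t])) = map (\<lambda>j. (s \<otimes> t) [^] j \<otimes> s) [0..<2*k]"
proof (induction k)
  case (Suc k)
  define f where "f = (\<lambda>j. (s \<otimes> t) [^] (j::nat) \<otimes> s)"
  have c: "s \<in> carrier W" "t \<in> carrier W" using assms by auto
  have f0: "f 0 = s" and f1: "f 1 = s \<otimes> t \<otimes> inv s"
    using c assms by (simp_all add: f_def)
  have fSS: "f (Suc (Suc j)) = s \<otimes> (t \<otimes> f j \<otimes> inv t) \<otimes> inv s" for j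
  proof -
    have "(s \<otimes> t) [^] Suc (Suc j) = s \<otimes> t \<otimes> (s \<otimes> t) [^] Suc j"
      using c by (intro nat_pow_Suc2) simp
    then have "f (Suc (Suc j)) = s \<otimes> t \<otimes> ((s \<otimes> t) [^] j \<otimes> (s \<otimes> t)) \<otimes> s"
      by (simp add: f_def)
    then show ?thesis
      using c assms by (simp add: f_def m_assoc)
  qed
  have "[0..<2 * Suc k] = 0 # 1 # map (\<lambda>j. Suc (Suc j)) [0..<2*k]"
  proof -
    have "map (\<lambda>j. Suc (Suc j)) [0..<2*k] = map Suc (map Suc [0..<2*k])"
      by simp
    also have "\<dots> = [2..<2 * Suc k]"
      unfolding map_Suc_upt by (simp add: numeral_2_eq_2)
    finally show ?thesis
      by (simp add: upt_conv_Cons numeral_2_eq_2)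
  qed
  then have "map f [0..<2 * Suc k] = f 0 # f 1 # map (\<lambda>j. f (Suc (Suc j))) [0..<2*k]"
    by simp
  also have "\<dots> = refl_seq W (s # t # concat (replicate k [s, t]))"
    using Suc unfolding f0 f1 fSS f_def[symmetric] by simp
  finally show ?case by (simp add: f_def)
qed simp

text \<open>The list has length \<open>2 m\<close> and period \<open>m\<close>, because
  \<open>(s t)^m = 1\<close>, so it is one list written twice.\<close>

lemma odd_refl_relator:
  assumes "s \<in> S" "t \<in> S"
  shows "\<not> odd_refl W (concat (replicate (ord (s \<otimes> t)) [s, t])) u"
proof -
  let ?m = "ord (s \<otimes> t)" and ?f = "\<lambda>j. (s \<otimes> t) [^] (j::nat) \<otimes> s"
  have r: "s \<otimes> t \<in> carrier W" using assms by auto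
  have "[0..<2 * ?m] = [0..<?m] @ map (\<lambda>j. j + ?m) [0..<?m]"
    by (metis add_0 le0 map_add_upt mult_2 upt_add_eq_append)
  moreover have "?f (j + ?m) = ?f j" for j
    using r by (simp add: nat_pow_mult[symmetric])
  ultimately have "map ?f [0..<2 * ?m] = map ?f [0..<?m] @ map ?f [0..<?m]"
    by simp
  then show ?thesis
    unfolding odd_refl_def refl_seq_replicate[OF assms] by simp
qed

lemma congruent_words: "coxeter_congruent W S xs ys \<Longrightarrow> set xs \<subseteq> S \<and> set ys \<subseteq> S"
proof (induction rule: coxeter_congruent.induct)
  case (relator s t)
  then show ?case by auto
qed auto

lemma congruent_wp: "coxeter_congruent W S xs ys \<Longrightarrow> wp xs = wp ys"
proof (induction rule: coxeter_congruent.induct)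
  case (relator s t)
  then show ?case
    using wp_replicate pow_ord_eq_1[of "s \<otimes> t"] by auto
next
  case (append xs xs' ys ys')
  then show ?case
    using congruent_words words_carrier by (metis wp_append)
qed auto

lemma congruent_odd_refl:
  "coxeter_congruent W S xs ys \<Longrightarrow> u \<in> carrier W \<Longrightarrow> odd_refl W xs u = odd_refl W ys u"
proof (induction arbitrary: u rule: coxeter_congruent.induct)
  case (relator s t)
  then show ?case using odd_refl_relator by (simp add: odd_refl_def)
next
  case (append xs xs' ys ys')
  have w: "set xs \<subseteq> S" "set xs' \<subseteq> S" "set ys \<subseteq> S" "set ys' \<subseteq> S"
    using append congruent_words by blast+
  have "wp xs = wp xs'" using append congruent_wp by blast
  then show ?case
    using append w by (simp add: odd_refl_append words_carrier)
qed auto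

text \<open>Any word for \<open>w\<close> gives the same parity; this is where the presentation of
  the group enters (\<open>inversion_wp\<close>). For a reflection \<open>t\<close> the meaning
  turns out to be that \<open>t w\<close> is shorter than \<open>w\<close>.\<close>

definition inversion :: "'a \<Rightarrow> 'a \<Rightarrow> bool"
  where "inversion w t \<longleftrightarrow> odd_refl W (SOME ss. set ss \<subseteq> S \<and> wp ss = w) t"

lemma inversion_wp:
  assumes "set ss \<subseteq> S" "t \<in> carrier W"
  shows "inversion (wp ss) t = odd_refl W ss t"
proof -
  let ?ss = "SOME xs. set xs \<subseteq> S \<and> wp xs = wp ss"
  have "set ?ss \<subseteq> S \<and> wp ?ss = wp ss"
    by (rule someI[of _ ss]) (use assms in simp)
  then have "coxeter_congruent W S ?ss ss"
    using assms presentation by blast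
  then show ?thesis
    using congruent_odd_refl[OF _ assms(2)] unfolding inversion_def by blast
qed

lemma inversion_mult:
  assumes "x \<in> carrier W" "y \<in> carrier W" "t \<in> carrier W"
  shows "inversion (x \<otimes> y) t \<longleftrightarrow> inversion x t \<noteq> inversion y (inv x \<otimes> t \<otimes> x)"
proof -
  obtain xs ys where w: "set xs \<subseteq> S" "wp xs = x" "set ys \<subseteq> S" "wp ys = y"
    using ex_word assms by metis
  then show ?thesis
    using inversion_wp[of "xs @ ys" t] inversion_wp[of xs t]
      inversion_wp[of ys "inv x \<otimes> t \<otimes> x"] odd_refl_append[of xs ys t] assms
    by (simp add: wp_append words_carrier)
qed

lemma inversion_one [simp]: "t \<in> carrier W \<Longrightarrow> \<not> inversion \<one> t"
  using inversion_wp[of "[]" t] by (simp add: odd_refl_def)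

lemma inversion_S [simp]: "s \<in> S \<Longrightarrow> t \<in> carrier W \<Longrightarrow> inversion s t \<longleftrightarrow> t = s"
  using inversion_wp[of "[s]" t] by (auto simp: odd_refl_def)

abbreviation Refl :: "'a set"
  where "Refl \<equiv> reflections W S"

lemma Refl_carrier [simp, intro]: "t \<in> Refl \<Longrightarrow> t \<in> carrier W"
  by (auto simp: reflections_def)

lemma S_Refl [simp, intro]: "s \<in> S \<Longrightarrow> s \<in> Refl"
  unfolding reflections_def by (rule CollectI, rule exI[of _ \<one>], rule exI[of _ s]) simp

lemma Refl_E:
  assumes "t \<in> Refl"
  obtains y s where "y \<in> carrier W" "s \<in> S" "t = y \<otimes> s \<otimes> inv y"
  using assms unfolding reflections_def by blast

lemma Refl_conj [simp, intro]:
  assumes "t \<in> Refl" "x \<in> carrier W"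
  shows "x \<otimes> t \<otimes> inv x \<in> Refl"
proof -
  obtain y s where "y \<in> carrier W" "s \<in> S" "t = y \<otimes> s \<otimes> inv y"
    using Refl_E[OF assms(1)] by metis
  then have "x \<otimes> t \<otimes> inv x = (x \<otimes> y) \<otimes> s \<otimes> inv (x \<otimes> y) \<and> x \<otimes> y \<in> carrier W \<and> s \<in> S"
    using assms by (simp add: inv_mult_group m_assoc)
  then show ?thesis
    unfolding reflections_def by (intro CollectI exI[of _ "x \<otimes> y"] exI[of _ s])
qed

lemma Refl_square [simp]:
  assumes "t \<in> Refl"
  shows "t \<otimes> t = \<one>"
proof -
  obtain y s where "y \<in> carrier W" "s \<in> S" "t = y \<otimes> s \<otimes> inv y"
    using Refl_E[OF assms(1)] by metis
  then show ?thesis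
    by (simp add: m_assoc)
qed

lemma Refl_inv [simp]: "t \<in> Refl \<Longrightarrow> inv t = t"
  by (simp add: inv_equality)

lemma Refl_cancel [simp]: "t \<in> Refl \<Longrightarrow> x \<in> carrier W \<Longrightarrow> t \<otimes> (t \<otimes> x) = x"
  by (simp flip: m_assoc)

lemma inversion_inv:
  assumes "x \<in> carrier W" "t \<in> carrier W"
  shows "inversion (inv x) (inv x \<otimes> t \<otimes> x) \<longleftrightarrow> inversion x t"
  using inversion_mult[of x "inv x" t] assms by simp

text \<open>Write \<open>t = y s y^-1\<close>. In the cocycle identity the contributions of
  \<open>y\<close> and of \<open>y^-1\<close> cancel, and the middle letter \<open>s\<close> counts
  once.\<close>

lemma inversion_Refl_self:
  assumes "t \<in> Refl"
  shows "inversion t t"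
proof -
  obtain y s where y: "y \<in> carrier W" "s \<in> S" and t: "t = y \<otimes> s \<otimes> inv y"
    using Refl_E[OF assms(1)] by metis
  have 1: "inv y \<otimes> t \<otimes> y = s"
    using y unfolding t by (simp add: m_assoc)
  have 2: "inv (y \<otimes> s) \<otimes> t \<otimes> (y \<otimes> s) = s"
  proof -
    have "inv (y \<otimes> s) \<otimes> t \<otimes> (y \<otimes> s) = s \<otimes> (inv y \<otimes> t \<otimes> y) \<otimes> s"
      using y assms by (simp add: m_assoc inv_mult_group)
    then show ?thesis using y 1 by simp
  qed
  have "inversion t t \<longleftrightarrow> inversion (y \<otimes> s) t \<noteq> inversion (inv y) s"
    using inversion_mult[of "y \<otimes> s" "inv y" t] y assms 2 t by simp
  also have "inversion (y \<otimes> s) t \<longleftrightarrow> inversion y t \<noteq> inversion s s"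
    using inversion_mult[of y s t] y assms 1 by simp
  also have "inversion (inv y) s = inversion y t"
    using inversion_inv[of y t] y assms 1 by simp
  finally show ?thesis using y by simp
qed

text \<open>If \<open>t\<close> is the i-th entry, left multiplication by \<open>t\<close> deletes
  the i-th letter. The remaining letters are among the old ones, which lets the argument run inside
  a subset of the generators.\<close>

lemma strong_exchange_word:
  assumes "set ss \<subseteq> S" "t \<in> set (refl_seq W ss)"
  obtains ys where "set ys \<subseteq> set ss" "length ys < length ss" "wp ys = t \<otimes> wp ss"
proof -
  have "\<exists>ys. set ys \<subseteq> set ss \<and> length ys < length ss \<and> wp ys = t \<otimes> wp ss"
    using assms
  proof (induction ss arbitrary: t)
    case (Cons s ss)
    have c: "s \<in> carrier W" "wp ss \<in> carrier W" using Cons.prems by auto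
    show ?case
    proof (cases "t = s")
      case True
      then show ?thesis using Cons.prems c by (intro exI[of _ ss]) auto
    next
      case False
      then obtain u where u: "u \<in> set (refl_seq W ss)" "t = s \<otimes> u \<otimes> inv s"
        using Cons.prems by auto
      then obtain ys where ys: "set ys \<subseteq> set ss" "length ys < length ss" "wp ys = u \<otimes> wp ss"
        using Cons.IH[OF _ u(1)] Cons.prems(1) by auto
      have "u \<in> carrier W"
        using u(1) refl_seq_closed words_carrier Cons.prems by (meson list.set_intros(2) subset_iff)
      then have "wp (s # ys) = t \<otimes> wp (s # ss)"
        using u ys c Cons.prems by (simp add: m_assoc)
      then show ?thesis using ys by (intro exI[of _ "s # ys"]) auto
    qed
  qed simp
  then show thesis using that by blast
qed

lemma inversion_in_refl_seq:
  assumes "set ss \<subseteq> S" "t \<in> carrier W" "inversion (wp ss) t"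
  shows "t \<in> set (refl_seq W ss)"
  using assms inversion_wp[of ss t] by (metis count_notin odd_refl_def even_zero)

lemma inversion_imp_len:
  assumes "w \<in> carrier W" "t \<in> carrier W" "inversion w t"
  shows "\<ell> (t \<otimes> w) < \<ell> w"
proof -
  obtain ss where ss: "set ss \<subseteq> S" "wp ss = w" "length ss = \<ell> w"
    using reduced_word[OF assms(1)] by metis
  then have "t \<in> set (refl_seq W ss)"
    using inversion_in_refl_seq assms by blast
  then obtain ys where ys: "set ys \<subseteq> set ss" "length ys < length ss" "wp ys = t \<otimes> wp ss"
    using strong_exchange_word ss by blast
  then have "\<ell> (wp ys) \<le> length ys" using len_wp_le[of ys] ss(1) by blast
  then show ?thesis using ys ss by simp
qed

lemma inversion_Refl_mult:
  assumes "w \<in> carrier W" "t \<in> Refl"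
  shows "inversion (t \<otimes> w) t \<longleftrightarrow> \<not> inversion w t"
  using inversion_mult[of t w t] inversion_Refl_self assms by simp

text \<open>Exactly one of \<open>w\<close> and \<open>t w\<close> has \<open>t\<close> as an
  inversion, so \<open>inversion_imp_len\<close>, applied to the one that has it, gives both
  directions.\<close>

lemma inversion_iff_len:
  assumes "w \<in> carrier W" "t \<in> Refl"
  shows "inversion w t \<longleftrightarrow> \<ell> (t \<otimes> w) < \<ell> w"
  using inversion_imp_len[of w t] inversion_imp_len[of "t \<otimes> w" t] inversion_Refl_mult assms
  by fastforce

lemma len_Refl_mult_neq:
  assumes "w \<in> carrier W" "t \<in> Refl"
  shows "\<ell> (t \<otimes> w) \<noteq> \<ell> w"
  using inversion_iff_len[of w t] inversion_iff_len[of "t \<otimes> w" t] inversion_Refl_mult assms by auto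

lemma len_S_mult:
  assumes "w \<in> carrier W" "s \<in> S"
  shows "\<ell> (s \<otimes> w) = (if inversion w s then \<ell> w - 1 else \<ell> w + 1)"
    "inversion w s \<Longrightarrow> \<ell> w = \<ell> (s \<otimes> w) + 1"
  using inversion_iff_len[of w s] len_mult_le[of s w] len_mult_le[of s "s \<otimes> w"]
    len_Refl_mult_neq[of w s] assms
  by auto

lemma inversion_iff_len_S:
  assumes "w \<in> carrier W" "s \<in> S"
  shows "\<ell> (s \<otimes> w) < \<ell> w \<longleftrightarrow> inversion w s" "\<ell> w < \<ell> (s \<otimes> w) \<longleftrightarrow> \<not> inversion w s"
  using len_S_mult[OF assms] by auto

lemma len_induct [consumes 1, case_names one step]:
  assumes "w \<in> carrier W"
    and "P \<one>"
    and "\<And>s w. s \<in> S \<Longrightarrow> w \<in> carrier W \<Longrightarrow> \<not> inversion w s \<Longrightarrow> P w \<Longrightarrow> P (s \<otimes> w)"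
  shows "P w"
  using assms(1)
proof (induction "\<ell> w" arbitrary: w)
  case 0
  then show ?case using len_eq_0_iff assms(2) by metis
next
  case (Suc n)
  obtain ss where ss: "set ss \<subseteq> S" "wp ss = w" "length ss = \<ell> w"
    using reduced_word[OF Suc.prems] by metis
  then obtain s xs where xs: "ss = s # xs" using Suc by (cases ss) auto
  have s: "s \<in> S" and x: "wp xs \<in> carrier W" using ss xs by auto
  have w: "w = s \<otimes> wp xs" using ss xs by simp
  have "\<ell> (wp xs) \<le> n" using len_wp_le[of xs] ss xs Suc by simp
  then have "\<not> inversion (wp xs) s" "\<ell> (wp xs) = n"
    using len_S_mult[OF x s] Suc(2) w by (auto split: if_splits)
  then show ?case using assms(3) s x Suc(1) w by auto
qed

lemma ex_descent:
  assumes "w \<in> carrier W" "w \<noteq> \<one>"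
  obtains s where "s \<in> S" "inversion w s"
  using assms(1,2)
proof (induction rule: len_induct)
  case (step s w)
  then show ?case using inversion_Refl_mult[of w s] by auto
qed simp

section \<open>The Bruhat order\<close>

abbreviation bless :: "'a \<Rightarrow> 'a \<Rightarrow> bool" (infix \<open>\<prec>\<^sub>B\<close> 50)
  where "y \<prec>\<^sub>B w \<equiv> bruhat_less W S y w"

lemma bless_step: "x \<in> carrier W \<Longrightarrow> t \<in> Refl \<Longrightarrow> \<ell> x < \<ell> (t \<otimes> x) \<Longrightarrow> x \<prec>\<^sub>B t \<otimes> x"
  unfolding bruhat_less_def by (rule r_into_trancl) blast

lemma bless_trans: "x \<prec>\<^sub>B y \<Longrightarrow> y \<prec>\<^sub>B z \<Longrightarrow> x \<prec>\<^sub>B z"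
  unfolding bruhat_less_def by (rule trancl_trans)

lemma bless_induct [consumes 1, case_names base step]:
  assumes "y \<prec>\<^sub>B w"
    and "\<And>t. t \<in> Refl \<Longrightarrow> y \<in> carrier W \<Longrightarrow> \<ell> y < \<ell> (t \<otimes> y) \<Longrightarrow> P (t \<otimes> y)"
    and "\<And>t x. t \<in> Refl \<Longrightarrow> x \<in> carrier W \<Longrightarrow> y \<prec>\<^sub>B x \<Longrightarrow> \<ell> x < \<ell> (t \<otimes> x) \<Longrightarrow> P x \<Longrightarrow>
      P (t \<otimes> x)"
  shows "P w"
  using assms(1) unfolding bruhat_less_def
proof (induction rule: trancl_induct)
  case (base z)
  then show ?case using assms(2) by auto
next
  case (step x z)
  then show ?case using assms(3)[unfolded bruhat_less_def] by auto
qed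

lemma bless_imp: "y \<prec>\<^sub>B w \<Longrightarrow> y \<in> carrier W \<and> w \<in> carrier W \<and> \<ell> y < \<ell> w"
proof (induction rule: bless_induct)
  case (step t x)
  then show ?case by auto
qed auto

lemma bless_S_iff: "s \<in> S \<Longrightarrow> z \<in> carrier W \<Longrightarrow> s \<otimes> z \<prec>\<^sub>B z \<longleftrightarrow> inversion z s"
  using bless_step[of "s \<otimes> z" s] bless_imp[of "s \<otimes> z" z] inversion_iff_len_S[of z s]
  by auto

lemma bless_S_iff': "s \<in> S \<Longrightarrow> z \<in> carrier W \<Longrightarrow> z \<prec>\<^sub>B s \<otimes> z \<longleftrightarrow> \<not> inversion z s"
  using bless_step[of z s] bless_imp[of z "s \<otimes> z"] inversion_iff_len_S[of z s]
  by auto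

lemma Refl_S_conj:
  assumes "x \<in> carrier W" "t \<in> Refl" "s \<in> S"
  shows "s \<otimes> (t \<otimes> x) = (s \<otimes> t \<otimes> s) \<otimes> (s \<otimes> x)"
  using assms by (simp add: m_assoc)

text \<open>For \<open>t \<noteq> s\<close> the cocycle identity gives \<open>s x\<close> the same
  parity at \<open>s t s\<close> as \<open>x\<close> has at \<open>t\<close>. So multiplying by
  \<open>s\<close> turns the upward step by \<open>t\<close> into an upward step by
  \<open>s t s\<close>.\<close>

lemma bless_lift_step:
  assumes "x \<in> carrier W" "t \<in> Refl" "\<ell> x < \<ell> (t \<otimes> x)" "s \<in> S"
  shows "s \<otimes> x = t \<otimes> x \<or> s \<otimes> x \<prec>\<^sub>B s \<otimes> (t \<otimes> x)"
proof (cases "t = s")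
  case False
  let ?u = "s \<otimes> t \<otimes> s"
  have u: "?u \<in> Refl" using Refl_conj[of t s] assms by simp
  have "?u \<noteq> s"
  proof
    assume "?u = s"
    then have "s \<otimes> ?u \<otimes> s = s \<otimes> s \<otimes> s" by simp
    then show False using assms False by (simp add: m_assoc)
  qed
  moreover have "s \<otimes> ?u \<otimes> s = t" using assms by (simp add: m_assoc)
  ultimately have "inversion (s \<otimes> x) ?u \<longleftrightarrow> inversion x t"
    using inversion_mult[of s x ?u] assms u by simp
  moreover have "\<not> inversion x t" using inversion_iff_len[of x t] assms by auto
  ultimately have "\<not> inversion (s \<otimes> x) ?u" by simp
  then have "\<ell> (s \<otimes> x) < \<ell> (?u \<otimes> (s \<otimes> x))"
    using inversion_iff_len[of "s \<otimes> x" ?u] len_Refl_mult_neq[of "s \<otimes> x" ?u] assms u by fastforce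
  then show ?thesis
    using bless_step[of "s \<otimes> x" ?u] Refl_S_conj assms u by simp
qed simp

lemma bless_lift:
  assumes "y \<prec>\<^sub>B w" "s \<in> S"
  shows "s \<otimes> y \<prec>\<^sub>B s \<otimes> w \<or> s \<otimes> y \<prec>\<^sub>B w \<or> s \<otimes> y = w"
  using assms
proof (induction rule: bless_induct)
  case (base t)
  then show ?case using bless_lift_step by blast
next
  case (step t x)
  have tx: "x \<prec>\<^sub>B t \<otimes> x" using step bless_step by blast
  from step.IH[OF step.prems] show ?case
  proof (elim disjE)
    assume "s \<otimes> y \<prec>\<^sub>B s \<otimes> x"
    then show ?thesis using bless_lift_step[of x t s] step bless_trans by metis
  qed (use tx bless_trans in blast)+
qed

lemma bless_lift_up:
  assumes "y \<prec>\<^sub>B w" "s \<in> S" "\<not> inversion w s"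
  shows "y \<prec>\<^sub>B s \<otimes> w" "s \<otimes> y \<prec>\<^sub>B s \<otimes> w"
  using bless_lift[OF assms(1,2)] bless_S_iff'[of s w] assms bless_imp[OF assms(1)] bless_trans
  by blast+

end

locale finite_coxeter = coxeter W S for W (structure) and S +
  assumes fin: "finite (carrier W)"

section \<open>The Hecke algebra over a commutative ring\<close>

abbreviation co :: "('a \<Rightarrow>\<^sub>0 'r::zero) \<Rightarrow> 'a \<Rightarrow> 'r"
  where "co \<equiv> Poly_Mapping.lookup"

definition scale :: "'r::comm_ring_1 \<Rightarrow> ('a \<Rightarrow>\<^sub>0 'r) \<Rightarrow> ('a \<Rightarrow>\<^sub>0 'r)"
  where "scale c h = Poly_Mapping.map ((*) c) h"

lemma lookup_scale [simp]: "co (scale c h) x = c * co h x"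
  unfolding scale_def by transfer (simp add: when_def)

lemma scale_add: "scale c (a + b) = scale c a + scale c b"
  and add_scale: "scale (c + d) a = scale c a + scale d a"
  and diff_scale: "scale (c - d) a = scale c a - scale d a"
  and minus_scale: "scale (- c) a = - scale c a"
  and scale_scale: "scale c (scale d a) = scale (c * d) a"
  and scale_one [simp]: "scale 1 a = a"
  and scale_0_left [simp]: "scale 0 a = 0"
  and scale_0_right [simp]: "scale c 0 = 0"
  and scale_single [simp]: "scale c (Poly_Mapping.single x r) = Poly_Mapping.single x (c * r)"
  by (auto intro!: poly_mapping_eqI
      simp: lookup_add lookup_minus algebra_simps lookup_single when_def)

lemma scale_sum: "scale c (sum f I) = (\<Sum>i\<in>I. scale c (f i))"
  by (induction I rule: infinite_finite_induct) (simp_all add: scale_add)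

definition lin :: "(('a \<Rightarrow>\<^sub>0 'r::comm_ring_1) \<Rightarrow> ('a \<Rightarrow>\<^sub>0 'r)) \<Rightarrow> bool"
  where "lin F \<longleftrightarrow> (\<forall>a b. F (a + b) = F a + F b) \<and> (\<forall>c a. F (scale c a) = scale c (F a))"

lemma lin_add: "lin F \<Longrightarrow> F (a + b) = F a + F b"
  and lin_scale: "lin F \<Longrightarrow> F (scale c a) = scale c (F a)"
  by (simp_all add: lin_def)

lemma lin_zero: "lin F \<Longrightarrow> F 0 = 0"
  using lin_scale[of F 0 0] by simp

lemma lin_minus: "lin F \<Longrightarrow> F (- a) = - F a"
  using lin_scale[of F "- 1" a] by (simp add: minus_scale)

lemma lin_diff: "lin F \<Longrightarrow> F (a - b) = F a - F b"
  using lin_add[of F a "- b"] by (simp add: lin_minus)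

lemma lin_sum: "lin F \<Longrightarrow> F (sum f I) = (\<Sum>i\<in>I. F (f i))"
  by (induction I rule: infinite_finite_induct) (simp_all add: lin_add lin_zero)

text \<open>Coefficients lie in any commutative ring in which \<open>q s\<close> is invertible, so
  the algebra is separated from the ordered group. Conjugacy is phrased as \<open>s x = x t\<close>
  because exactly then left and right multiplication by generators interfere.\<close>

locale hecke = finite_coxeter W S for W (structure) and S +
  fixes q qi :: "'a \<Rightarrow> 'r::comm_ring_1"
  assumes q_qi: "s \<in> S \<Longrightarrow> q s * qi s = 1"
    and q_conj: "s \<in> S \<Longrightarrow> t \<in> S \<Longrightarrow> x \<in> carrier W \<Longrightarrow> s \<otimes> x = x \<otimes> t \<Longrightarrow>
      q s = q t \<and> qi s = qi t"
begin

definition \<xi> :: "'a \<Rightarrow> 'r"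
  where "\<xi> s = q s - qi s"

definition mk :: "('a \<Rightarrow> 'r) \<Rightarrow> ('a \<Rightarrow>\<^sub>0 'r)"
  where "mk f = (\<Sum>x\<in>carrier W. Poly_Mapping.single x (f x))"

definition Hc :: "('a \<Rightarrow>\<^sub>0 'r) set"
  where "Hc = {h. Poly_Mapping.keys h \<subseteq> carrier W}"

definition T :: "'a \<Rightarrow> ('a \<Rightarrow>\<^sub>0 'r)"
  where "T w = Poly_Mapping.single w 1"

lemma lookup_T: "co (T w) x = (if x = w then 1 else 0)"
  by (simp add: T_def lookup_single when_def)

lemma lookup_mk [simp]: "co (mk f) x = (if x \<in> carrier W then f x else 0)"
  by (simp add: mk_def lookup_sum lookup_single when_def fin)

lemma Hc_iff: "h \<in> Hc \<longleftrightarrow> (\<forall>x. x \<notin> carrier W \<longrightarrow> co h x = 0)"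
  by (auto simp: Hc_def in_keys_iff)

lemma Hc_lookup: "h \<in> Hc \<Longrightarrow> x \<notin> carrier W \<Longrightarrow> co h x = 0"
  by (simp add: Hc_iff)

lemma Hc_closed [simp, intro]:
  "0 \<in> Hc" "a \<in> Hc \<Longrightarrow> b \<in> Hc \<Longrightarrow> a + b \<in> Hc" "a \<in> Hc \<Longrightarrow> b \<in> Hc \<Longrightarrow> a - b \<in> Hc"
  "a \<in> Hc \<Longrightarrow> - a \<in> Hc" "a \<in> Hc \<Longrightarrow> scale c a \<in> Hc" "mk f \<in> Hc" "w \<in> carrier W \<Longrightarrow> T w \<in> Hc"
  by (auto simp: Hc_iff lookup_add lookup_minus lookup_T)

lemma Hc_sum [intro]: "(\<And>i. i \<in> I \<Longrightarrow> f i \<in> Hc) \<Longrightarrow> sum f I \<in> Hc"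
  by (induction I rule: infinite_finite_induct) auto

lemma Hc_eqI:
  assumes "a \<in> Hc" "b \<in> Hc"
    and "\<And>x. x \<in> carrier W \<Longrightarrow> co a x = co b x"
  shows "a = b"
  by (rule poly_mapping_eqI) (metis assms Hc_lookup)

lemma Hc_expand:
  assumes "h \<in> Hc"
  shows "h = (\<Sum>w\<in>carrier W. scale (co h w) (T w))"
  by (rule Hc_eqI) (use assms fin in \<open>auto simp: lookup_sum lookup_T if_distrib cong: if_cong\<close>)

lemma lin_eqI:
  assumes "lin F" "lin G" "\<And>w. w \<in> carrier W \<Longrightarrow> F (T w) = G (T w)" "h \<in> Hc"
  shows "F h = G h"
proof -
  have "F h = (\<Sum>w\<in>carrier W. scale (co h w) (F (T w)))"
    by (subst Hc_expand[OF assms(4)]) (simp add: lin_sum lin_scale assms(1))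
  also have "\<dots> = (\<Sum>w\<in>carrier W. scale (co h w) (G (T w)))"
    using assms(3) by simp
  also have "\<dots> = G h"
    by (subst (2) Hc_expand[OF assms(4)]) (simp add: lin_sum lin_scale assms(2))
  finally show ?thesis .
qed

text \<open>\<open>lam s\<close> and \<open>rho s\<close> are the left and right multiplications by \<open>T\<^sub>s\<close> in coordinates.\<close>

definition lam :: "'a \<Rightarrow> ('a \<Rightarrow>\<^sub>0 'r) \<Rightarrow> ('a \<Rightarrow>\<^sub>0 'r)"
  where "lam s h = mk (\<lambda>x. co h (s \<otimes> x) +
    (if inversion x s then \<xi> s * co h x else 0))"

definition rho :: "'a \<Rightarrow> ('a \<Rightarrow>\<^sub>0 'r) \<Rightarrow> ('a \<Rightarrow>\<^sub>0 'r)"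
  where "rho s h = mk (\<lambda>x. co h (x \<otimes> s) +
    (if inversion (inv x) s then \<xi> s * co h x else 0))"

lemma lookup_lam: "x \<in> carrier W \<Longrightarrow> co (lam s h) x =
    co h (s \<otimes> x) + (if inversion x s then \<xi> s * co h x else 0)"
  by (simp add: lam_def)

lemma lookup_rho: "x \<in> carrier W \<Longrightarrow> co (rho s h) x =
    co h (x \<otimes> s) +
    (if inversion (inv x) s then \<xi> s * co h x else 0)"
  by (simp add: rho_def)

lemma lam_Hc [simp, intro]: "lam s h \<in> Hc"
  and rho_Hc [simp, intro]: "rho s h \<in> Hc"
  by (simp_all add: lam_def rho_def)

lemma lin_lam: "lin (lam s)"
  unfolding lin_def by (auto intro!: Hc_eqI simp: lookup_lam lookup_add algebra_simps)

lemma lin_rho: "lin (rho s)"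
  unfolding lin_def by (auto intro!: Hc_eqI simp: lookup_rho lookup_add algebra_simps)

lemma S_mult_eq_iff:
  assumes "s \<in> S" "x \<in> carrier W" "y \<in> carrier W"
  shows "s \<otimes> x = y \<longleftrightarrow> x = s \<otimes> y" "x \<otimes> s = y \<longleftrightarrow> x = y \<otimes> s"
  using assms by auto

lemma inversion_S_mult: "x \<in> carrier W \<Longrightarrow> s \<in> S \<Longrightarrow> inversion (s \<otimes> x) s \<longleftrightarrow> \<not> inversion x s"
  by (simp add: inversion_Refl_mult)

lemma lam_T:
  assumes "s \<in> S" "w \<in> carrier W"
  shows "lam s (T w) = (if inversion w s then T (s \<otimes> w) + scale (\<xi> s) (T w) else T (s \<otimes> w))"
  by (rule Hc_eqI) (use assms S_mult_eq_iff[of s] in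
      \<open>auto simp: lookup_lam lookup_T lookup_add\<close>)

lemma rho_T:
  assumes "s \<in> S" "w \<in> carrier W"
  shows "rho s (T w) =
    (if inversion (inv w) s then T (w \<otimes> s) + scale (\<xi> s) (T w) else T (w \<otimes> s))"
  by (rule Hc_eqI) (use assms S_mult_eq_iff[of s] in
      \<open>auto simp: lookup_rho lookup_T lookup_add\<close>)

text \<open>Multiplying by a generator on one side changes a descent on the other side only if the
  two moves coincide, \<open>s x = x t\<close>; all three claims are cocycle identities.\<close>

lemma inversion_left_right:
  assumes "s \<in> S" "t \<in> S" "x \<in> carrier W"
  shows "inversion (inv (s \<otimes> x)) t \<longleftrightarrow> (inversion (inv x) t \<noteq> (s \<otimes> x = x \<otimes> t))"
    and "inversion (x \<otimes> t) s \<longleftrightarrow> (inversion x s \<noteq> (s \<otimes> x = x \<otimes> t))"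
    and "s \<otimes> x = x \<otimes> t \<Longrightarrow> inversion (inv x) t \<longleftrightarrow> inversion x s"
proof -
  have c: "s \<in> carrier W" "t \<in> carrier W" using assms by auto
  have e1: "x \<otimes> t \<otimes> inv x = s \<longleftrightarrow> s \<otimes> x = x \<otimes> t"
    using assms c by (metis inv_solve_right m_closed)
  have e2: "inv x \<otimes> s \<otimes> x = t \<longleftrightarrow> s \<otimes> x = x \<otimes> t"
    using assms c by (metis e1 conj_eq_iff)
  have "inversion (inv x \<otimes> s) t \<longleftrightarrow> (inversion (inv x) t \<noteq> (x \<otimes> t \<otimes> inv x = s))"
    using inversion_mult[of "inv x" s t] assms c by simp
  then show "inversion (inv (s \<otimes> x)) t \<longleftrightarrow> (inversion (inv x) t \<noteq> (s \<otimes> x = x \<otimes> t))"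
    using assms c e1 by (simp add: inv_mult_group)
  show "inversion (x \<otimes> t) s \<longleftrightarrow> (inversion x s \<noteq> (s \<otimes> x = x \<otimes> t))"
    using inversion_mult[of x t s] assms c e2 by simp
  show "inversion (inv x) t \<longleftrightarrow> inversion x s" if "s \<otimes> x = x \<otimes> t"
    using inversion_inv[of x s] assms c e2 that by simp
qed

text \<open>Compare coordinates. Outside the case \<open>s x = x t\<close> the two descent
  conditions are independent and the terms match; in that case \<open>s\<close> and \<open>t\<close>
  are conjugate, so their parameters agree.\<close>

lemma lam_rho:
  assumes "s \<in> S" "t \<in> S"
  shows "lam s (rho t h) = rho t (lam s h)"
proof (rule Hc_eqI)
  fix x assume x: "x \<in> carrier W"
  have c: "s \<otimes> x \<in> carrier W" "x \<otimes> t \<in> carrier W" using assms x by auto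
  have \<xi>: "\<xi> s = \<xi> t" if "s \<otimes> x = x \<otimes> t"
    using q_conj[OF assms x that] by (simp add: \<xi>_def)
  have sxx: "s \<otimes> x \<otimes> t = s \<otimes> (x \<otimes> t)" using assms x by (simp add: m_assoc)
  show "co (lam s (rho t h)) x = co (rho t (lam s h)) x"
    unfolding lookup_lam[OF x] lookup_rho[OF x] lookup_lam[OF c(2)] lookup_rho[OF c(1)]
      inversion_left_right(1,2)[OF assms x] sxx
    using inversion_left_right(3)[OF assms x] \<xi>
    by (cases "s \<otimes> x = x \<otimes> t") (auto simp: algebra_simps)
qed auto

section \<open>The product and its associativity\<close>

definition commutant :: "(('a \<Rightarrow>\<^sub>0 'r) \<Rightarrow> ('a \<Rightarrow>\<^sub>0 'r)) set"
  where "commutant = {F. lin F \<and> (\<forall>t\<in>S. \<forall>h. F (rho t h) = rho t (F h))}"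

text \<open>Yields associativity: for fixed \<open>a\<close> and \<open>b\<close>, both \<open>(a b) c\<close> and \<open>a (b c)\<close> commute in \<open>c\<close> with
  all right multiplications.\<close>

lemma commutant_eqI:
  assumes "F \<in> commutant" "G \<in> commutant" "F (T \<one>) = G (T \<one>)" "h \<in> Hc"
  shows "F h = G h"
proof (rule lin_eqI[of F G])
  fix w assume w: "w \<in> carrier W"
  have "F (T (inv u)) = G (T (inv u))" if "u \<in> carrier W" for u
    using that
  proof (induction rule: len_induct)
    case (step s u)
    have "T (inv (s \<otimes> u)) = rho s (T (inv u))"
      using step by (simp add: rho_T inv_mult_group)
    then show ?case
      using step assms unfolding commutant_def by simp
  qed (simp add: assms)
  from this[of "inv w"] show "F (T w) = G (T w)" using w by simp
qed (use assms in \<open>auto simp: commutant_def\<close>)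

text \<open>A reduced word is chosen, but the result on \<open>Hc\<close> is independent of it:
  \<open>op w\<close> commutes with right multiplications and sends \<open>T \<one>\<close> to
  \<open>T w\<close>, and these two facts determine it.\<close>

definition op :: "'a \<Rightarrow> ('a \<Rightarrow>\<^sub>0 'r) \<Rightarrow> ('a \<Rightarrow>\<^sub>0 'r)"
  where "op w = foldr lam (SOME ss. set ss \<subseteq> S \<and> wp ss = w \<and> length ss = \<ell> w)"

definition mult :: "('a \<Rightarrow>\<^sub>0 'r) \<Rightarrow> ('a \<Rightarrow>\<^sub>0 'r) \<Rightarrow> ('a \<Rightarrow>\<^sub>0 'r)" (infixl \<open>\<star>\<close> 70)
  where "a \<star> b = (\<Sum>w\<in>carrier W. scale (co a w) (op w b))"

lemma op_word:
  assumes "w \<in> carrier W"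
  obtains ss where "set ss \<subseteq> S" "wp ss = w" "length ss = \<ell> w" "op w = foldr lam ss"
proof -
  let ?ss = "SOME ss. set ss \<subseteq> S \<and> wp ss = w \<and> length ss = \<ell> w"
  have "\<exists>ss. set ss \<subseteq> S \<and> wp ss = w \<and> length ss = \<ell> w"
    using reduced_word[OF assms] by metis
  from someI_ex[OF this] show thesis
    by (intro that[of ?ss]) (auto simp: op_def)
qed

lemma commutant_foldr:
  assumes "set ss \<subseteq> S"
  shows "foldr lam ss \<in> commutant"
proof -
  have "lin (foldr lam ss)"
    by (induction ss) (simp_all add: lin_def lin_add[OF lin_lam] lin_scale[OF lin_lam])
  moreover have "foldr lam ss (rho t h) = rho t (foldr lam ss h)" if "t \<in> S" for t h
    using assms by (induction ss) (use that in \<open>simp_all add: lam_rho\<close>)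
  ultimately show ?thesis unfolding commutant_def by blast
qed

lemma op_commutant: "w \<in> carrier W \<Longrightarrow> op w \<in> commutant"
  by (metis op_word commutant_foldr)

lemma lin_op: "w \<in> carrier W \<Longrightarrow> lin (op w)"
  using op_commutant unfolding commutant_def by blast

lemma foldr_lam_T_one:
  "set ss \<subseteq> S \<Longrightarrow> length ss = \<ell> (wp ss) \<Longrightarrow> foldr lam ss (T \<one>) = T (wp ss)"
proof (induction ss)
  case (Cons s ss)
  have s: "s \<in> S" "set ss \<subseteq> S" "wp ss \<in> carrier W" using Cons.prems by auto
  have "\<not> inversion (wp ss) s" "length ss = \<ell> (wp ss)"
    using len_S_mult[OF s(3,1)] len_wp_le[OF s(2)] Cons.prems by (auto split: if_splits)
  then show ?case using Cons s by (simp add: lam_T)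
qed simp

lemma op_T_one: "w \<in> carrier W \<Longrightarrow> op w (T \<one>) = T w"
  by (metis op_word foldr_lam_T_one)

lemma op_one: "op \<one> h = h"
proof -
  obtain ss where "set ss \<subseteq> S" "wp ss = \<one>" "length ss = \<ell> \<one>" "op \<one> = foldr lam ss"
    using op_word[OF one_closed] by metis
  then show ?thesis by simp
qed

lemma op_S:
  assumes "s \<in> S"
  shows "op s = lam s"
proof -
  obtain ss where ss: "set ss \<subseteq> S" "wp ss = s" "length ss = \<ell> s" "op s = foldr lam ss"
    using op_word[of s] assms by blast
  then obtain t where "ss = [t]" using assms by (auto simp: length_Suc_conv)
  then show ?thesis using ss by auto
qed

lemma op_Hc:
  assumes "w \<in> carrier W" "h \<in> Hc"
  shows "op w h \<in> Hc"
proof -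
  obtain ss where "set ss \<subseteq> S" "op w = foldr lam ss"
    using op_word[OF assms(1)] by metis
  then show ?thesis using assms by (cases ss) auto
qed

lemma mult_Hc [simp, intro]: "b \<in> Hc \<Longrightarrow> a \<star> b \<in> Hc"
  unfolding mult_def using op_Hc by auto

lemma lin_mult_right: "lin (\<lambda>b. a \<star> b)"
  unfolding lin_def mult_def
  by (simp add: lin_add[OF lin_op] lin_scale[OF lin_op] scale_add sum.distrib scale_sum
      scale_scale mult.commute)

lemma lin_mult_left: "lin (\<lambda>a. a \<star> b)"
  unfolding lin_def mult_def
  by (simp add: lookup_add add_scale sum.distrib scale_sum scale_scale)

lemmas mult_add_right = lin_add[OF lin_mult_right]
  and mult_add_left = lin_add[OF lin_mult_left]
  and mult_scale_right = lin_scale[OF lin_mult_right]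
  and mult_scale_left = lin_scale[OF lin_mult_left]
  and mult_diff_right = lin_diff[OF lin_mult_right]
  and mult_diff_left = lin_diff[OF lin_mult_left]
  and mult_sum_right = lin_sum[OF lin_mult_right]
  and mult_sum_left = lin_sum[OF lin_mult_left]
  and mult_0_right [simp] = lin_zero[OF lin_mult_right]
  and mult_0_left [simp] = lin_zero[OF lin_mult_left]

lemma mult_rho:
  assumes "t \<in> S"
  shows "a \<star> rho t h = rho t (a \<star> h)"
  using assms op_commutant unfolding mult_def commutant_def
  by (simp add: lin_sum[OF lin_rho] lin_scale[OF lin_rho])

lemma mult_commutant: "(\<lambda>b. a \<star> b) \<in> commutant"
  using lin_mult_right mult_rho unfolding commutant_def by blast

lemma mult_T_one [simp]: "a \<in> Hc \<Longrightarrow> a \<star> T \<one> = a"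
  using Hc_expand[of a] by (simp add: mult_def op_T_one)

lemma T_mult: "w \<in> carrier W \<Longrightarrow> T w \<star> b = op w b"
proof -
  assume w: "w \<in> carrier W"
  have "T w \<star> b = (\<Sum>x\<in>carrier W. if x = w then op w b else 0)"
    unfolding mult_def by (rule sum.cong) (auto simp: lookup_T)
  then show ?thesis using w fin by simp
qed

lemma T_one_mult [simp]: "T \<one> \<star> b = b"
  by (simp add: T_mult op_one)

lemma T_S_mult: "s \<in> S \<Longrightarrow> T s \<star> b = lam s b"
  by (simp add: T_mult op_S)

lemma mult_assoc:
  assumes "b \<in> Hc" "c \<in> Hc"
  shows "(a \<star> b) \<star> c = a \<star> (b \<star> c)"
proof (rule commutant_eqI[of "\<lambda>c. (a \<star> b) \<star> c" "\<lambda>c. a \<star> (b \<star> c)"])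
  show "(\<lambda>c. a \<star> (b \<star> c)) \<in> commutant"
    unfolding commutant_def lin_def
    by (simp add: mult_rho mult_add_right mult_scale_right)
qed (use assms mult_commutant in auto)

lemma mult_T_S:
  assumes "a \<in> Hc" "s \<in> S"
  shows "a \<star> T s = rho s a"
  using mult_rho[of s a "T \<one>"] rho_T[of s \<one>] assms by simp

lemma T_S_mult_T:
  "s \<in> S \<Longrightarrow> w \<in> carrier W \<Longrightarrow> \<not> inversion w s \<Longrightarrow> T s \<star> T w = T (s \<otimes> w)"
  "s \<in> S \<Longrightarrow> w \<in> carrier W \<Longrightarrow> inversion w s \<Longrightarrow>
    T s \<star> T w = T (s \<otimes> w) + scale (\<xi> s) (T w)"
  by (simp_all add: T_S_mult lam_T)

lemma T_mult_T_S:
  "s \<in> S \<Longrightarrow> w \<in> carrier W \<Longrightarrow> \<not> inversion (inv w) s \<Longrightarrow> T w \<star> T s = T (w \<otimes> s)"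
  by (simp add: mult_T_S rho_T)

section \<open>Inverses of the standard basis\<close>

text \<open>The inverse of \<open>T s\<close>, read off from the quadratic relation
  \<open>T_S_square\<close>.\<close>

definition Ti :: "'a \<Rightarrow> ('a \<Rightarrow>\<^sub>0 'r)"
  where "Ti s = T s - scale (\<xi> s) (T \<one>)"

lemma Ti_Hc [simp, intro]: "s \<in> S \<Longrightarrow> Ti s \<in> Hc"
  by (simp add: Ti_def)

lemma T_S_square: "s \<in> S \<Longrightarrow> T s \<star> T s = T \<one> + scale (\<xi> s) (T s)"
  by (simp add: T_S_mult_T)

lemma T_Ti [simp]: "s \<in> S \<Longrightarrow> T s \<star> Ti s = T \<one>" "s \<in> S \<Longrightarrow> Ti s \<star> T s = T \<one>"
  by (simp_all add: Ti_def mult_diff_right mult_diff_left mult_scale_right mult_scale_left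
      T_S_square)

lemma Ti_mult: "s \<in> S \<Longrightarrow> Ti s \<star> h = lam s h - scale (\<xi> s) h"
  by (simp add: Ti_def mult_diff_left mult_scale_left T_S_mult)

lemma Ti_square: "s \<in> S \<Longrightarrow> Ti s \<star> Ti s = T \<one> - scale (\<xi> s) (Ti s)"
  using mult_diff_right[of "Ti s" "T s" "scale (\<xi> s) (T \<one>)"]
  by (simp add: Ti_def[symmetric] mult_scale_right)

definition is_inverse :: "('a \<Rightarrow>\<^sub>0 'r) \<Rightarrow> ('a \<Rightarrow>\<^sub>0 'r) \<Rightarrow> bool"
  where "is_inverse a b \<longleftrightarrow> b \<in> Hc \<and> a \<star> b = T \<one> \<and> b \<star> a = T \<one>"

lemma is_inverse_unique:
  assumes "a \<in> Hc" "is_inverse a b" "is_inverse a c"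
  shows "b = c"
proof -
  have "b = b \<star> (a \<star> c)" using assms by (simp add: is_inverse_def)
  also have "\<dots> = c" using assms mult_assoc[of a c b] by (simp add: is_inverse_def)
  finally show ?thesis .
qed

text \<open>The prescribed image of \<open>T w\<close> under the bar involution, built before the
  involution itself.\<close>

definition Tbar :: "'a \<Rightarrow> ('a \<Rightarrow>\<^sub>0 'r)"
  where "Tbar w = (THE b. is_inverse (T (inv w)) b)"

lemma is_inverse_step:
  assumes "s \<in> S" "u \<in> carrier W" "\<not> inversion u s" "is_inverse (T (inv u)) b"
  shows "is_inverse (T (inv (s \<otimes> u))) (Ti s \<star> b)"
proof -
  have b: "b \<in> Hc" "T (inv u) \<star> b = T \<one>" "b \<star> T (inv u) = T \<one>"
    using assms by (auto simp: is_inverse_def)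
  have eq: "T (inv (s \<otimes> u)) = T (inv u) \<star> T s"
    using assms by (simp add: T_mult_T_S inv_mult_group)
  have "T (inv u) \<star> T s \<star> (Ti s \<star> b) = T (inv u) \<star> (T s \<star> Ti s \<star> b)"
    using assms b by (simp add: mult_assoc del: T_Ti)
  moreover have "Ti s \<star> b \<star> (T (inv u) \<star> T s) = Ti s \<star> (b \<star> T (inv u) \<star> T s)"
    using assms b(1) by (simp add: mult_assoc)
  ultimately show ?thesis
    using assms b by (simp add: is_inverse_def eq)
qed

lemma Tbar_is_inverse:
  assumes "w \<in> carrier W"
  shows "is_inverse (T (inv w)) (Tbar w)"
proof -
  have "\<exists>b. is_inverse (T (inv w)) b"
    using assms
  proof (induction rule: len_induct)
    case one
    show ?case by (rule exI[of _ "T \<one>"]) (simp add: is_inverse_def)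
  next
    case (step s w)
    then show ?case using is_inverse_step by blast
  qed
  then obtain b where b: "is_inverse (T (inv w)) b" by blast
  have "Tbar w = b"
    unfolding Tbar_def using is_inverse_unique[of "T (inv w)"] b assms by (intro the_equality) auto
  then show ?thesis using b by simp
qed

lemma Tbar_Hc [simp, intro]: "w \<in> carrier W \<Longrightarrow> Tbar w \<in> Hc"
  using Tbar_is_inverse by (simp add: is_inverse_def)

lemma Tbar_eqI: "w \<in> carrier W \<Longrightarrow> is_inverse (T (inv w)) b \<Longrightarrow> Tbar w = b"
  using is_inverse_unique[of "T (inv w)"] Tbar_is_inverse by auto

lemma Tbar_one [simp]: "Tbar \<one> = T \<one>"
  by (rule Tbar_eqI) (auto simp: is_inverse_def)

lemma Tbar_step:
  assumes "s \<in> S" "u \<in> carrier W" "\<not> inversion u s"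
  shows "Tbar (s \<otimes> u) = Ti s \<star> Tbar u"
  using Tbar_eqI is_inverse_step[OF assms] Tbar_is_inverse assms by simp

text \<open>Left multiplication by \<open>Ti s\<close> raises lengths in the support by at most one,
  and the top coefficient is carried along. Control by length is what comparisons at elements of
  maximal length use.\<close>

lemma Tbar_triangular:
  assumes "w \<in> carrier W"
  shows "co (Tbar w) w = 1 \<and>
    (\<forall>x. co (Tbar w) x \<noteq> 0 \<longrightarrow> x = w \<or> \<ell> x < \<ell> w)"
  using assms
proof (induction rule: len_induct)
  case (step s u)
  have su: "\<ell> (s \<otimes> u) = \<ell> u + 1" using len_S_mult(1)[of u s] step by simp
  have l: "co (Tbar (s \<otimes> u)) x =
      co (Tbar u) (s \<otimes> x) -
      (if inversion x s then 0 else \<xi> s * co (Tbar u) x)"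
    if "x \<in> carrier W" for x
    using step that by (simp add: Tbar_step Ti_mult lookup_minus lookup_lam)
  have "co (Tbar (s \<otimes> u)) (s \<otimes> u) = 1"
    using l[of "s \<otimes> u"] step inversion_S_mult[of u s] by simp
  moreover have "x = s \<otimes> u \<or> \<ell> x < \<ell> (s \<otimes> u)"
    if nz: "co (Tbar (s \<otimes> u)) x \<noteq> 0" for x
  proof -
    have x: "x \<in> carrier W" using nz Hc_lookup[of "Tbar (s \<otimes> u)" x] step by auto
    then consider "co (Tbar u) (s \<otimes> x) \<noteq> 0"
      | "co (Tbar u) x \<noteq> 0"
      using nz l[OF x] by (cases "co (Tbar u) x = 0") (auto split: if_splits)
    then show ?thesis
    proof cases
      case 1
      then have "s \<otimes> x = u \<or> \<ell> (s \<otimes> x) < \<ell> u" using step by blast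
      then show ?thesis
        using S_mult_eq_iff[of s x u] step x su len_S_mult[of x s] by (auto split: if_splits)
    next
      case 2
      then show ?thesis using step su by fastforce
    qed
  qed
  ultimately show ?case by blast
qed (auto simp: lookup_T)

end

section \<open>The bar involution\<close>

locale hecke_bar = hecke W S q qi for W (structure) and S
    and q qi :: "'a \<Rightarrow> 'r::comm_ring_1" +
  fixes b :: "'r \<Rightarrow> 'r"
  assumes b_add: "b (x + y) = b x + b y"
    and b_mult: "b (x * y) = b x * b y"
    and b_one [simp]: "b 1 = 1"
    and b_b [simp]: "b (b x) = x"
    and b_q [simp]: "s \<in> S \<Longrightarrow> b (q s) = qi s"
begin

lemma b_zero [simp]: "b 0 = 0"
  using b_add[of 0 0] by simp

lemma b_minus: "b (- x) = - b x"
  using b_add[of x "- x"] by (simp add: eq_neg_iff_add_eq_0 add.commute)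

lemma b_diff: "b (x - y) = b x - b y"
  using b_add[of x "- y"] by (simp add: b_minus)

lemma b_qi [simp]: "s \<in> S \<Longrightarrow> b (qi s) = q s"
  using b_b[of "q s"] b_q by metis

lemma b_\<xi> [simp]: "s \<in> S \<Longrightarrow> b (\<xi> s) = - \<xi> s"
  by (simp add: \<xi>_def b_diff)

definition hbar :: "('a \<Rightarrow>\<^sub>0 'r) \<Rightarrow> ('a \<Rightarrow>\<^sub>0 'r)"
  where "hbar h = (\<Sum>w\<in>carrier W. scale (b (co h w)) (Tbar w))"

lemma hbar_Hc [simp, intro]: "hbar h \<in> Hc"
  unfolding hbar_def by auto

lemma hbar_add: "hbar (x + y) = hbar x + hbar y"
  by (simp add: hbar_def lookup_add b_add add_scale sum.distrib)

lemma hbar_scale: "hbar (scale c x) = scale (b c) (hbar x)"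
  by (simp add: hbar_def b_mult scale_sum scale_scale)

lemma hbar_zero [simp]: "hbar 0 = 0"
  by (simp add: hbar_def)

lemma hbar_minus: "hbar (- x) = - hbar x"
  by (simp add: hbar_def b_minus minus_scale sum_negf)

lemma hbar_diff: "hbar (x - y) = hbar x - hbar y"
  using hbar_add[of x "- y"] by (simp add: hbar_minus)

lemma hbar_sum: "hbar (sum f I) = (\<Sum>i\<in>I. hbar (f i))"
  by (induction I rule: infinite_finite_induct) (simp_all add: hbar_add)

lemma hbar_T:
  assumes "w \<in> carrier W"
  shows "hbar (T w) = Tbar w"
proof -
  have "hbar (T w) = (\<Sum>x\<in>carrier W. if x = w then Tbar w else 0)"
    unfolding hbar_def by (rule sum.cong) (auto simp: lookup_T)
  then show ?thesis using assms fin by simp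
qed

lemma Tbar_S: "s \<in> S \<Longrightarrow> Tbar s = Ti s"
  using Tbar_step[of s \<one>] by simp

lemma Hc_induct [consumes 1, case_names T add scale zero]:
  assumes "h \<in> Hc"
    and "\<And>w. w \<in> carrier W \<Longrightarrow> P (T w)"
    and "\<And>x y. x \<in> Hc \<Longrightarrow> y \<in> Hc \<Longrightarrow> P x \<Longrightarrow> P y \<Longrightarrow> P (x + y)"
    and "\<And>c x. x \<in> Hc \<Longrightarrow> P x \<Longrightarrow> P (scale c x)"
    and "P 0"
  shows "P h"
proof -
  have "(\<Sum>w\<in>A. scale (co h w) (T w)) \<in> Hc \<and>
      P (\<Sum>w\<in>A. scale (co h w) (T w))" if "A \<subseteq> carrier W" for A
    using finite_subset[OF that fin] that
    by (induction A rule: finite_induct) (use assms in auto)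
  then show ?thesis using Hc_expand[OF assms(1)] by (metis subset_refl)
qed

lemma hbar_T_S_mult:
  assumes "s \<in> S" "h \<in> Hc"
  shows "hbar (T s \<star> h) = Ti s \<star> hbar h"
  using assms(2)
proof (induction rule: Hc_induct)
  case (T w)
  show ?case
  proof (cases "inversion w s")
    case False
    then show ?thesis using T assms by (simp add: T_S_mult_T hbar_T Tbar_step)
  next
    case True
    let ?u = "s \<otimes> w"
    have u: "?u \<in> carrier W" "\<not> inversion ?u s"
      using T assms True inversion_S_mult by auto
    \<comment> \<open>The descent is reduced to the ascent from \<open>s w\<close>. The square of
      \<open>Ti s\<close> then reproduces the quadratic relation with the sign of
      \<open>\<xi> s\<close> changed, as the bar of the scalar requires.\<close>
    have w: "Tbar w = Ti s \<star> Tbar ?u" using Tbar_step[OF assms(1) u] assms T by simp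
    have "Ti s \<star> Tbar w = Tbar ?u - scale (\<xi> s) (Tbar w)"
      using assms u unfolding w
      by (simp add: mult_assoc[symmetric] Ti_square mult_diff_left mult_scale_left)
    then show ?thesis
      using T assms True u by (simp add: T_S_mult_T hbar_T hbar_add hbar_scale minus_scale)
  qed
qed (simp_all add: mult_add_right hbar_add mult_scale_right hbar_scale)

lemma hbar_T_mult:
  assumes "w \<in> carrier W" "h \<in> Hc"
  shows "hbar (T w \<star> h) = Tbar w \<star> hbar h"
  using assms
proof (induction rule: len_induct)
  case (step s u)
  have "hbar (T (s \<otimes> u) \<star> h) = hbar (T s \<star> (T u \<star> h))"
    using step by (simp add: T_S_mult_T[symmetric] mult_assoc)
  also have "\<dots> = Ti s \<star> (Tbar u \<star> hbar h)"
    using step by (simp add: hbar_T_S_mult)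
  also have "\<dots> = Tbar (s \<otimes> u) \<star> hbar h"
    using step by (simp add: Tbar_step mult_assoc)
  finally show ?case .
qed simp

lemma hbar_mult:
  assumes "a \<in> Hc" "h \<in> Hc"
  shows "hbar (a \<star> h) = hbar a \<star> hbar h"
  using assms(1)
  by (induction rule: Hc_induct)
    (use assms in \<open>simp_all add: hbar_T_mult hbar_T mult_add_left hbar_add mult_scale_left
      hbar_scale\<close>)

lemma hbar_Ti:
  assumes "s \<in> S"
  shows "hbar (Ti s) = T s"
proof -
  have "hbar (Ti s) = Ti s + scale (\<xi> s) (T \<one>)"
    unfolding Ti_def[of s]
    using assms by (simp add: hbar_diff hbar_scale hbar_T Tbar_S minus_scale Ti_def)
  then show ?thesis by (simp add: Ti_def)
qed

lemma hbar_Tbar: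
  assumes "w \<in> carrier W"
  shows "hbar (Tbar w) = T w"
  using assms
proof (induction rule: len_induct)
  case (step s u)
  then show ?case by (simp add: Tbar_step hbar_mult hbar_Ti T_S_mult_T)
qed (simp add: hbar_T)

lemma hbar_hbar:
  assumes "h \<in> Hc"
  shows "hbar (hbar h) = h"
  using assms
  by (induction rule: Hc_induct)
    (simp_all add: hbar_T hbar_Tbar hbar_add hbar_scale)

text \<open>Every \<open>Tbar w\<close> is \<open>T w\<close> plus shorter terms, so at an element
  of maximal length only its own term contributes.\<close>

lemma lookup_hbar_maximal:
  assumes "y \<in> carrier W"
    and "\<And>w. w \<in> carrier W \<Longrightarrow> co h w \<noteq> 0 \<Longrightarrow> \<ell> w \<le> \<ell> y"
  shows "co (hbar h) y = b (co h y)"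
proof -
  have "co (hbar h) y =
      (\<Sum>w\<in>carrier W. b (co h w) * co (Tbar w) y)"
    by (simp add: hbar_def lookup_sum)
  also have "\<dots> = (\<Sum>w\<in>carrier W. if w = y then b (co h y) else 0)"
  proof (rule sum.cong)
    fix w assume w: "w \<in> carrier W"
    show "b (co h w) * co (Tbar w) y =
        (if w = y then b (co h y) else 0)"
    proof (cases "w = y \<or> co h w = 0")
      case True
      then show ?thesis using Tbar_triangular[OF w] by auto
    next
      case False
      then have "co (Tbar w) y = 0"
        using Tbar_triangular[OF w] assms(2)[OF w] by force
      then show ?thesis using False by simp
    qed
  qed simp
  finally show ?thesis using assms fin by simp
qed

end

section \<open>Standard parabolic subgroups\<close>

context coxeter
begin

definition par :: "'a set \<Rightarrow> 'a set"
  where "par J = wp ` {ss. set ss \<subseteq> J}"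

lemma par_I: "set ss \<subseteq> J \<Longrightarrow> wp ss \<in> par J"
  by (auto simp: par_def)

lemma par_E:
  assumes "w \<in> par J"
  obtains ss where "set ss \<subseteq> J" "w = wp ss"
  using assms by (auto simp: par_def)

lemma par_one [simp, intro]: "\<one> \<in> par J"
  using par_I[of "[]" J] by simp

lemma par_carrier: "J \<subseteq> S \<Longrightarrow> w \<in> par J \<Longrightarrow> w \<in> carrier W"
  by (auto elim!: par_E)

lemma par_gen: "J \<subseteq> S \<Longrightarrow> s \<in> J \<Longrightarrow> s \<in> par J"
  using par_I[of "[s]" J] by auto

lemma par_S: "par S = carrier W"
proof
  show "carrier W \<subseteq> par S"
  proof
    fix w assume "w \<in> carrier W"
    then obtain ss where "set ss \<subseteq> S" "wp ss = w" using ex_word by metis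
    then show "w \<in> par S" using par_I by blast
  qed
qed (auto simp: par_def)

lemma par_mult:
  assumes "J \<subseteq> S" "x \<in> par J" "y \<in> par J"
  shows "x \<otimes> y \<in> par J"
proof -
  obtain xs ys where "set xs \<subseteq> J" "x = wp xs" "set ys \<subseteq> J" "y = wp ys"
    using assms(2,3) by (auto elim!: par_E)
  moreover from this have "wp (xs @ ys) = wp xs \<otimes> wp ys"
    using assms(1) by (intro wp_append) auto
  ultimately show ?thesis
    using par_I[of "xs @ ys" J] by simp
qed

lemma par_inv:
  assumes "J \<subseteq> S" "x \<in> par J"
  shows "inv x \<in> par J"
proof -
  obtain xs where "set xs \<subseteq> J" "x = wp xs"
    using assms by (auto elim!: par_E)
  moreover from this have "wp (rev xs) = inv (wp xs)"
    using assms(1) by (intro wp_rev) auto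
  ultimately show ?thesis
    using par_I[of "rev xs" J] by simp
qed

text \<open>The exchange condition deletes letters from a given word, so shortening a word over
  \<open>J\<close> never leaves \<open>J\<close>.\<close>

lemma par_reduced_word:
  assumes "J \<subseteq> S" "set ss \<subseteq> J"
  shows "\<exists>ys. set ys \<subseteq> J \<and> wp ys = wp ss \<and> length ys = \<ell> (wp ss)"
  using assms(2)
proof (induction ss)
  case (Cons s ss)
  then obtain ys where ys: "set ys \<subseteq> J" "wp ys = wp ss" "length ys = \<ell> (wp ss)"
    by auto
  have s: "s \<in> S" "s \<in> J" and c: "wp ss \<in> carrier W" using Cons.prems assms(1) by auto
  show ?case
  proof (cases "inversion (wp ss) s")
    case False
    then have "\<ell> (wp (s # ss)) = \<ell> (wp ss) + 1" using len_S_mult(1)[OF c s(1)] by simp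
    then show ?thesis using ys s by (intro exI[of _ "s # ys"]) auto
  next
    case True
    then have "s \<in> set (refl_seq W ys)"
      using inversion_in_refl_seq[of ys s] ys assms(1) s by auto
    then obtain zs where zs: "set zs \<subseteq> set ys" "length zs < length ys" "wp zs = s \<otimes> wp ys"
      using strong_exchange_word[of ys s] ys assms(1) by blast
    have "\<ell> (wp zs) \<le> length zs" using len_wp_le[of zs] zs ys assms(1) by blast
    moreover have "\<ell> (wp ss) = \<ell> (s \<otimes> wp ss) + 1" using len_S_mult(2)[OF c s(1) True] .
    ultimately have "length zs = \<ell> (s \<otimes> wp ss)" using zs ys by simp
    then show ?thesis using zs ys by (intro exI[of _ zs]) auto
  qed
qed (auto intro!: exI[of _ "[]"])

lemma par_induct [consumes 2, case_names one step]:
  assumes "J \<subseteq> S" "w \<in> par J"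
    and "P \<one>"
    and "\<And>s w. s \<in> J \<Longrightarrow> w \<in> par J \<Longrightarrow> \<not> inversion w s \<Longrightarrow> P w \<Longrightarrow> P (s \<otimes> w)"
  shows "P w"
proof -
  have "P (wp ss)" if "set ss \<subseteq> J" "length ss = \<ell> (wp ss)" for ss
    using that
  proof (induction ss)
    case (Cons s ss)
    have s: "s \<in> S" "set ss \<subseteq> S" "wp ss \<in> carrier W" using Cons.prems assms(1) by auto
    have "\<not> inversion (wp ss) s" "length ss = \<ell> (wp ss)"
      using len_S_mult[OF s(3,1)] len_wp_le[OF s(2)] Cons.prems by (auto split: if_splits)
    then show ?case using assms(4)[of s "wp ss"] Cons par_I[of ss J] by simp
  qed (simp add: assms(3))
  moreover obtain ss where "set ss \<subseteq> J" "w = wp ss" using assms(2) par_E by blast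
  ultimately show ?thesis using par_reduced_word[OF assms(1)] by metis
qed

lemma par_descent:
  assumes "J \<subseteq> S" "w \<in> par J" "w \<noteq> \<one>"
  obtains s u where "s \<in> J" "u \<in> par J" "\<not> inversion u s" "w = s \<otimes> u"
  using assms
proof (induction rule: par_induct)
  case (step s w)
  then show ?case by metis
qed simp

text \<open>A downward step in the Bruhat order deletes a letter from any word for the upper
  element, in particular from one over \<open>J\<close>.\<close>

lemma par_bless_closed:
  assumes "y \<prec>\<^sub>B w" "J \<subseteq> S" "w \<in> par J"
  shows "y \<in> par J"
proof -
  have down: "x \<in> par J"
    if "t \<in> Refl" "x \<in> carrier W" "\<ell> x < \<ell> (t \<otimes> x)" and tx: "t \<otimes> x \<in> par J" for t x
  proof -
    obtain ss where ss: "set ss \<subseteq> J" "t \<otimes> x = wp ss" using tx par_E by blast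
    have "inversion (t \<otimes> x) t"
      using inversion_iff_len[of "t \<otimes> x" t] that by simp
    then have "t \<in> set (refl_seq W ss)"
      using inversion_in_refl_seq[of ss t] ss assms(2) that by auto
    moreover have "set ss \<subseteq> S" using ss(1) assms(2) by blast
    ultimately obtain ys where ys: "set ys \<subseteq> set ss" "wp ys = t \<otimes> wp ss"
      by (metis strong_exchange_word)
    then have "wp ys = x" using that by (simp flip: ss(2))
    then show ?thesis using ys ss par_I[of ys J] by auto
  qed
  show ?thesis
    using assms
  proof (induction rule: bless_induct)
    case (base t)
    then show ?case using down by blast
  next
    case (step t x)
    then show ?case using down by blast
  qed
qed

lemma refl_seq_conj:
  assumes "J \<subseteq> S" "set ss \<subseteq> J" "t \<in> set (refl_seq W ss)"
  shows "\<exists>u\<in>par J. \<exists>j\<in>J. t = u \<otimes> j \<otimes> inv u"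
  using assms(2,3)
proof (induction ss arbitrary: t)
  case (Cons s ss)
  have s: "s \<in> S" "s \<in> J" using Cons.prems assms(1) by auto
  show ?case
  proof (cases "t = s")
    case True
    then show ?thesis using s by (intro bexI[of _ \<one>] bexI[of _ s]) auto
  next
    case False
    then obtain r where r: "r \<in> set (refl_seq W ss)" "t = s \<otimes> r \<otimes> inv s"
      using Cons.prems by auto
    then obtain u j where uj: "u \<in> par J" "j \<in> J" "r = u \<otimes> j \<otimes> inv u"
      using Cons.IH[of r] Cons.prems by auto
    have "u \<in> carrier W" "j \<in> carrier W" using uj par_carrier assms(1) by auto
    then have "t = (s \<otimes> u) \<otimes> j \<otimes> inv (s \<otimes> u)"
      using r uj s by (simp add: m_assoc inv_mult_group)
    moreover have "s \<otimes> u \<in> par J" using par_mult par_gen s uj assms(1) by simp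
    ultimately show ?thesis using uj by blast
  qed
qed simp

lemma inversion_par:
  assumes "J \<subseteq> S" "w \<in> par J" "t \<in> carrier W" "inversion w t"
  shows "\<exists>u\<in>par J. \<exists>j\<in>J. t = u \<otimes> j \<otimes> inv u"
proof -
  obtain ss where "set ss \<subseteq> J" "w = wp ss" using assms(2) par_E by blast
  then show ?thesis
    using inversion_in_refl_seq[of ss t] refl_seq_conj[of J ss t] assms by auto
qed

end

section \<open>Commuting sets of generators\<close>

locale commuting_parts = coxeter W S for W (structure) and S +
  fixes J K :: "'a set"
  assumes JS: "J \<subseteq> S" and KS: "K \<subseteq> S"
    and JK_disjoint: "J \<inter> K = {}"
    and JK_comm: "s \<in> J \<Longrightarrow> t \<in> K \<Longrightarrow> s \<otimes> t = t \<otimes> s"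
begin

lemma par_J_carrier [simp, intro]: "x \<in> par J \<Longrightarrow> x \<in> carrier W"
  and par_K_carrier [simp, intro]: "x \<in> par K \<Longrightarrow> x \<in> carrier W"
  using par_carrier JS KS by blast+

lemma gen_par_comm:
  assumes "s \<in> J" "y \<in> par K"
  shows "s \<otimes> y = y \<otimes> s"
  using KS assms(2)
proof (induction rule: par_induct)
  case (step t y)
  have c: "s \<in> carrier W" "t \<in> carrier W" "y \<in> carrier W" using step assms JS KS by auto
  have "s \<otimes> (t \<otimes> y) = t \<otimes> (s \<otimes> y)"
    using c JK_comm[OF assms(1) step(1)] by (simp flip: m_assoc)
  then show ?case using c step(4) by (simp add: m_assoc)
qed (use assms JS in auto)

lemma par_comm:
  assumes "x \<in> par J" "y \<in> par K"
  shows "x \<otimes> y = y \<otimes> x"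
  using JS assms(1)
proof (induction rule: par_induct)
  case (step s x)
  have c: "s \<in> carrier W" "x \<in> carrier W" "y \<in> carrier W" using step assms JS by auto
  have "s \<otimes> x \<otimes> y = s \<otimes> y \<otimes> x" using c step(4) by (simp add: m_assoc)
  then show ?case using c gen_par_comm[OF step(1) assms(2)] by (simp add: m_assoc)
qed (use assms in auto)

lemma par_conj_trivial:
  assumes "x \<in> par J" "y \<in> par K"
  shows "inv y \<otimes> x \<otimes> y = x" "y \<otimes> x \<otimes> inv y = x" "inv x \<otimes> y \<otimes> x = y" "x \<otimes> y \<otimes> inv x = y"
proof -
  have c: "x \<in> carrier W" "y \<in> carrier W" using assms by auto
  show "inv y \<otimes> x \<otimes> y = x" "x \<otimes> y \<otimes> inv x = y"
    using c by (simp_all add: m_assoc par_comm[OF assms])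
  show "y \<otimes> x \<otimes> inv y = x" "inv x \<otimes> y \<otimes> x = y"
    using c by (simp_all add: m_assoc flip: par_comm[OF assms])
qed

text \<open>As its own inversion, \<open>k\<close> would be conjugate to some \<open>j\<close> in
  \<open>J\<close> by an element of \<open>par J\<close>. That element commutes with
  \<open>k\<close>, hence \<open>k = j\<close>, against disjointness.\<close>

lemma K_not_in_par_J:
  assumes "k \<in> K"
  shows "k \<notin> par J"
proof
  assume k: "k \<in> par J"
  have "k \<in> S" using assms KS by blast
  then have "inversion k k" by simp
  then obtain u j where uj: "u \<in> par J" "j \<in> J" "k = u \<otimes> j \<otimes> inv u"
    using inversion_par[OF JS k, of k] \<open>k \<in> S\<close> by auto
  have "j \<in> carrier W" using uj JS by auto
  then have "inv u \<otimes> k \<otimes> u = j"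
    unfolding uj(3) using uj(1) by (simp add: m_assoc)
  moreover have "inv u \<otimes> k \<otimes> u = k"
    using par_conj_trivial(3)[OF uj(1)] par_gen[OF KS assms] by simp
  ultimately show False using JK_disjoint assms uj by auto
qed

text \<open>An inversion of \<open>y\<close> is conjugate within \<open>par K\<close> to some
  \<open>k\<close> in \<open>K\<close>. But \<open>r\<close> commutes with \<open>par K\<close>, so
  \<open>r = k\<close>, which is not in \<open>par J\<close>.\<close>

lemma not_inversion_par:
  assumes "r \<in> par J" "y \<in> par K"
  shows "\<not> inversion y r"
proof
  assume "inversion y r"
  then obtain u k where uk: "u \<in> par K" "k \<in> K" "r = u \<otimes> k \<otimes> inv u"
    using inversion_par[OF KS assms(2), of r] assms by auto
  have "k \<in> carrier W" using uk KS by auto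
  then have "inv u \<otimes> r \<otimes> u = k"
    unfolding uk(3) using uk(1) by (simp add: m_assoc)
  then have "r = k" using par_conj_trivial(1)[OF assms(1) uk(1)] by simp
  then show False using K_not_in_par_J uk assms by blast
qed

lemma inversion_par_mult:
  assumes "x \<in> par J" "y \<in> par K" "t \<in> par J"
  shows "inversion (x \<otimes> y) t \<longleftrightarrow> inversion x t"
proof -
  have "inv x \<otimes> t \<otimes> x \<in> par J"
    using assms par_mult[OF JS] par_inv[OF JS] by simp
  then show ?thesis
    using inversion_mult[of x y t] not_inversion_par assms by simp
qed

text \<open>A non-trivial \<open>x\<close> has a descent \<open>s\<close> in \<open>K\<close>. Seen
  from \<open>par J\<close>, this inversion is a conjugate inside \<open>par J\<close>, which
  contains no element of \<open>K\<close>.\<close>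

lemma par_inter:
  assumes "x \<in> par J" "x \<in> par K"
  shows "x = \<one>"
proof (rule ccontr)
  assume "x \<noteq> \<one>"
  then obtain s u where su: "s \<in> K" "u \<in> par K" "\<not> inversion u s" "x = s \<otimes> u"
    using par_descent[OF KS assms(2)] by blast
  then have s: "s \<in> K" "inversion x s"
    using inversion_Refl_mult[of u s] KS by auto
  then obtain u j where uj: "u \<in> par J" "j \<in> J" "s = u \<otimes> j \<otimes> inv u"
    using inversion_par[OF JS assms(1), of s] KS by auto
  then have "s \<in> par J" using par_mult[OF JS] par_inv[OF JS] par_gen[OF JS] by simp
  then show False using K_not_in_par_J s by blast
qed

lemma par_mult_inj:
  assumes "x \<in> par J" "y \<in> par K" "x' \<in> par J" "y' \<in> par K" "x \<otimes> y = x' \<otimes> y'"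
  shows "x = x' \<and> y = y'"
proof -
  have c: "x \<in> carrier W" "y \<in> carrier W" "x' \<in> carrier W" "y' \<in> carrier W"
    using assms by auto
  have "inv x' \<otimes> (x \<otimes> y) \<otimes> inv y = inv x' \<otimes> (x' \<otimes> y') \<otimes> inv y" using assms(5) by simp
  then have "inv x' \<otimes> x = y' \<otimes> inv y" using c by (simp add: m_assoc)
  moreover have "inv x' \<otimes> x \<in> par J" "y' \<otimes> inv y \<in> par K"
    using assms par_mult[OF JS] par_inv[OF JS] par_mult[OF KS] par_inv[OF KS] by simp_all
  ultimately have "inv x' \<otimes> x = \<one>" using par_inter by metis
  then have "x' \<otimes> (inv x' \<otimes> x) = x'" using c by simp
  then have "x = x'" using c by simp
  then show ?thesis using assms(5) c by simp
qed

text \<open>Each step from \<open>u\<close> to \<open>t u\<close> inside \<open>par J\<close> has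
  \<open>t\<close> in \<open>par J\<close>, and right multiplication by \<open>y\<close> leaves the
  inversions in \<open>par J\<close> unchanged.\<close>

lemma par_mult_bless:
  assumes "z \<prec>\<^sub>B x" "x \<in> par J" "y \<in> par K"
  shows "z \<otimes> y \<prec>\<^sub>B x \<otimes> y"
proof -
  have up: "u \<otimes> y \<prec>\<^sub>B t \<otimes> u \<otimes> y"
    if "t \<in> Refl" "u \<in> par J" "t \<otimes> u \<in> par J" "\<ell> u < \<ell> (t \<otimes> u)" for t u
  proof -
    have "t \<otimes> u \<otimes> inv u \<in> par J" using that par_mult[OF JS] par_inv[OF JS] by blast
    then have t: "t \<in> par J" using that by (simp add: m_assoc)
    have "\<not> inversion u t" using inversion_iff_len[of u t] that by auto
    then have "\<not> inversion (u \<otimes> y) t" using inversion_par_mult that t assms by simp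
    then have "\<ell> (u \<otimes> y) < \<ell> (t \<otimes> (u \<otimes> y))"
      using inversion_iff_len[of "u \<otimes> y" t] len_Refl_mult_neq[of "u \<otimes> y" t] that assms by fastforce
    then have "u \<otimes> y \<prec>\<^sub>B t \<otimes> (u \<otimes> y)"
      using bless_step[of "u \<otimes> y" t] that assms by simp
    then show ?thesis using that assms by (simp add: m_assoc)
  qed
  show ?thesis
    using assms(1,2)
  proof (induction rule: bless_induct)
    case (base t)
    have "z \<in> par J" using par_bless_closed[OF bless_step JS] base by blast
    then show ?case using base up by blast
  next
    case (step t u)
    have "u \<in> par J" using par_bless_closed[OF bless_step JS] step by blast
    then show ?case using up[of t u] step bless_trans by blast
  qed
qed

end

section \<open>The Kazhdan--Lusztig basis\<close>

text \<open>\<open>Neg\<close> plays the part of the integral span of the negative group elements.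
  \<open>Neg_split\<close> and \<open>Neg_b\<close> together say that the ring is the direct sum of
  the bar-fixed elements and \<open>Neg\<close>.\<close>

locale hecke_kl = hecke_bar W S q qi b for W (structure) and S
    and q qi :: "'a \<Rightarrow> 'r::comm_ring_1" and b +
  fixes Neg :: "'r set"
  assumes Neg_0 [simp, intro]: "0 \<in> Neg"
    and Neg_add: "x \<in> Neg \<Longrightarrow> y \<in> Neg \<Longrightarrow> x + y \<in> Neg"
    and Neg_minus: "x \<in> Neg \<Longrightarrow> - x \<in> Neg"
    and Neg_mult: "x \<in> Neg \<Longrightarrow> y \<in> Neg \<Longrightarrow> x * y \<in> Neg"
    and Neg_qi: "s \<in> S \<Longrightarrow> qi s \<in> Neg"
    and Neg_b: "x \<in> Neg \<Longrightarrow> b x = x \<Longrightarrow> x = 0"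
    and Neg_split: "\<exists>m. b m = m \<and> x - m \<in> Neg"
begin

lemma Neg_diff: "x \<in> Neg \<Longrightarrow> y \<in> Neg \<Longrightarrow> x - y \<in> Neg"
  using Neg_add[of x "- y"] Neg_minus by simp

text \<open>At an element of maximal length in the support the coefficient is fixed by
  \<open>b\<close> and lies in \<open>Neg\<close>, so it vanishes.\<close>

lemma bar_invariant_Neg_zero:
  assumes "h \<in> Hc" "hbar h = h" "\<And>y. y \<in> carrier W \<Longrightarrow> co h y \<in> Neg"
  shows "h = 0"
proof (rule ccontr)
  assume "h \<noteq> 0"
  let ?K = "Poly_Mapping.keys h"
  have K: "finite ?K" "?K \<noteq> {}" "?K \<subseteq> carrier W"
    using \<open>h \<noteq> 0\<close> assms(1) by (auto simp: Hc_def in_keys_iff intro: poly_mapping_eqI)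
  define n where "n = Max (\<ell> ` ?K)"
  have "n \<in> \<ell> ` ?K" unfolding n_def using K by (intro Max_in) auto
  then obtain y where y: "y \<in> ?K" "\<ell> y = n" by blast
  have "\<ell> w \<le> \<ell> y" if "co h w \<noteq> 0" for w
    unfolding y n_def using that K(1) by (intro Max_ge) (auto simp: in_keys_iff)
  then have "co (hbar h) y = b (co h y)"
    using y K by (intro lookup_hbar_maximal) auto
  then have "co h y = 0"
    using Neg_b[of "co h y"] assms y K by auto
  then show False using y by (simp add: in_keys_iff)
qed

definition is_KL :: "'a \<Rightarrow> ('a \<Rightarrow>\<^sub>0 'r) \<Rightarrow> bool"
  where "is_KL w c \<longleftrightarrow> c \<in> Hc \<and> hbar c = c \<and> co c w = 1 \<and>
    (\<forall>y. y \<noteq> w \<longrightarrow> co c y \<in> Neg \<and> (co c y \<noteq> 0 \<longrightarrow> y \<prec>\<^sub>B w))"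

lemma KL_unique:
  assumes "c \<in> Hc" "hbar c = c" "co c w = 1" "\<And>y. y \<noteq> w \<Longrightarrow> co c y \<in> Neg"
    and "c' \<in> Hc" "hbar c' = c'" "co c' w = 1" "\<And>y. y \<noteq> w \<Longrightarrow> co c' y \<in> Neg"
  shows "c = c'"
proof -
  have "c - c' = 0"
  proof (rule bar_invariant_Neg_zero)
    fix y assume "y \<in> carrier W"
    show "co (c - c') y \<in> Neg"
      using assms Neg_diff by (cases "y = w") (simp_all add: lookup_minus)
  qed (use assms in \<open>auto simp: hbar_diff\<close>)
  then show ?thesis by simp
qed

text \<open>In terms of coordinates, \<open>T\<^sub>s c = q\<^sub>s c\<close>.\<close>

definition eig :: "'a \<Rightarrow> ('a \<Rightarrow>\<^sub>0 'r) \<Rightarrow> bool"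
  where "eig s c \<longleftrightarrow> (\<forall>x\<in>carrier W. inversion x s \<longrightarrow> co c (s \<otimes> x) = qi s * co c x)"

text \<open>The eigenvector condition travels with the induction: it derives the coefficients at
  \<open>y < s y\<close> from those at \<open>s y\<close>, so only the latter have to be pushed into
  \<open>Neg\<close>.\<close>

definition good :: "'a \<Rightarrow> ('a \<Rightarrow>\<^sub>0 'r) \<Rightarrow> bool"
  where "good w c \<longleftrightarrow> is_KL w c \<and> (\<forall>s\<in>S. inversion w s \<longrightarrow> eig s c)"

text \<open>Chosen before existence is known, so that the recursion can refer to \<open>KL z\<close>
  for shorter \<open>z\<close>; existence is \<open>KL_good\<close>.\<close>

definition KL :: "'a \<Rightarrow> ('a \<Rightarrow>\<^sub>0 'r)"
  where "KL w = (SOME c. good w c)"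

definition Zset :: "'a \<Rightarrow> 'a \<Rightarrow> 'a set"
  where "Zset s u = {z. z \<prec>\<^sub>B u \<and> inversion z s}"

lemma Zset_carrier: "z \<in> Zset s u \<Longrightarrow> z \<in> carrier W"
  and Zset_len: "z \<in> Zset s u \<Longrightarrow> \<ell> z < \<ell> u"
  using bless_imp by (auto simp: Zset_def)

lemma finite_Zset [simp, intro]: "finite (Zset s u)"
  by (rule finite_subset[OF _ fin]) (use Zset_carrier in blast)

text \<open>A downward sweep by length: stage \<open>n\<close> has treated all \<open>z\<close> of
  length at least \<open>N - n\<close>. Among elements at least as long as \<open>z\<close>,
  subtracting a multiple of \<open>KL z\<close> changes only the coefficient at \<open>z\<close>, so
  earlier corrections survive.\<close>

lemma eliminate:
  assumes good: "\<And>z. z \<in> Z \<Longrightarrow> good z (KL z)"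
    and Z: "finite Z" "\<And>z. z \<in> Z \<Longrightarrow> \<ell> z < N"
  shows "\<exists>m. (\<forall>z. b (m z) = m z) \<and> (\<forall>z. z \<notin> Z \<longrightarrow> m z = 0) \<and>
    (\<forall>z\<in>Z. N \<le> \<ell> z + n \<longrightarrow> co (D - (\<Sum>z\<in>Z. scale (m z) (KL z))) z \<in> Neg)"
proof (induction n)
  case 0
  have "\<not> N \<le> \<ell> z + 0" if "z \<in> Z" for z using Z(2)[OF that] by simp
  then show ?case by (intro exI[of _ "\<lambda>_. 0"]) simp
next
  case (Suc n)
  then obtain m where m: "\<And>z. b (m z) = m z" "\<And>z. z \<notin> Z \<Longrightarrow> m z = 0"
    and neg: "\<And>z. z \<in> Z \<Longrightarrow> N \<le> \<ell> z + n \<Longrightarrow> co (D - (\<Sum>z\<in>Z. scale (m z) (KL z))) z \<in> Neg"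
    by blast
  define E where "E = D - (\<Sum>z\<in>Z. scale (m z) (KL z))"
  define L where "L = {z \<in> Z. N = Suc (\<ell> z + n)}"
  \<comment> \<open>\<open>r\<close> picks a bar-fixed part; subtracting it leaves a coefficient in
    \<open>Neg\<close>.\<close>
  obtain r where r: "\<And>x. b (r x) = r x" "\<And>x. x - r x \<in> Neg"
    using Neg_split by metis
  define k where "k z = (if z \<in> L then r (co E z) else 0)" for z
  have k: "b (k z) = k z" for z using r(1) by (simp add: k_def)
  have co_k: "co (\<Sum>z'\<in>Z. scale (k z') (KL z')) z = k z"
    if "z \<in> Z" "N \<le> \<ell> z + Suc n" for z
  proof -
    have "k z' * co (KL z') z = (if z' = z then k z else 0)" if "z' \<in> Z" for z'
    proof (cases "z' \<in> L")
      case True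
      then have "\<ell> z' \<le> \<ell> z" using \<open>N \<le> \<ell> z + Suc n\<close> by (simp add: L_def)
      moreover have "is_KL z' (KL z')" using good that by (simp add: good_def)
      ultimately show ?thesis
        using bless_imp[of z z'] unfolding is_KL_def by (cases "z' = z") fastforce+
    qed (auto simp: k_def)
    then show ?thesis using that Z by (simp add: lookup_sum)
  qed
  show ?case
  proof (intro exI[of _ "\<lambda>z. m z + k z"] conjI allI impI ballI)
    fix z assume z: "z \<in> Z" "N \<le> \<ell> z + Suc n"
    have "D - (\<Sum>z\<in>Z. scale (m z + k z) (KL z)) = E - (\<Sum>z\<in>Z. scale (k z) (KL z))"
      by (simp add: E_def add_scale sum.distrib)
    then have "co (D - (\<Sum>z\<in>Z. scale (m z + k z) (KL z))) z = co E z - k z"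
      using co_k[OF z] by (simp add: lookup_minus)
    moreover have "co E z - k z \<in> Neg"
      using r(2)[of "co E z"] neg[OF z(1)] z by (cases "z \<in> L") (auto simp: k_def L_def E_def)
    ultimately show "co (D - (\<Sum>z\<in>Z. scale (m z + k z) (KL z))) z \<in> Neg" by simp
  qed (use m k in \<open>auto simp: b_add k_def L_def\<close>)
qed

lemma eig_sum: "(\<And>z. z \<in> Z \<Longrightarrow> eig s (f z)) \<Longrightarrow> eig s (\<Sum>z\<in>Z. scale (m z) (f z))"
  unfolding eig_def by (auto simp: lookup_sum sum_distrib_left ac_simps intro!: sum.cong)

lemma eig_diff: "eig s c \<Longrightarrow> eig s d \<Longrightarrow> eig s (c - d)"
  unfolding eig_def by (simp add: lookup_minus algebra_simps)

context
  fixes s u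
  assumes s: "s \<in> S" and u: "u \<in> carrier W" and up: "\<not> inversion u s" and gu: "good u (KL u)"
begin

text \<open>This is the product of \<open>KL s\<close> and \<open>KL u\<close>, since
  \<open>T s + scale (qi s) (T \<one>)\<close> is the Kazhdan--Lusztig element of the generator
  \<open>s\<close>.\<close>

definition "D = T s \<star> KL u + scale (qi s) (KL u)"

lemma KLu: "KL u \<in> Hc" "hbar (KL u) = KL u" "co (KL u) u = 1"
  "\<And>y. y \<noteq> u \<Longrightarrow> co (KL u) y \<in> Neg" "\<And>y. y \<noteq> u \<Longrightarrow> co (KL u) y \<noteq> 0 \<Longrightarrow> y \<prec>\<^sub>B u"
  using gu by (auto simp: good_def is_KL_def)

lemma D_Hc: "D \<in> Hc"
  using KLu by (simp add: D_def)

lemma D_bar: "hbar D = D"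
proof -
  have "hbar D = Ti s \<star> KL u + scale (q s) (KL u)"
    using s KLu by (simp add: D_def hbar_add hbar_T_S_mult hbar_scale)
  also have "\<dots> = T s \<star> KL u - scale (\<xi> s) (KL u) + scale (q s) (KL u)"
    using s by (simp add: Ti_mult T_S_mult)
  also have "\<dots> = D"
    by (simp add: D_def \<xi>_def diff_scale)
  finally show ?thesis .
qed

lemma lookup_D: "x \<in> carrier W \<Longrightarrow>
    co D x = co (KL u) (s \<otimes> x) + (if inversion x s then q s else qi s) * co (KL u) x"
  using s by (simp add: D_def T_S_mult lookup_add lookup_lam \<xi>_def algebra_simps)

text \<open>The quadratic relation in the form \<open>(T s - q s) (T s + qi s) = 0\<close>, read in
  coordinates.\<close>

lemma D_eig: "eig s D"
  unfolding eig_def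
proof (intro ballI impI)
  fix x assume x: "x \<in> carrier W" "inversion x s"
  then have "\<not> inversion (s \<otimes> x) s" using inversion_S_mult s by simp
  then have "co D (s \<otimes> x) = co (KL u) x + qi s * co (KL u) (s \<otimes> x)"
    using lookup_D[of "s \<otimes> x"] x s by simp
  moreover have "qi s * (q s * co (KL u) x) = co (KL u) x"
    using q_qi[OF s] by (simp add: algebra_simps flip: mult.assoc)
  ultimately show "co D (s \<otimes> x) = qi s * co D x"
    using lookup_D[of x] x by (simp add: algebra_simps)
qed

lemma u_less: "u \<prec>\<^sub>B s \<otimes> u"
  using bless_S_iff' s u up by blast

lemma D_support:
  assumes "co D x \<noteq> 0" "x \<noteq> s \<otimes> u"
  shows "x \<prec>\<^sub>B s \<otimes> u"
proof -
  have x: "x \<in> carrier W" using assms Hc_lookup D_Hc by blast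
  have le: "y \<prec>\<^sub>B s \<otimes> u \<and> (s \<otimes> y \<prec>\<^sub>B s \<otimes> u \<or> y = u)" if "co (KL u) y \<noteq> 0" for y
  proof (cases "y = u")
    case False
    then have "y \<prec>\<^sub>B u" using KLu that by blast
    then show ?thesis using bless_lift_up[of y u s] s up by blast
  qed (use u_less in blast)
  consider "co (KL u) (s \<otimes> x) \<noteq> 0" | "co (KL u) x \<noteq> 0"
    using assms lookup_D[OF x] by fastforce
  then show ?thesis
  proof cases
    case 1
    then show ?thesis using le[of "s \<otimes> x"] assms S_mult_eq_iff[of s x u] s x u by auto
  next
    case 2
    then show ?thesis using le by blast
  qed
qed

lemma not_up_KL: "co (KL u) (s \<otimes> u) = 0"
proof (rule ccontr)
  assume "co (KL u) (s \<otimes> u) \<noteq> 0"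
  moreover have "s \<otimes> u \<noteq> u" using bless_imp[OF u_less] by auto
  ultimately have "s \<otimes> u \<prec>\<^sub>B u" using KLu by blast
  then show False using bless_imp[OF u_less] bless_imp by fastforce
qed

lemma D_top: "co D (s \<otimes> u) = 1"
  using lookup_D[of "s \<otimes> u"] s u KLu not_up_KL by simp

text \<open>Such an \<open>x\<close> is not below \<open>u\<close>, so only the coefficient of
  \<open>KL u\<close> at \<open>s x\<close> remains in \<open>lookup_D\<close>, and
  \<open>s x \<noteq> u\<close> puts it in \<open>Neg\<close>.\<close>

lemma D_Neg:
  assumes "x \<in> carrier W" "inversion x s" "x \<noteq> s \<otimes> u" "x \<notin> Zset s u"
  shows "co D x \<in> Neg"
proof -
  have "x \<noteq> u" using assms up by blast
  then have "co (KL u) x = 0" using KLu(5) assms by (auto simp: Zset_def)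
  moreover have "s \<otimes> x \<noteq> u" using assms S_mult_eq_iff[of s x u] s u by auto
  ultimately show ?thesis using lookup_D[OF assms(1)] KLu(4) by simp
qed

text \<open>Bar-fixed multiples of \<open>KL z\<close>, for \<open>z\<close> in
  \<open>Zset s u\<close>, bring the coefficients of \<open>D\<close> at elements with descent
  \<open>s\<close> into \<open>Neg\<close>. All terms satisfy \<open>eig s\<close>, so the other
  coefficients are \<open>qi s\<close> times these. The multipliers \<open>m\<close> become the
  coefficients \<open>MM\<close>.\<close>

lemma KL_step:
  assumes goodz: "\<And>z. z \<in> Zset s u \<Longrightarrow> good z (KL z)"
  shows "\<exists>m c. is_KL (s \<otimes> u) c \<and> eig s c \<and> (\<forall>z. b (m z) = m z) \<and>
    (\<forall>z. z \<notin> Zset s u \<longrightarrow> m z = 0) \<and>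
    D = c + (\<Sum>z\<in>Zset s u. scale (m z) (KL z))"
proof -
  let ?Z = "Zset s u"
  have "\<exists>m. (\<forall>z. b (m z) = m z) \<and> (\<forall>z. z \<notin> ?Z \<longrightarrow> m z = 0) \<and>
      (\<forall>z\<in>?Z. co (D - (\<Sum>z\<in>?Z. scale (m z) (KL z))) z \<in> Neg)"
    using eliminate[where Z = ?Z and N = "\<ell> u" and n = "\<ell> u" and D = D] goodz Zset_len
    by simp
  then obtain m where m: "\<And>z. b (m z) = m z" "\<And>z. z \<notin> ?Z \<Longrightarrow> m z = 0"
    and neg: "\<And>z. z \<in> ?Z \<Longrightarrow> co (D - (\<Sum>z\<in>?Z. scale (m z) (KL z))) z \<in> Neg"
    by blast
  define c where "c = D - (\<Sum>z\<in>?Z. scale (m z) (KL z))"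
  have z: "KL z \<in> Hc" "hbar (KL z) = KL z" "eig s (KL z)" "z \<prec>\<^sub>B u"
    "\<And>y. co (KL z) y \<noteq> 0 \<Longrightarrow> y \<prec>\<^sub>B u" if "z \<in> ?Z" for z
  proof -
    have zu: "z \<prec>\<^sub>B u" using that by (auto simp: Zset_def)
    show "KL z \<in> Hc" "hbar (KL z) = KL z" "eig s (KL z)" "z \<prec>\<^sub>B u"
      using goodz[OF that] that s by (auto simp: good_def is_KL_def Zset_def)
    show "y \<prec>\<^sub>B u" if "co (KL z) y \<noteq> 0" for y
      using goodz[OF \<open>z \<in> ?Z\<close>] that zu bless_trans[of y z u]
      by (cases "y = z") (auto simp: good_def is_KL_def)
  qed
  have far: "co c y = co D y" if "\<not> y \<prec>\<^sub>B u" for y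
  proof -
    have "co (KL z) y = 0" if "z \<in> ?Z" for z using z(5)[OF that] \<open>\<not> y \<prec>\<^sub>B u\<close> by blast
    then show ?thesis by (simp add: c_def lookup_minus lookup_sum)
  qed
  have cH: "c \<in> Hc" unfolding c_def using D_Hc z by auto
  have "hbar c = c"
    unfolding c_def using z m by (simp add: hbar_diff D_bar hbar_sum hbar_scale cong: sum.cong)
  moreover have "eig s c" unfolding c_def using D_eig z by (intro eig_diff eig_sum) auto
  moreover have "co c (s \<otimes> u) = 1"
    using far[of "s \<otimes> u"] D_top bless_imp[OF u_less] bless_imp[of "s \<otimes> u" u] by force
  moreover have neg': "co c y \<in> Neg" if "y \<noteq> s \<otimes> u" "y \<in> carrier W" "inversion y s" for y
  proof (cases "y \<in> ?Z")
    case True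
    then show ?thesis using neg by (simp add: c_def)
  next
    case False
    then have "\<not> y \<prec>\<^sub>B u" using that by (simp add: Zset_def)
    then show ?thesis using far D_Neg False that by simp
  qed
  moreover have "co c y \<in> Neg" if "y \<noteq> s \<otimes> u" for y
  proof -
    consider "y \<notin> carrier W" | "y \<in> carrier W" "inversion y s"
      | "y \<in> carrier W" "\<not> inversion y s" by blast
    then show ?thesis
    proof cases
      case 1
      then show ?thesis using Hc_lookup[OF cH] by simp
    next
      case 2
      then show ?thesis using neg' that by blast
    next
      case 3
      \<comment> \<open>If \<open>?x\<close> is the top element \<open>s u\<close>, its coefficient
        is 1 and the one at \<open>y\<close> is \<open>qi s\<close> itself, which lies in
        \<open>Neg\<close>.\<close>
      let ?x = "s \<otimes> y"
      have x: "?x \<in> carrier W" "inversion ?x s" "s \<otimes> ?x = y"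
        using 3 s inversion_S_mult by auto
      have "co c y = qi s * co c ?x"
        using \<open>eig s c\<close> x unfolding eig_def by metis
      then show ?thesis
        using neg'[of ?x] Neg_mult Neg_qi[OF s] \<open>co c (s \<otimes> u) = 1\<close> x
        by (cases "?x = s \<otimes> u") auto
    qed
  qed
  moreover have "y \<prec>\<^sub>B s \<otimes> u" if "co c y \<noteq> 0" "y \<noteq> s \<otimes> u" for y
    using far[of y] D_support[of y] that bless_trans[OF _ u_less, of y] by fastforce
  ultimately have "is_KL (s \<otimes> u) c" "eig s c" using cH by (auto simp: is_KL_def)
  then show ?thesis using m by (intro exI[of _ m] exI[of _ c]) (simp add: c_def)
qed

end

text \<open>Every descent of \<open>w\<close> yields a candidate that is an eigenvector for that
  descent. Uniqueness identifies the candidates, so one element serves all descents.\<close>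

lemma KL_good: "w \<in> carrier W \<Longrightarrow> good w (KL w)"
proof (induction "\<ell> w" arbitrary: w rule: less_induct)
  case less
  have step: "\<exists>c. is_KL w c \<and> eig s c" if s: "s \<in> S" "inversion w s" for s
  proof -
    let ?u = "s \<otimes> w"
    have u: "?u \<in> carrier W" "\<not> inversion ?u s" "s \<otimes> ?u = w" "\<ell> ?u < \<ell> w"
      using s less.prems inversion_S_mult len_S_mult(2)[of w s] by auto
    have "good z (KL z)" if "z \<in> Zset s ?u" for z
      using less.hyps[of z] Zset_len[OF that] Zset_carrier[OF that] u by simp
    then show ?thesis
      using KL_step[OF s(1) u(1,2) less.hyps[OF u(4,1)]] u(3) by auto
  qed
  have "\<exists>c. good w c"
  proof (cases "w = \<one>")
    case True
    have "good w (T \<one>)"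
      unfolding True good_def is_KL_def by (auto simp: lookup_T hbar_T)
    then show ?thesis by blast
  next
    case False
    then obtain s where s: "s \<in> S" "inversion w s"
      using ex_descent less.prems by blast
    then obtain c where c: "is_KL w c" using step by blast
    have "eig t c" if t: "t \<in> S" "inversion w t" for t
    proof -
      obtain d where d: "is_KL w d" "eig t d" using step t by blast
      then have "c = d" using KL_unique[of c w d] c by (simp add: is_KL_def)
      then show ?thesis using d by simp
    qed
    then show ?thesis using c by (auto simp: good_def)
  qed
  then show ?case unfolding KL_def by (rule someI_ex)
qed

lemma KL_Hc [simp, intro]: "w \<in> carrier W \<Longrightarrow> KL w \<in> Hc"
  and KL_bar: "w \<in> carrier W \<Longrightarrow> hbar (KL w) = KL w"
  and KL_top: "w \<in> carrier W \<Longrightarrow> co (KL w) w = 1"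
  and KL_Neg: "w \<in> carrier W \<Longrightarrow> y \<noteq> w \<Longrightarrow> co (KL w) y \<in> Neg"
  and KL_support: "w \<in> carrier W \<Longrightarrow> y \<noteq> w \<Longrightarrow> co (KL w) y \<noteq> 0 \<Longrightarrow> y \<prec>\<^sub>B w"
  using KL_good by (auto simp: good_def is_KL_def)

lemma KL_eqI:
  assumes "w \<in> carrier W" "c \<in> Hc" "hbar c = c" "co c w = 1" "\<And>y. y \<noteq> w \<Longrightarrow> co c y \<in> Neg"
  shows "KL w = c"
  using KL_unique[of "KL w" w c] assms KL_Hc KL_bar KL_top KL_Neg by blast

lemma KL_one: "KL \<one> = T \<one>"
  by (rule KL_eqI) (auto simp: lookup_T hbar_T)

text \<open>At a longest \<open>y\<close> with \<open>m y \<noteq> 0\<close> no other term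
  contributes. This makes the structure constants unique.\<close>

lemma KL_independent:
  assumes "Z \<subseteq> carrier W" "(\<Sum>z\<in>Z. scale (m z) (KL z)) = 0" "z \<in> Z"
  shows "m z = 0"
proof (rule ccontr)
  assume "m z \<noteq> 0"
  have fZ: "finite Z" using assms(1) fin finite_subset by blast
  let ?K = "{z \<in> Z. m z \<noteq> 0}"
  have K: "finite ?K" "?K \<noteq> {}" using fZ assms \<open>m z \<noteq> 0\<close> by auto
  define n where "n = Max (\<ell> ` ?K)"
  have "n \<in> \<ell> ` ?K" unfolding n_def using K by (intro Max_in) auto
  then obtain y where y: "y \<in> Z" "m y \<noteq> 0" "\<ell> y = n" by blast
  have max: "\<ell> w \<le> \<ell> y" if "w \<in> Z" "m w \<noteq> 0" for w
    unfolding y n_def using that K(1) by (intro Max_ge) auto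
  have "m w * co (KL w) y = (if w = y then m y else 0)" if w: "w \<in> Z" for w
  proof (cases "w = y \<or> m w = 0")
    case True
    then show ?thesis using KL_top w assms(1) by auto
  next
    case False
    then have "\<not> y \<prec>\<^sub>B w" using max[OF w] bless_imp[of y w] by fastforce
    then have "co (KL w) y = 0" using KL_support[of w y] w assms(1) False by auto
    then show ?thesis using False by simp
  qed
  then have "co (\<Sum>z\<in>Z. scale (m z) (KL z)) y = m y"
    using y fZ by (simp add: lookup_sum)
  then show False using y assms(2) by simp
qed

section \<open>The structure constants \<open>MM\<close>\<close>

definition is_MM :: "'a \<Rightarrow> 'a \<Rightarrow> ('a \<Rightarrow> 'r) \<Rightarrow> bool"
  where "is_MM s u m \<longleftrightarrow> (\<forall>z. z \<notin> Zset s u \<longrightarrow> m z = 0) \<and>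
    T s \<star> KL u = KL (s \<otimes> u) - scale (qi s) (KL u) + (\<Sum>z\<in>Zset s u. scale (m z) (KL z))"

definition MM :: "'a \<Rightarrow> 'a \<Rightarrow> 'a \<Rightarrow> 'r"
  where "MM s u = (SOME m. is_MM s u m)"

lemma is_MM_unique:
  assumes "is_MM s u m" "is_MM s u m'"
  shows "m = m'"
proof
  fix z
  have "(\<Sum>z\<in>Zset s u. scale (m z - m' z) (KL z)) = 0"
    using assms unfolding is_MM_def by (simp add: diff_scale sum_subtractf algebra_simps)
  then have "m z - m' z = 0" if "z \<in> Zset s u"
    using KL_independent[of "Zset s u" "\<lambda>z. m z - m' z" z] that Zset_carrier by blast
  then show "m z = m' z" using assms unfolding is_MM_def by (cases "z \<in> Zset s u") auto
qed

text \<open>The construction of the basis subtracts bar-fixed multiples only, so bar-invariant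
  coefficients exist; uniqueness then transfers the invariance to \<open>MM\<close>.\<close>

lemma ex_MM:
  assumes "s \<in> S" "u \<in> carrier W" "\<not> inversion u s"
  shows "\<exists>m. is_MM s u m \<and> (\<forall>z. b (m z) = m z)"
proof -
  have "good z (KL z)" if "z \<in> Zset s u" for z
    using KL_good Zset_carrier[OF that] by blast
  then obtain m c where mc: "is_KL (s \<otimes> u) c" "\<forall>z. b (m z) = m z" "\<forall>z. z \<notin> Zset s u \<longrightarrow> m z = 0"
    "D s u = c + (\<Sum>z\<in>Zset s u. scale (m z) (KL z))"
    using KL_step[OF assms KL_good[OF assms(2)]] by blast
  have "KL (s \<otimes> u) = c"
    by (rule KL_eqI) (use mc(1) assms in \<open>auto simp: is_KL_def\<close>)
  then show ?thesis
    using mc D_def[OF assms KL_good[OF assms(2)]]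
    by (intro exI[of _ m]) (auto simp: is_MM_def algebra_simps)
qed

lemma MM_is_MM: "s \<in> S \<Longrightarrow> u \<in> carrier W \<Longrightarrow> \<not> inversion u s \<Longrightarrow> is_MM s u (MM s u)"
  unfolding MM_def using ex_MM someI_ex by metis

lemma MM_eqI: "is_MM s u m \<Longrightarrow> MM s u = m"
  unfolding MM_def using is_MM_unique someI by metis

lemma MM_bar: "s \<in> S \<Longrightarrow> u \<in> carrier W \<Longrightarrow> \<not> inversion u s \<Longrightarrow> b (MM s u z) = MM s u z"
  using ex_MM MM_eqI by metis

lemma MM_outside: "s \<in> S \<Longrightarrow> u \<in> carrier W \<Longrightarrow> \<not> inversion u s \<Longrightarrow> z \<notin> Zset s u \<Longrightarrow> MM s u z = 0"
  using MM_is_MM by (simp add: is_MM_def)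

lemma MM_eq:
  assumes "s \<in> S" "u \<in> carrier W" "\<not> inversion u s"
  shows "T s \<star> KL u = KL (s \<otimes> u) - scale (qi s) (KL u) + (\<Sum>z\<in>Zset s u. scale (MM s u z) (KL z))"
  using MM_is_MM[OF assms] by (simp add: is_MM_def)

lemma MM_lookup:
  assumes "s \<in> S" "u \<in> carrier W" "\<not> inversion u s" "x \<in> carrier W"
  shows "co (KL (s \<otimes> u)) x + (\<Sum>z\<in>Zset s u. MM s u z * co (KL z) x) =
    co (KL u) (s \<otimes> x) + (if inversion x s then q s else qi s) * co (KL u) x"
proof -
  have "KL (s \<otimes> u) + (\<Sum>z\<in>Zset s u. scale (MM s u z) (KL z)) = D s u"
    using MM_eq[OF assms(1-3)] D_def[OF assms(1-3) KL_good[OF assms(2)]] by (simp add: algebra_simps)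
  then have "co (KL (s \<otimes> u) + (\<Sum>z\<in>Zset s u. scale (MM s u z) (KL z))) x = co (D s u) x"
    by simp
  then show ?thesis
    using lookup_D[OF assms(1-3) KL_good[OF assms(2)] assms(4)] by (simp add: lookup_add lookup_sum)
qed

end

section \<open>Exponent bounds\<close>

text \<open>\<open>Bx n\<close> stands for the ring elements whose exponents have size at most
  \<open>n\<close> in the parameters of \<open>J\<close>. \<open>Bx_split\<close> expresses that a
  bar-fixed \<open>m\<close> is determined by its non-negative exponents, which a summand from
  \<open>Neg\<close> cannot hide.\<close>

locale hecke_kl_filtered = hecke_kl W S q qi b Neg for W (structure) and S
    and q qi :: "'a \<Rightarrow> 'r::comm_ring_1" and b Neg +
  fixes J :: "'a set" and Bx :: "nat \<Rightarrow> 'r set"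
  assumes JS: "J \<subseteq> S"
    and Bx_0 [simp]: "0 \<in> Bx n"
    and Bx_1: "1 \<in> Bx 0"
    and Bx_add: "x \<in> Bx n \<Longrightarrow> y \<in> Bx n \<Longrightarrow> x + y \<in> Bx n"
    and Bx_minus: "x \<in> Bx n \<Longrightarrow> - x \<in> Bx n"
    and Bx_mono: "x \<in> Bx n \<Longrightarrow> n \<le> n' \<Longrightarrow> x \<in> Bx n'"
    and Bx_mult: "x \<in> Bx n \<Longrightarrow> y \<in> Bx n' \<Longrightarrow> x * y \<in> Bx (n + n')"
    and Bx_q: "s \<in> J \<Longrightarrow> q s \<in> Bx 1"
    and Bx_qi: "s \<in> J \<Longrightarrow> qi s \<in> Bx 1"
    and Bx_split: "b m = m \<Longrightarrow> p \<in> Neg \<Longrightarrow> m + p \<in> Bx n \<Longrightarrow> m \<in> Bx n"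
begin

lemma Bx_diff: "x \<in> Bx n \<Longrightarrow> y \<in> Bx n \<Longrightarrow> x - y \<in> Bx n"
  using Bx_add[of x n "- y"] Bx_minus by simp

lemma Bx_sum: "(\<And>i. i \<in> I \<Longrightarrow> f i \<in> Bx n) \<Longrightarrow> sum f I \<in> Bx n"
  by (induction I rule: infinite_finite_induct) (auto intro: Bx_add)

text \<open>At \<open>z\<close>, the equation \<open>MM_lookup\<close> has two unknowns:
  \<open>MM s u z\<close> and a coefficient of \<open>KL (s u)\<close> that lies in
  \<open>Neg\<close>; \<open>Bx_split\<close> separates them. The other constants in the same
  equation belong to longer elements, hence a downward induction on the length of
  \<open>z\<close>.\<close>

lemma MM_Bx_step:
  assumes s: "s \<in> J" and u: "u \<in> par J" and up: "\<not> inversion u s"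
    and IH: "\<And>z y. z \<in> par J \<Longrightarrow> \<ell> z \<le> \<ell> u \<Longrightarrow> y \<in> carrier W \<Longrightarrow> co (KL z) y \<in> Bx (\<ell> z - \<ell> y)"
  shows "MM s u z \<in> Bx (\<ell> u + 1 - \<ell> z)" and "x \<in> carrier W \<Longrightarrow> co (KL (s \<otimes> u)) x \<in> Bx (\<ell> u + 1 - \<ell> x)"
proof -
  have sS: "s \<in> S" and uc: "u \<in> carrier W" using s u JS par_carrier by auto
  have su: "\<ell> (s \<otimes> u) = \<ell> u + 1" using len_S_mult(1)[OF uc sS] up by simp
  have Z: "z \<in> par J" "\<ell> z < \<ell> u" "z \<in> carrier W" if "z \<in> Zset s u" for z
    using that par_bless_closed[OF _ JS u] Zset_len Zset_carrier by (auto simp: Zset_def)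
  let ?d = "\<lambda>x. co (KL u) (s \<otimes> x) + (if inversion x s then q s else qi s) * co (KL u) x"
  have d: "?d x \<in> Bx (\<ell> u + 1 - \<ell> x)" if x: "x \<in> carrier W" for x
  proof -
    have "\<ell> x \<le> \<ell> (s \<otimes> x) + 1" using len_S_mult[OF x sS] by (cases "inversion x s") auto
    then have "\<ell> u - \<ell> (s \<otimes> x) \<le> \<ell> u + 1 - \<ell> x" by simp
    moreover have "co (KL u) (s \<otimes> x) \<in> Bx (\<ell> u - \<ell> (s \<otimes> x))"
      using IH[OF u order.refl, of "s \<otimes> x"] x sS by simp
    ultimately have "co (KL u) (s \<otimes> x) \<in> Bx (\<ell> u + 1 - \<ell> x)"
      using Bx_mono by blast
    moreover have "(if inversion x s then q s else qi s) * co (KL u) x \<in> Bx (\<ell> u + 1 - \<ell> x)"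
    proof (cases "\<ell> x \<le> \<ell> u")
      case True
      have "(if inversion x s then q s else qi s) * co (KL u) x \<in> Bx (1 + (\<ell> u - \<ell> x))"
        using IH[OF u order.refl x] Bx_q[OF s] Bx_qi[OF s] by (intro Bx_mult) auto
      moreover have "1 + (\<ell> u - \<ell> x) = \<ell> u + 1 - \<ell> x" using True by simp
      ultimately show ?thesis by (simp only:)
    next
      \<comment> \<open>Here the natural number difference \<open>\<ell> u - \<ell> x\<close> is
        truncated to 0 and the product bound would be too large by one; the coefficient is zero for
        reasons of length.\<close>
      case False
      then have "co (KL u) x = 0"
        using KL_support[OF uc, of x] bless_imp[of x u] by fastforce
      then show ?thesis by simp
    qed
    ultimately show ?thesis by (rule Bx_add)
  qed
  have prod: "MM s u z * co (KL z) x \<in> Bx (\<ell> u + 1 - \<ell> x)"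
    if "z \<in> Zset s u" "MM s u z \<in> Bx (\<ell> u + 1 - \<ell> z)" "x \<in> carrier W" for z x
  proof (cases "\<ell> x \<le> \<ell> z")
    case True
    have "MM s u z * co (KL z) x \<in> Bx ((\<ell> u + 1 - \<ell> z) + (\<ell> z - \<ell> x))"
      using that Z[OF that(1)] IH by (intro Bx_mult) auto
    then show ?thesis using True Z[OF that(1)] by simp
  next
    case False
    then have "co (KL z) x = 0"
      using KL_support[of z x] Z[OF that(1)] bless_imp[of x z] by fastforce
    then show ?thesis by simp
  qed
  have MM_Bx: "MM s u z \<in> Bx (\<ell> u + 1 - \<ell> z)" for z
  proof (induction "\<ell> u - \<ell> z" arbitrary: z rule: less_induct)
    case less
    show ?case
    proof (cases "z \<in> Zset s u")
      case True
      let ?r = "\<Sum>z'\<in>Zset s u - {z}. MM s u z' * co (KL z') z"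
      have "MM s u z' * co (KL z') z \<in> Bx (\<ell> u + 1 - \<ell> z)" if z': "z' \<in> Zset s u - {z}" for z'
      proof (cases "z \<prec>\<^sub>B z'")
        case True
        then have "\<ell> u - \<ell> z' < \<ell> u - \<ell> z" using bless_imp[OF True] Z[of z'] z' by auto
        then show ?thesis using less.hyps prod z' Z \<open>z \<in> Zset s u\<close> by blast
      next
        case False
        then have "co (KL z') z = 0" using KL_support[of z' z] z' Z[of z'] by auto
        then show ?thesis by simp
      qed
      then have r: "?r \<in> Bx (\<ell> u + 1 - \<ell> z)" by (rule Bx_sum)
      have "(\<Sum>z'\<in>Zset s u. MM s u z' * co (KL z') z) = MM s u z + ?r"
        using True KL_top Z[OF True] by (subst sum.remove[of _ z]) auto
      then have "MM s u z + co (KL (s \<otimes> u)) z = ?d z - ?r"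
        using MM_lookup[OF sS uc up, of z] Z[OF True] by (simp add: algebra_simps)
      also have "\<dots> \<in> Bx (\<ell> u + 1 - \<ell> z)" using d[of z] Z[OF True] r by (intro Bx_diff) auto
      finally have "MM s u z + co (KL (s \<otimes> u)) z \<in> Bx (\<ell> u + 1 - \<ell> z)" .
      moreover have "z \<noteq> s \<otimes> u" using Z(2)[OF True] su by auto
      then have "co (KL (s \<otimes> u)) z \<in> Neg" using KL_Neg[of "s \<otimes> u" z] sS uc by auto
      ultimately show ?thesis using Bx_split MM_bar[OF sS uc up] by blast
    qed (use MM_outside[OF sS uc up] in simp)
  qed
  then show "MM s u z \<in> Bx (\<ell> u + 1 - \<ell> z)" .
  assume x: "x \<in> carrier W"
  have "co (KL (s \<otimes> u)) x = ?d x - (\<Sum>z\<in>Zset s u. MM s u z * co (KL z) x)"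
    using MM_lookup[OF sS uc up x] by (simp add: algebra_simps)
  also have "\<dots> \<in> Bx (\<ell> u + 1 - \<ell> x)"
    using d[OF x] prod MM_Bx x by (intro Bx_diff Bx_sum) auto
  finally show "co (KL (s \<otimes> u)) x \<in> Bx (\<ell> u + 1 - \<ell> x)" .
qed

lemma KL_Bx:
  assumes "w \<in> par J" "y \<in> carrier W"
  shows "co (KL w) y \<in> Bx (\<ell> w - \<ell> y)"
  using assms
proof (induction "\<ell> w" arbitrary: w y rule: less_induct)
  case less
  show ?case
  proof (cases "w = \<one>")
    case True
    then show ?thesis using Bx_1 by (auto simp: KL_one lookup_T)
  next
    case False
    then obtain s u where su: "s \<in> J" "u \<in> par J" "\<not> inversion u s" "w = s \<otimes> u"
      using par_descent[OF JS less.prems(1)] by metis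
    have w: "\<ell> w = \<ell> u + 1"
      using len_S_mult(1)[of u s] su JS par_carrier by auto
    have "co (KL z) y \<in> Bx (\<ell> z - \<ell> y)" if "z \<in> par J" "\<ell> z \<le> \<ell> u" "y \<in> carrier W" for z y
      using less.hyps[of z y] that w by simp
    from MM_Bx_step(2)[OF su(1-3) this less.prems(2)] show ?thesis using w su(4) by simp
  qed
qed

lemma MM_Bx: "s \<in> J \<Longrightarrow> u \<in> par J \<Longrightarrow> \<not> inversion u s \<Longrightarrow> MM s u z \<in> Bx (\<ell> u + 1 - \<ell> z)"
  by (rule MM_Bx_step(1)) (auto intro: KL_Bx)

end

section \<open>Factorization along commuting parabolic subgroups\<close>

locale hecke_kl_parts = hecke_kl W S q qi b Neg + commuting_parts W S J K for W (structure) and S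
    and q qi :: "'a \<Rightarrow> 'r::comm_ring_1" and b Neg J K
begin

lemma finite_par [simp, intro]: "finite (par J)" "finite (par K)"
  by (rule finite_subset[OF _ fin]; blast)+

lemma T_mult_par:
  assumes "x \<in> par J" "y \<in> par K"
  shows "T x \<star> T y = T (x \<otimes> y)"
  using JS assms(1)
proof (induction rule: par_induct)
  case (step s x)
  have c: "s \<in> S" "s \<in> par J" "x \<in> carrier W" "y \<in> carrier W"
    using step assms JS par_gen by auto
  have "T (s \<otimes> x) \<star> T y = T s \<star> (T x \<star> T y)"
    using step c by (simp add: mult_assoc flip: T_S_mult_T(1))
  also have "\<dots> = T (s \<otimes> (x \<otimes> y))"
    using step c inversion_par_mult[of x y s] assms by (simp add: T_S_mult_T(1))
  finally show ?case using c by (simp add: m_assoc)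
qed (use assms in simp)

lemma KL_expand_par:
  assumes "L \<subseteq> S" "w \<in> par L"
  shows "KL w = (\<Sum>a\<in>par L. scale (co (KL w) a) (T a))"
proof -
  have w: "w \<in> carrier W" using assms par_carrier by blast
  have "(\<Sum>a\<in>par L. scale (co (KL w) a) (T a)) = (\<Sum>a\<in>carrier W. scale (co (KL w) a) (T a))"
  proof (rule sum.mono_neutral_left[OF fin])
    show "par L \<subseteq> carrier W" using par_carrier assms by blast
    show "\<forall>a\<in>carrier W - par L. scale (co (KL w) a) (T a) = 0"
    proof
      fix a assume "a \<in> carrier W - par L"
      then have "co (KL w) a = 0"
        using KL_support[OF w, of a] par_bless_closed[OF _ assms, of a] assms(2) by blast
      then show "scale (co (KL w) a) (T a) = 0" by simp
    qed
  qed
  then show ?thesis using Hc_expand[of "KL w"] w by simp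
qed

lemma lookup_KL_mult:
  assumes "x \<in> par J" "y \<in> par K"
  shows "co (KL x \<star> KL y) v =
    (\<Sum>a\<in>par J. \<Sum>c\<in>par K. if v = a \<otimes> c then co (KL x) a * co (KL y) c else 0)"
proof -
  have "KL x \<star> KL y =
      (\<Sum>a\<in>par J. \<Sum>c\<in>par K. scale (co (KL x) a * co (KL y) c) (T (a \<otimes> c)))"
    by (subst KL_expand_par[OF JS assms(1)], subst KL_expand_par[OF KS assms(2)])
      (simp add: mult_sum_left mult_sum_right mult_scale_left mult_scale_right T_mult_par
        scale_sum scale_scale, subst sum.swap, simp add: mult.commute)
  then show ?thesis
    by (auto simp: lookup_sum lookup_T intro!: sum.cong)
qed

lemma lookup_KL_mult_par:
  assumes "x \<in> par J" "y \<in> par K" "a \<in> par J" "c \<in> par K"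
  shows "co (KL x \<star> KL y) (a \<otimes> c) = co (KL x) a * co (KL y) c"
proof -
  have "co (KL x \<star> KL y) (a \<otimes> c) =
      (\<Sum>a'\<in>par J. \<Sum>c'\<in>par K. if c' = c then if a' = a then co (KL x) a * co (KL y) c else 0 else 0)"
    unfolding lookup_KL_mult[OF assms(1,2)]
  proof (rule sum.cong[OF HOL.refl], rule sum.cong[OF HOL.refl])
    fix a' c' assume "a' \<in> par J" "c' \<in> par K"
    note inj = par_mult_inj[OF assms(3,4) this]
    show "(if a \<otimes> c = a' \<otimes> c' then co (KL x) a' * co (KL y) c' else 0) =
        (if c' = c then if a' = a then co (KL x) a * co (KL y) c else 0 else 0)"
    proof (cases "a \<otimes> c = a' \<otimes> c'")
      case True
      then show ?thesis using inj[OF True] by simp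
    next
      case False
      then have "\<not> (a' = a \<and> c' = c)" by blast
      then show ?thesis using False by simp
    qed
  qed
  then show ?thesis using assms by simp
qed

lemma lookup_KL_mult_other:
  assumes "x \<in> par J" "y \<in> par K" "\<And>a c. a \<in> par J \<Longrightarrow> c \<in> par K \<Longrightarrow> v \<noteq> a \<otimes> c"
  shows "co (KL x \<star> KL y) v = 0"
  unfolding lookup_KL_mult[OF assms(1,2)] using assms(3) by (auto intro!: sum.neutral)

text \<open>The product is fixed by bar, and its coefficient at \<open>a c\<close> is a coefficient
  of \<open>KL x\<close> times one of \<open>KL y\<close>. Each factor is 1 at the top and in
  \<open>Neg\<close> elsewhere, so uniqueness applies.\<close>

lemma KL_mult:
  assumes "x \<in> par J" "y \<in> par K"
  shows "KL (x \<otimes> y) = KL x \<star> KL y"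
proof (rule KL_eqI)
  have xy: "x \<in> carrier W" "y \<in> carrier W" using assms by auto
  then show "x \<otimes> y \<in> carrier W" "KL x \<star> KL y \<in> Hc" "hbar (KL x \<star> KL y) = KL x \<star> KL y"
    by (auto simp: hbar_mult KL_bar)
  show "co (KL x \<star> KL y) (x \<otimes> y) = 1"
    using assms xy KL_top by (simp add: lookup_KL_mult_par)
  fix v assume v: "v \<noteq> x \<otimes> y"
  show "co (KL x \<star> KL y) v \<in> Neg"
  proof (cases "\<exists>a\<in>par J. \<exists>c\<in>par K. v = a \<otimes> c")
    case True
    then obtain a c where ac: "a \<in> par J" "c \<in> par K" "v = a \<otimes> c" by blast
    then have "co (KL x \<star> KL y) v = co (KL x) a * co (KL y) c"
      using lookup_KL_mult_par assms by simp
    also have "\<dots> \<in> Neg"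
      using ac v KL_top KL_Neg[of x a] KL_Neg[of y c] Neg_mult xy
      by (cases "a = x"; cases "c = y") auto
    finally show ?thesis .
  next
    case False
    then have "co (KL x \<star> KL y) v = 0" using lookup_KL_mult_other[OF assms, of v] by blast
    then show ?thesis by simp
  qed
qed

lemma lookup_KL_par_cases:
  assumes "x \<in> par J" "y \<in> par K" "co (KL (x \<otimes> y)) v \<noteq> 0"
  shows "\<exists>a\<in>par J. \<exists>c\<in>par K. v = a \<otimes> c \<and> co (KL (x \<otimes> y)) v = co (KL x) a * co (KL y) c"
  using lookup_KL_mult_par[OF assms(1,2)] lookup_KL_mult_other[OF assms(1,2), of v] assms(3)
  unfolding KL_mult[OF assms(1,2)] by blast

text \<open>Multiply the equation defining \<open>MM s x\<close> by \<open>KL y\<close> on the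
  right. By \<open>KL_mult\<close> it becomes the equation for \<open>x y\<close>, and uniqueness
  reads off its coefficients: they only depend on the factor in \<open>par J\<close>.\<close>

lemma MM_par:
  assumes s: "s \<in> J" and x: "x \<in> par J" and y: "y \<in> par K" and up: "\<not> inversion x s"
    and nz: "MM s (x \<otimes> y) v \<noteq> 0"
  shows "\<exists>z\<in>Zset s x. MM s (x \<otimes> y) v = MM s x z"
proof -
  have c: "s \<in> S" "s \<in> carrier W" "x \<in> carrier W" "y \<in> carrier W" using assms JS by auto
  have sJ: "s \<in> par J" using par_gen JS s by blast
  have Z: "z \<in> par J" "z \<in> carrier W" if "z \<in> Zset s x" for z
    using that par_bless_closed[OF _ JS x] by (auto simp: Zset_def)
  \<comment> \<open>The coefficients for \<open>x\<close> transported along right multiplication by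
    \<open>y\<close>, and 0 elsewhere.\<close>
  define m where "m v = (if \<exists>z\<in>Zset s x. v = z \<otimes> y then MM s x (v \<otimes> inv y) else 0)" for v
  have m: "m (z \<otimes> y) = MM s x z" if "z \<in> Zset s x" for z
    using that Z[OF that] c by (auto simp: m_def m_assoc)
  have ZZ: "z \<otimes> y \<in> Zset s (x \<otimes> y)" if "z \<in> Zset s x" for z
    using that par_mult_bless[of z x y] inversion_par_mult[of z y s] Z[OF that] x y sJ
    by (auto simp: Zset_def)
  have inj: "inj_on (\<lambda>z. z \<otimes> y) (Zset s x)"
    by (rule inj_onI) (use Z c in simp)
  have "(\<Sum>v\<in>Zset s (x \<otimes> y). scale (m v) (KL v)) =
      (\<Sum>v\<in>(\<lambda>z. z \<otimes> y) ` Zset s x. scale (m v) (KL v))"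
    by (rule sum.mono_neutral_right) (use ZZ in \<open>auto simp: m_def\<close>)
  also have "\<dots> = (\<Sum>z\<in>Zset s x. scale (MM s x z) (KL z \<star> KL y))"
    using inj m Z y by (simp add: sum.reindex KL_mult)
  finally have sum: "(\<Sum>v\<in>Zset s (x \<otimes> y). scale (m v) (KL v)) =
      (\<Sum>z\<in>Zset s x. scale (MM s x z) (KL z \<star> KL y))" .
  have "T s \<star> KL (x \<otimes> y) = T s \<star> KL x \<star> KL y"
    using c by (simp add: KL_mult x y mult_assoc)
  also have "\<dots> = KL (s \<otimes> x) \<star> KL y - scale (qi s) (KL x \<star> KL y) +
      (\<Sum>z\<in>Zset s x. scale (MM s x z) (KL z \<star> KL y))"
    unfolding MM_eq[OF c(1,3) up]
    by (simp add: mult_add_left mult_diff_left mult_scale_left mult_sum_left)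
  also have "KL (s \<otimes> x) \<star> KL y = KL (s \<otimes> (x \<otimes> y))"
    using KL_mult[of "s \<otimes> x" y] par_mult[OF JS sJ x] y c by (simp add: m_assoc)
  finally have "is_MM s (x \<otimes> y) m"
    unfolding is_MM_def sum using ZZ by (auto simp: m_def KL_mult x y)
  then have "MM s (x \<otimes> y) = m" by (rule MM_eqI)
  moreover from this nz obtain z where "z \<in> Zset s x" "v = z \<otimes> y"
    by (auto simp: m_def split: if_splits)
  ultimately show ?thesis using m by auto
qed

end

section \<open>Conjugacy classes of generators\<close>

context coxeter
begin

definition adj :: "'a \<Rightarrow> 'a \<Rightarrow> bool"
  where "adj s t \<longleftrightarrow> s \<in> S \<and> t \<in> S \<and> s \<otimes> t \<noteq> t \<otimes> s"

definition conjugate :: "'a \<Rightarrow> 'a \<Rightarrow> bool"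
  where "conjugate s t \<longleftrightarrow> (\<exists>x\<in>carrier W. s \<otimes> x = x \<otimes> t)"

lemma adj_sym: "adj s t \<Longrightarrow> adj t s"
  by (auto simp: adj_def)

lemma conj_refl [simp]: "s \<in> carrier W \<Longrightarrow> conjugate s s"
  unfolding conjugate_def by (rule bexI[of _ \<one>]) auto

lemma conj_sym:
  assumes "s \<in> carrier W" "t \<in> carrier W" "conjugate s t"
  shows "conjugate t s"
proof -
  obtain x where x: "x \<in> carrier W" "s \<otimes> x = x \<otimes> t" using assms by (auto simp: conjugate_def)
  have "t \<otimes> inv x = inv x \<otimes> (x \<otimes> t) \<otimes> inv x" using assms x(1) by (simp add: m_assoc)
  also have "\<dots> = inv x \<otimes> s" using assms x(1) by (simp add: m_assoc flip: x(2))
  finally show ?thesis unfolding conjugate_def using x by blast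
qed

lemma conj_trans:
  assumes "s \<in> carrier W" "t \<in> carrier W" "u \<in> carrier W" "conjugate s t" "conjugate t u"
  shows "conjugate s u"
proof -
  obtain x y where x: "x \<in> carrier W" "s \<otimes> x = x \<otimes> t" and y: "y \<in> carrier W" "t \<otimes> y = y \<otimes> u"
    using assms by (auto simp: conjugate_def)
  have "s \<otimes> (x \<otimes> y) = (s \<otimes> x) \<otimes> y" using assms(1) x(1) y(1) by (simp add: m_assoc)
  also have "\<dots> = x \<otimes> (t \<otimes> y)" unfolding x(2) using assms(2) x(1) y(1) by (simp add: m_assoc)
  also have "\<dots> = (x \<otimes> y) \<otimes> u" unfolding y(2) using assms(3) x(1) y(1) by (simp add: m_assoc)
  finally show ?thesis unfolding conjugate_def using x y by blast
qed

definition cls :: "'a \<Rightarrow> 'a set"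
  where "cls s = {t \<in> S. conjugate s t}"

lemma cls_eq_iff:
  assumes "s \<in> S" "t \<in> S"
  shows "cls s = cls t \<longleftrightarrow> conjugate s t"
proof
  assume "cls s = cls t"
  then have "t \<in> cls s" using assms by (auto simp: cls_def)
  then show "conjugate s t" by (simp add: cls_def)
next
  assume "conjugate s t"
  moreover from this have "conjugate t s" using conj_sym[of s t] assms by blast
  ultimately have "conjugate s u \<longleftrightarrow> conjugate t u" if "u \<in> S" for u
    using conj_trans[of s t u] conj_trans[of t s u] assms that by blast
  then show "cls s = cls t" by (auto simp: cls_def)
qed

end

context finite_coxeter
begin

lemma finite_S [simp, intro]: "finite S"
  using finite_subset[OF S_subset fin] .

lemma ord_comm: "s \<in> S \<Longrightarrow> t \<in> S \<Longrightarrow> ord (s \<otimes> t) = ord (t \<otimes> s)"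
  using ord_inv[of "s \<otimes> t"] by (simp add: inv_mult_group)

lemma ord_pos: "s \<in> S \<Longrightarrow> t \<in> S \<Longrightarrow> ord (s \<otimes> t) \<ge> 1"
  using ord_ge_1[OF fin, of "s \<otimes> t"] by simp

lemma ord_ge_2:
  assumes "s \<in> S" "t \<in> S" "s \<noteq> t"
  shows "ord (s \<otimes> t) \<ge> 2"
proof -
  have "s \<otimes> t \<noteq> \<one>"
    using assms S_cancel[of s t] by (metis S_carrier r_one)
  then have "ord (s \<otimes> t) \<noteq> 1" using ord_eq_1[of "s \<otimes> t"] assms by auto
  then show ?thesis using ord_pos[OF assms(1,2)] by simp
qed

lemma ord_adj_ge_3:
  assumes "adj s t"
  shows "ord (s \<otimes> t) \<ge> 3"
proof -
  have st: "s \<in> S" "t \<in> S" "s \<otimes> t \<noteq> t \<otimes> s" using assms by (auto simp: adj_def)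
  have "ord (s \<otimes> t) \<noteq> 2"
  proof
    assume "ord (s \<otimes> t) = 2"
    then have "(s \<otimes> t) [^] (2::nat) = \<one>" using pow_ord_eq_1[of "s \<otimes> t"] st by simp
    then have "(s \<otimes> t) \<otimes> (s \<otimes> t) = \<one>" using st by (simp add: numeral_2_eq_2)
    then have "inv (s \<otimes> t) = s \<otimes> t" using st by (intro inv_equality) auto
    then show False using st by (simp add: inv_mult_group)
  qed
  moreover have "s \<noteq> t" using st by auto
  ultimately show ?thesis using ord_ge_2[of s t] st by simp
qed

text \<open>Label 3 is the braid relation \<open>s t s = t s t\<close>, which makes \<open>s\<close>
  and \<open>t\<close> conjugate by \<open>t s\<close>.\<close>

lemma ord_adj_ge_4:
  assumes "adj s t" "\<not> conjugate s t"
  shows "ord (s \<otimes> t) \<ge> 4"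
proof -
  have st: "s \<in> S" "t \<in> S" using assms by (auto simp: adj_def)
  have "ord (s \<otimes> t) \<noteq> 3"
  proof
    assume "ord (s \<otimes> t) = 3"
    then have "(s \<otimes> t) [^] (3::nat) = \<one>" using pow_ord_eq_1[of "s \<otimes> t"] st by simp
    then have "(s \<otimes> t \<otimes> s) \<otimes> (t \<otimes> s \<otimes> t) = \<one>"
      using st by (simp add: numeral_3_eq_3 m_assoc)
    then have "inv (t \<otimes> s \<otimes> t) = s \<otimes> t \<otimes> s" using st by (intro inv_equality) auto
    then have "t \<otimes> s \<otimes> t = s \<otimes> (t \<otimes> s)" using st by (simp add: inv_mult_group m_assoc)
    then have "s \<otimes> (t \<otimes> s) = (t \<otimes> s) \<otimes> t" by simp
    then show False using assms(2) st unfolding conjugate_def by blast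
  qed
  then show ?thesis using ord_adj_ge_3[OF assms(1)] by simp
qed

subsection \<open>The geometric representation\<close>

definition cs :: "'a \<Rightarrow> 'a \<Rightarrow> real"
  where "cs s t = cos (pi / real (ord (s \<otimes> t)))"

text \<open>The Tits form of the basis vector of \<open>s\<close> with \<open>f\<close>;
  \<open>sig s\<close> is the corresponding reflection.\<close>

definition bf :: "'a \<Rightarrow> ('a \<Rightarrow> real) \<Rightarrow> real"
  where "bf s f = f s - (\<Sum>t\<in>S - {s}. cs s t * f t)"

definition sig :: "'a \<Rightarrow> ('a \<Rightarrow> real) \<Rightarrow> ('a \<Rightarrow> real)"
  where "sig s f = f(s := f s - 2 * bf s f)"

lemma cs_comm: "s \<in> S \<Longrightarrow> t \<in> S \<Longrightarrow> cs s t = cs t s"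
  by (simp add: cs_def ord_comm)

lemma cs_mono:
  assumes "s \<in> S" "t \<in> S" "1 \<le> k" "k \<le> ord (s \<otimes> t)"
  shows "cos (pi / real k) \<le> cs s t"
  unfolding cs_def using assms
  by (intro cos_monotone_0_pi_le) (auto intro!: divide_left_mono mult_pos_pos simp: field_simps)

lemma cs_nonneg: "s \<in> S \<Longrightarrow> t \<in> S \<Longrightarrow> s \<noteq> t \<Longrightarrow> 0 \<le> cs s t"
  using cs_mono[of s t 2] ord_ge_2[of s t] by (simp add: cos_pi_half)

lemma cs_adj: "adj s t \<Longrightarrow> 1 / 2 \<le> cs s t"
  using cs_mono[of s t 3] ord_adj_ge_3[of s t] by (simp add: adj_def cos_60)

lemma cs_adj_not_conj: "adj s t \<Longrightarrow> \<not> conjugate s t \<Longrightarrow> sqrt 2 / 2 \<le> cs s t"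
  using cs_mono[of s t 4] ord_adj_ge_4[of s t] by (simp add: adj_def cos_45)

lemma sig_square: "sig s (sig s f) = f"
proof -
  have "(\<Sum>t\<in>S - {s}. cs s t * sig s f t) = (\<Sum>t\<in>S - {s}. cs s t * f t)"
    by (rule sum.cong) (auto simp: sig_def)
  then have "bf s (sig s f) = - bf s f" by (simp add: bf_def) (simp add: sig_def bf_def)
  then show ?thesis by (simp add: sig_def[of s "sig s f"]) (simp add: sig_def fun_eq_iff)
qed

text \<open>On the coordinates \<open>s\<close> and \<open>t\<close> the product of the two
  reflections is, in the metric of the Tits form, a rotation by \<open>2 \<pi> / m\<close> about a
  point that depends on the other coordinates; \<open>m\<close> iterations close up.\<close>

lemma sig_relator:
  assumes st: "s \<in> S" "t \<in> S"
  shows "foldr sig (concat (replicate (ord (s \<otimes> t)) [s, t])) f = f"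
proof (cases "s = t")
  case True
  then have "ord (s \<otimes> t) = 1" using st ord_id by simp
  then show ?thesis using True sig_square by simp
next
  case False
  define m where "m = ord (s \<otimes> t)"
  define \<theta> where "\<theta> = pi / real m"
  have m: "m \<ge> 2" using ord_ge_2[OF st False] by (simp add: m_def)
  have "0 < \<theta>" "\<theta> < pi" using m by (auto simp: \<theta>_def field_simps)
  then have sin: "sin \<theta> > 0" by (rule sin_gt_zero)
  define c where "c = cos \<theta>"
  have c2: "1 - c\<^sup>2 \<noteq> 0" using sin by (simp add: c_def cos_squared_eq)
  define \<alpha> where "\<alpha> = (\<Sum>u\<in>S - {s, t}. cs s u * f u)"
  define \<beta> where "\<beta> = (\<Sum>u\<in>S - {s, t}. cs t u * f u)"
  \<comment> \<open>The fixed point: at \<open>(x0, y0)\<close> both \<open>bf s\<close> and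
    \<open>bf t\<close> vanish, so coordinates taken relative to it transform linearly.\<close>
  define x0 where "x0 = (\<alpha> + c * \<beta>) / (1 - c\<^sup>2)"
  define y0 where "y0 = (\<beta> + c * \<alpha>) / (1 - c\<^sup>2)"
  have fix0: "x0 = c * y0 + \<alpha>" "y0 = c * x0 + \<beta>"
    using c2 by (simp_all add: x0_def y0_def field_simps power2_eq_square)
  define g where "g x y = f(s := x0 + x, t := y0 + y)" for x y
  have cst: "cs s t = c" "cs t s = c"
    using cs_comm st by (auto simp: cs_def c_def \<theta>_def m_def)
  have bs: "bf s (g x y) = x - c * y" for x y
  proof -
    have "(\<Sum>u\<in>S - {s}. cs s u * g x y u) = cs s t * g x y t + (\<Sum>u\<in>S - {s} - {t}. cs s u * g x y u)"
      using st False by (intro sum.remove) auto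
    also have "(\<Sum>u\<in>S - {s} - {t}. cs s u * g x y u) = \<alpha>"
      unfolding \<alpha>_def by (intro sum.cong) (auto simp: g_def)
    finally show ?thesis using fix0 False by (simp add: bf_def cst) (simp add: g_def algebra_simps)
  qed
  have bt: "bf t (g x y) = y - c * x" for x y
  proof -
    have "(\<Sum>u\<in>S - {t}. cs t u * g x y u) = cs t s * g x y s + (\<Sum>u\<in>S - {t} - {s}. cs t u * g x y u)"
      using st False by (intro sum.remove) auto
    also have "(\<Sum>u\<in>S - {t} - {s}. cs t u * g x y u) = \<beta>"
      unfolding \<beta>_def by (intro sum.cong) (auto simp: g_def)
    finally show ?thesis using fix0 False by (simp add: bf_def cst) (simp add: g_def algebra_simps)
  qed
  have ss: "sig s (g x y) = g (2 * c * y - x) y" for x y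
    using False by (simp add: sig_def bs) (auto simp: g_def fun_eq_iff)
  have tt: "sig t (g x y) = g x (2 * c * x - y)" for x y
    using False by (simp add: sig_def bt) (auto simp: g_def fun_eq_iff)
  define x y where "x = f s - x0" and "y = f t - y0"
  \<comment> \<open>Both reflections give a two-term recursion with multiplier
    \<open>2 cos \<theta>\<close>, which sines of successive multiples of \<open>\<theta>\<close>
    solve.\<close>
  define Xs where "Xs k = (x * sin ((2 * real k + 1) * \<theta>) - y * sin (2 * real k * \<theta>)) / sin \<theta>" for k
  define Ys where "Ys k = (x * sin (2 * real k * \<theta>) - y * sin ((2 * real k - 1) * \<theta>)) / sin \<theta>" for k
  have rec: "sin (a + \<theta>) = 2 * c * sin a - sin (a - \<theta>)" for a
    by (simp add: sin_add sin_diff c_def)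
  have Ys_Suc: "Ys (Suc k) = 2 * c * Xs k - Ys k" for k
  proof -
    have 1: "sin (2 * real (Suc k) * \<theta>) = 2 * c * sin ((2 * real k + 1) * \<theta>) - sin (2 * real k * \<theta>)"
      using rec[of "(2 * real k + 1) * \<theta>"] by (simp add: algebra_simps)
    have 2: "sin ((2 * real (Suc k) - 1) * \<theta>) =
        2 * c * sin (2 * real k * \<theta>) - sin ((2 * real k - 1) * \<theta>)"
      using rec[of "2 * real k * \<theta>"] by (simp add: algebra_simps)
    show ?thesis unfolding Xs_def Ys_def 1 2 using sin by (simp add: field_simps)
  qed
  have Xs_Suc: "Xs (Suc k) = 2 * c * Ys (Suc k) - Xs k" for k
  proof -
    have 1: "sin ((2 * real (Suc k) + 1) * \<theta>) =
        2 * c * sin (2 * real (Suc k) * \<theta>) - sin ((2 * real k + 1) * \<theta>)"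
      using rec[of "2 * real (Suc k) * \<theta>"] by (simp add: algebra_simps)
    have 2: "sin (2 * real (Suc k) * \<theta>) =
        2 * c * sin ((2 * real (Suc k) - 1) * \<theta>) - sin (2 * real k * \<theta>)"
      using rec[of "(2 * real k + 1) * \<theta>"] by (simp add: algebra_simps)
    have eq: "(x * (2 * c * s2 - s4) - y * (2 * c * s3 - s5)) / sin \<theta> =
        2 * c * ((x * s2 - y * s3) / sin \<theta>) - (x * s4 - y * s5) / sin \<theta>" for s2 s3 s4 s5
      using sin by (simp add: field_simps)
    have "Xs (Suc k) = (x * (2 * c * sin (2 * real (Suc k) * \<theta>) - sin ((2 * real k + 1) * \<theta>)) -
        y * (2 * c * sin ((2 * real (Suc k) - 1) * \<theta>) - sin (2 * real k * \<theta>))) / sin \<theta>"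
      unfolding Xs_def 1 using 2 by simp
    then show ?thesis unfolding eq by (simp only: Xs_def Ys_def)
  qed
  have iter: "foldr sig (concat (replicate k [s, t])) f = g (Xs k) (Ys k)" for k
  proof (induction k)
    case 0
    show ?case using sin by (simp add: Xs_def Ys_def g_def x_def y_def)
  next
    case (Suc k)
    then show ?case by (simp add: tt ss Ys_Suc[symmetric] Xs_Suc[symmetric])
  qed
  have m\<theta>: "2 * real m * \<theta> = 2 * pi" using m by (simp add: \<theta>_def)
  have "(2 * real m + 1) * \<theta> = \<theta> + 2 * pi" "(2 * real m - 1) * \<theta> = - \<theta> + 2 * pi"
    using m\<theta> by (simp_all add: algebra_simps)
  then have "sin ((2 * real m + 1) * \<theta>) = sin \<theta>" "sin ((2 * real m - 1) * \<theta>) = - sin \<theta>"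
    by (metis sin_periodic, metis sin_periodic sin_minus)
  moreover have "sin (2 * real m * \<theta>) = 0" unfolding m\<theta> by simp
  ultimately have "Xs m = x" "Ys m = y"
    using sin by (simp_all add: Xs_def Ys_def)
  then show ?thesis using iter[of m] by (simp add: g_def x_def y_def m_def)
qed

lemma congruent_sig:
  "coxeter_congruent W S xs ys \<Longrightarrow> foldr sig xs f = foldr sig ys f"
proof (induction arbitrary: f rule: coxeter_congruent.induct)
  case (relator s t)
  then show ?case using sig_relator by simp
qed auto

section \<open>The action of the group and an invariant inner product\<close>

definition act :: "'a \<Rightarrow> ('a \<Rightarrow> real) \<Rightarrow> ('a \<Rightarrow> real)"
  where "act w = foldr sig (SOME ss. set ss \<subseteq> S \<and> wp ss = w)"

lemma act_wp:
  assumes "set ss \<subseteq> S"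
  shows "act (wp ss) f = foldr sig ss f"
proof -
  let ?ss = "SOME xs. set xs \<subseteq> S \<and> wp xs = wp ss"
  have "set ?ss \<subseteq> S \<and> wp ?ss = wp ss"
    by (rule someI[of _ ss]) (use assms in simp)
  then have "coxeter_congruent W S ?ss ss"
    using assms presentation by blast
  then show ?thesis
    using congruent_sig unfolding act_def by blast
qed

lemma act_mult_S:
  assumes "w \<in> carrier W" "s \<in> S"
  shows "act w (sig s f) = act (w \<otimes> s) f"
proof -
  obtain ss where ss: "set ss \<subseteq> S" "wp ss = w" using ex_word[OF assms(1)] by metis
  have "act w (sig s f) = foldr sig (ss @ [s]) f" using act_wp[OF ss(1)] ss(2) by simp
  also have "\<dots> = act (wp (ss @ [s])) f" using act_wp[of "ss @ [s]"] ss assms by simp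
  also have "wp (ss @ [s]) = w \<otimes> s" using ss assms by (simp add: wp_append words_carrier)
  finally show ?thesis .
qed

lemma sig_linear: "sig s (\<lambda>x. f x + c * g x) = (\<lambda>x. sig s f x + c * sig s g x)"
  by (auto simp: sig_def bf_def fun_eq_iff algebra_simps sum.distrib sum_distrib_left)

lemma act_linear: "act w (\<lambda>x. f x + c * g x) = (\<lambda>x. act w f x + c * act w g x)"
proof -
  have "foldr sig ss (\<lambda>x. f x + c * g x) = (\<lambda>x. foldr sig ss f x + c * foldr sig ss g x)" for ss
    by (induction ss) (simp_all add: sig_linear)
  then show ?thesis unfolding act_def by blast
qed

text \<open>The coordinate inner product summed over the finite group, hence invariant.\<close>

definition Q :: "('a \<Rightarrow> real) \<Rightarrow> ('a \<Rightarrow> real) \<Rightarrow> real"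
  where "Q f g = (\<Sum>w\<in>carrier W. \<Sum>u\<in>S. act w f u * act w g u)"

lemma Q_comm: "Q f g = Q g f"
  by (simp add: Q_def mult.commute)

lemma Q_linear: "Q (\<lambda>x. f x + c * g x) h = Q f h + c * Q g h"
  by (simp add: Q_def act_linear algebra_simps sum.distrib sum_distrib_left)

lemma Q_sig:
  assumes "s \<in> S"
  shows "Q (sig s f) (sig s g) = Q f g"
proof -
  have "Q (sig s f) (sig s g) = (\<Sum>w\<in>carrier W. \<Sum>u\<in>S. act (w \<otimes> s) f u * act (w \<otimes> s) g u)"
    using assms by (simp add: Q_def act_mult_S)
  also have "\<dots> = Q f g"
    unfolding Q_def
    by (rule sum.reindex_bij_witness[of _ "\<lambda>w. w \<otimes> s" "\<lambda>w. w \<otimes> s"]) (use assms in auto)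
  finally show ?thesis .
qed

lemma Q_pos:
  assumes "u \<in> S" "f u \<noteq> 0"
  shows "Q f f > 0"
proof -
  have "act \<one> f = f" using act_wp[of "[]" f] by simp
  then have "0 < (\<Sum>u\<in>S. act \<one> f u * act \<one> f u)"
    using assms by (intro sum_pos2[of S u]) (auto simp: zero_less_mult_iff not_less_iff_gr_or_eq)
  then show ?thesis
    unfolding Q_def using fin by (intro sum_pos2[of "carrier W" \<one>]) (auto intro!: sum_nonneg)
qed

definition E :: "'a \<Rightarrow> 'a \<Rightarrow> real"
  where "E s x = (if x = s then 1 else 0)"

lemma E_self: "E s s = 1"
  by (simp add: E_def)

lemma bf_E: "s \<in> S \<Longrightarrow> t \<in> S \<Longrightarrow> bf s (E t) = (if s = t then 1 else - cs s t)"
  by (auto simp: bf_def E_def if_distrib cong: if_cong)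

lemma sig_E_form: "sig s f = (\<lambda>x. f x + (- 2 * bf s f) * E s x)"
  by (auto simp: sig_def E_def fun_eq_iff)

text \<open>\<open>sig s\<close> negates \<open>E s\<close> and moves \<open>f\<close> by
  \<open>- 2 * bf s f\<close> along \<open>E s\<close>; invariance of \<open>Q\<close> then forces
  the proportionality.\<close>

lemma Q_E:
  assumes "s \<in> S"
  shows "Q f (E s) = bf s f * Q (E s) (E s)"
proof -
  have "sig s (E s) = (\<lambda>x. E s x + (- 2) * E s x)"
    using assms by (simp add: sig_E_form bf_E)
  then have "Q (sig s (E s)) (sig s f) = Q (\<lambda>x. E s x + (- 2) * E s x) (sig s f)"
    by simp
  then have "Q (sig s (E s)) (sig s f) = - Q (E s) (sig s f)"
    unfolding Q_linear by simp
  then have "Q (E s) f = - Q (sig s f) (E s)"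
    using Q_sig[OF assms] by (simp add: Q_comm)
  also have "Q (sig s f) (E s) = Q f (E s) - 2 * bf s f * Q (E s) (E s)"
    using Q_linear[of f "- 2 * bf s f" "E s" "E s"] unfolding sig_E_form[symmetric] by simp
  finally show ?thesis by (simp add: Q_comm)
qed

text \<open>Evaluate \<open>Q (E s) (E t)\<close> from both sides by \<open>Q_E\<close>; the factor
  \<open>cs s t\<close> is non-zero on an edge. So on a component \<open>Q\<close> is a constant
  multiple of the Tits form.\<close>

lemma Q_E_adj:
  assumes "adj s t"
  shows "Q (E s) (E s) = Q (E t) (E t)"
proof -
  have st: "s \<in> S" "t \<in> S" "s \<noteq> t" using assms by (auto simp: adj_def)
  have "cs s t * Q (E s) (E s) = cs s t * Q (E t) (E t)"
    using Q_E[OF st(1), of "E t"] Q_E[OF st(2), of "E s"] st(3) bf_E[OF st(1,2)] bf_E[OF st(2,1)]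
      cs_comm[OF st(1,2)] Q_comm[of "E s" "E t"] by simp
  then show ?thesis using cs_adj[OF assms] by simp
qed

lemma Q_expand:
  assumes "P \<subseteq> S"
  shows "Q (\<lambda>x. if x \<in> P then f x else 0) g = (\<Sum>s\<in>P. f s * Q (E s) g)"
  using finite_subset[OF assms finite_S]
proof (induction P rule: finite_induct)
  case empty
  have "Q (\<lambda>x. 0) g = 0" using Q_linear[of "\<lambda>x. 0" 1 "\<lambda>x. 0" g] by simp
  then show ?case by simp
next
  case (insert s P)
  have "(\<lambda>x. if x \<in> insert s P then f x else 0) = (\<lambda>x. (if x \<in> P then f x else 0) + f s * E s x)"
    using insert by (auto simp: E_def fun_eq_iff)
  then show ?case using insert by (simp add: Q_linear)
qed

text \<open>An invariant inner product makes the Tits form positive definite on each component.\<close>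

lemma bf_positive:
  assumes P: "P \<subseteq> S" "s0 \<in> P" "\<And>s. s \<in> P \<Longrightarrow> Q (E s) (E s) = Q (E s0) (E s0)"
    and f: "\<And>s. s \<in> P \<Longrightarrow> f s > 0" "\<And>x. x \<notin> P \<Longrightarrow> f x = 0"
  shows "\<exists>s\<in>P. bf s f > 0"
proof (rule ccontr)
  assume "\<not> (\<exists>s\<in>P. bf s f > 0)"
  then have neg: "bf s f \<le> 0" if "s \<in> P" for s using that by force
  have "f = (\<lambda>x. if x \<in> P then f x else 0)" using f(2) by auto
  then have "Q f f = (\<Sum>s\<in>P. f s * Q (E s) f)" using Q_expand[OF P(1), of f f] by simp
  also have "\<dots> = (\<Sum>s\<in>P. f s * bf s f * Q (E s0) (E s0))"
  proof (rule sum.cong[OF HOL.refl])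
    fix s assume "s \<in> P"
    then show "f s * Q (E s) f = f s * bf s f * Q (E s0) (E s0)"
      using Q_E[of s f] P(1) P(3)[of s] Q_comm[of "E s" f] by auto
  qed
  also have "\<dots> \<le> 0"
  proof (rule sum_nonpos)
    fix s assume s: "s \<in> P"
    have "Q (E s0) (E s0) > 0" using Q_pos[of s0 "E s0"] P(1,2) by (auto simp: E_self)
    moreover have "f s * bf s f \<le> 0" using f(1)[OF s] neg[OF s] by (simp add: mult_nonneg_nonpos)
    ultimately show "f s * bf s f * Q (E s0) (E s0) \<le> 0" by (simp add: mult_nonpos_nonneg)
  qed
  finally show False using Q_pos[of s0 f] f(1)[of s0] P(1,2) by auto
qed

subsection \<open>At most two classes in each component\<close>

lemma bf_le:
  assumes "s \<in> S" "A \<subseteq> S - {s}" "\<And>t. 0 \<le> f t"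
  shows "bf s f \<le> f s - (\<Sum>t\<in>A. cs s t * f t)"
proof -
  have "(\<Sum>t\<in>A. cs s t * f t) \<le> (\<Sum>t\<in>S - {s}. cs s t * f t)"
    using assms cs_nonneg by (intro sum_mono2) auto
  then show ?thesis by (simp add: bf_def)
qed

text \<open>On a shortest walk through three classes the inner vertices form a single class, so both end
  edges have even labels \<open>\<ge> 4\<close>. The weights \<open>1, \<surd>2, \<dots>, \<surd>2, 1\<close> of the affine diagram of type
  \<open>C\<close> then contradict positivity.\<close>

lemma no_three_classes:
  assumes "set xs \<subseteq> S" "successively adj xs"
  shows "card (cls ` set xs) \<le> 2"
  using assms
proof (induction "length xs" arbitrary: xs rule: less_induct)
  case less
  show ?case
  proof (rule ccontr)
    assume "\<not> card (cls ` set xs) \<le> 2"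
    then have card3: "card (cls ` set xs) \<ge> 3" by simp
    have card_le: "card (cls ` set xs) \<le> length xs"
      by (meson card_image_le card_length finite_set le_trans)
    then have len3: "3 \<le> length xs" using card3 by simp
    then obtain a ys where a: "xs = a # ys" by (cases xs) auto
    with len3 have ys: "xs = a # ys" "ys \<noteq> []" by auto
    then obtain mid z where mz: "ys = mid @ [z]" by (metis rev_exhaust)
    have xs: "xs = a # mid @ [z]" using ys mz by simp
    have S: "a \<in> S" "z \<in> S" "set mid \<subseteq> S" using less.prems xs by auto
    have "successively adj ((a # mid) @ [z])" "successively adj (a # (mid @ [z]))"
      using less.prems(2) xs by simp_all
    then have succ: "successively adj (a # mid)" "successively adj (mid @ [z])"
      unfolding successively_append_iff[of adj "a # mid"] successively_Cons[of adj a "mid @ [z]"]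
      by auto
    \<comment> \<open>Dropping either end leaves a shorter walk with at most two classes. Hence the
      class of each end occurs nowhere else on the walk, and the inner vertices share one
      class.\<close>
    have "card (cls ` set (a # mid)) \<le> 2" "card (cls ` set (mid @ [z])) \<le> 2"
      using less.hyps[of "a # mid"] less.hyps[of "mid @ [z]"] succ S xs by auto
    moreover have "cls ` set xs = insert (cls a) (cls ` set (mid @ [z]))"
      "cls ` set xs = insert (cls z) (cls ` set (a # mid))" using xs by auto
    ultimately have new: "cls a \<notin> cls ` set (mid @ [z])" "cls z \<notin> cls ` set (a # mid)"
      and c2: "card (cls ` set (mid @ [z])) = 2"
      using card3 by (auto simp: card_insert_if split: if_splits)
    have "card (cls ` set mid) = 1"
      using c2 new(2) by (simp add: card_insert_if)
    then obtain k where k: "cls ` set mid = {k}" by (auto simp: card_1_singleton_iff)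
    have midk: "cls x = k" if "x \<in> set mid" for x using that k by blast
    have "mid \<noteq> []" using k by auto
    have nc: "\<not> conjugate x a" "\<not> conjugate x z" "\<not> conjugate a x" "\<not> conjugate z x" if "x \<in> set mid" for x
    proof -
      have "x \<in> S" using that S by blast
      moreover have "cls a \<noteq> cls x" "cls z \<noteq> cls x" using new that by auto
      ultimately show "\<not> conjugate x a" "\<not> conjugate x z" "\<not> conjugate a x" "\<not> conjugate z x"
        using cls_eq_iff S by metis+
    qed
    have az: "a \<noteq> z" "a \<notin> set mid" "z \<notin> set mid" using new by auto
    define n where "n = length xs"
    have n: "n = length mid + 2" by (simp add: n_def xs)
    have x0: "xs ! 0 = a" by (simp add: xs)
    have xn: "xs ! (n - 1) = z" by (simp add: xs n nth_append)
    have xi: "xs ! i \<in> set mid" if "0 < i" "i < n - 1" for i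
      using that by (auto simp: xs n nth_Cons' nth_append)
    have adj: "adj (xs ! i) (xs ! Suc i)" if "Suc i < n" for i
      using less.prems(2) that by (simp add: successively_conv_nth n_def)
    \<comment> \<open>No backtracking: a detour to a neighbour and back could be cut out without
      losing a class. So the two neighbours of an inner vertex are distinct and both count in
      \<open>bf\<close>.\<close>
    have nback: "xs ! (i - 1) \<noteq> xs ! Suc i" if i: "0 < i" "i < n - 1" for i
    proof
      assume eq: "xs ! (i - 1) = xs ! Suc i"
      let ?p = "xs ! (i - 1)"
      have p: "?p \<in> set mid"
      proof -
        have "i - 1 \<noteq> 0"
        proof
          assume "i - 1 = 0"
          then have "xs ! Suc i = a" using eq x0 by simp
          then show False using az xi[of "Suc i"] xn i by (cases "Suc i = n - 1") auto
        qed
        then show ?thesis using xi[of "i - 1"] i by auto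
      qed
      define zs where "zs = take i xs @ drop (i + 2) xs"
      have dropi: "drop (i - 1) xs = ?p # xs ! i # ?p # drop (i + 2) xs"
      proof -
        have "i - 1 < length xs" "Suc (i - 1) < length xs" "Suc (Suc (i - 1)) < length xs"
          using i by (auto simp: n_def)
        then have "drop (i - 1) xs = xs ! (i - 1) # xs ! Suc (i - 1) # xs ! Suc (Suc (i - 1)) #
            drop (Suc (Suc (Suc (i - 1)))) xs"
          by (metis Cons_nth_drop_Suc)
        then show ?thesis using i eq by simp
      qed
      have takei: "take i xs = take (i - 1) xs @ [?p]"
        using take_Suc_conv_app_nth[of "i - 1" xs] i by (auto simp: n_def)
      have xs': "xs = take (i - 1) xs @ ?p # xs ! i # ?p # drop (i + 2) xs"
        by (simp only: dropi[symmetric] append_take_drop_id)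
      have zs': "zs = take (i - 1) xs @ ?p # drop (i + 2) xs" by (simp add: zs_def takei)
      have "successively adj zs"
        unfolding zs' using less.prems(2)
        by (subst (asm) xs') (auto simp: successively_append_iff successively_Cons)
      moreover have sets: "set xs = insert (xs ! i) (set zs)"
        unfolding zs' by (subst xs') auto
      moreover have "length zs < length xs" unfolding zs' by (subst (2) xs') simp
      ultimately have "card (cls ` set zs) \<le> 2" using less.hyps[of zs] less.prems by auto
      moreover have "cls (xs ! i) = cls ?p" using midk p xi[OF i] by simp
      then have "cls ` set xs = cls ` set zs" using sets zs' by auto
      ultimately show False using card3 by simp
    qed
    define f where "f x = (if x = a \<or> x = z then 1 else if x \<in> set mid then sqrt 2 else 0)" for x
    have fmid: "f x = sqrt 2" if "x \<in> set mid" for x using that az by (auto simp: f_def)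
    have f0: "0 \<le> f x" for x by (simp add: f_def)
    have s22: "sqrt 2 / 2 * sqrt 2 = (1::real)" by simp
    \<comment> \<open>An inner neighbour has weight \<open>sqrt 2\<close> and edge coefficient at
      least 1/2; an end has weight 1, but the label of its edge is at least 4. Two such
      contributions outweigh \<open>f x = sqrt 2\<close>.\<close>
    have half: "sqrt 2 / 2 \<le> cs x y * f y" if "adj x y" "x \<in> set mid" "y \<in> set xs" for x y
    proof (cases "y \<in> set mid")
      case True
      then show ?thesis
        using cs_adj[OF that(1)] mult_right_mono[of "1/2" "cs x y" "sqrt 2"] fmid by simp
    next
      case False
      then have "f y = 1" "\<not> conjugate x y" using that nc xs by (auto simp: f_def)
      then show ?thesis using cs_adj_not_conj[OF that(1)] by simp
    qed
    \<comment> \<open>At an end of weight 1 the single edge into the walk already contributes at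
      least \<open>sqrt 2 / 2 * sqrt 2 = 1\<close>.\<close>
    have end0: "bf x f \<le> 0" if x: "x = a \<or> x = z" "y \<in> set mid" "adj x y" for x y
    proof -
      have "bf x f \<le> f x - (\<Sum>t\<in>{y}. cs x t * f t)"
        using x S az f0 by (intro bf_le) auto
      moreover have "sqrt 2 / 2 * sqrt 2 \<le> cs x y * sqrt 2"
        using cs_adj_not_conj[OF x(3)] nc[OF x(2)] x by (intro mult_right_mono) auto
      ultimately show ?thesis using x fmid s22 by (auto simp: f_def)
    qed
    have "bf x f \<le> 0" if x_xs: "x \<in> set xs" for x
    proof -
      consider "x = a" | "x = z" | "x \<in> set mid" using x_xs xs by auto
      then show ?thesis
      proof cases
        case 1
        then show ?thesis using end0[of a "xs ! 1"] adj[of 0] x0 xi[of 1] n \<open>mid \<noteq> []\<close>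
          by (cases mid) auto
      next
        case 2
        have "adj z (xs ! (n - 2))"
          using adj[of "n - 2"] xn n adj_sym by (simp add: numeral_2_eq_2)
        then show ?thesis using end0[of z "xs ! (n - 2)"] xi[of "n - 2"] n \<open>mid \<noteq> []\<close> 2
          by (cases mid) auto
      next
        case 3
        then obtain i where i: "0 < i" "i < n - 1" "x = xs ! i"
        proof -
          obtain j where "j < length mid" "x = mid ! j" using 3 by (auto simp: in_set_conv_nth)
          then show thesis using that[of "Suc j"] by (auto simp: xs n nth_append)
        qed
        let ?u = "xs ! (i - 1)" and ?v = "xs ! Suc i"
        have uv: "adj x ?u" "adj x ?v"
          using adj[of "i - 1"] adj[of i] i adj_sym by auto
        have in_xs: "?u \<in> set xs" "?v \<in> set xs" using i by (auto simp: n_def)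
        have "bf x f \<le> f x - (\<Sum>t\<in>{?u, ?v}. cs x t * f t)"
          using uv f0 by (intro bf_le) (auto simp: adj_def)
        also have "(\<Sum>t\<in>{?u, ?v}. cs x t * f t) = cs x ?u * f ?u + cs x ?v * f ?v"
          using nback[OF i(1,2)] by simp
        also have "f x - \<dots> \<le> 0"
          using half[OF uv(1) 3 in_xs(1)] half[OF uv(2) 3 in_xs(2)] fmid[OF 3] by simp
        finally show ?thesis .
      qed
    qed
    moreover have "\<exists>s\<in>set xs. bf s f > 0"
    proof (rule bf_positive[of _ a])
      have "Q (E (xs ! i)) (E (xs ! i)) = Q (E a) (E a)" if "i < n" for i
        using that
      proof (induction i)
        case (Suc i)
        then show ?case using Q_E_adj[OF adj[of i]] by simp
      qed (simp add: x0)
      then show "Q (E s) (E s) = Q (E a) (E a)" if "s \<in> set xs" for s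
        using that by (auto simp: in_set_conv_nth n_def)
    qed (use less.prems xs in \<open>auto simp: f_def\<close>)
    ultimately show False by force
  qed
qed

section \<open>Components of the Coxeter graph\<close>

definition comp :: "'a \<Rightarrow> 'a set"
  where "comp s = {t. adj\<^sup>*\<^sup>* s t}"

lemma comp_self [simp]: "s \<in> comp s"
  by (simp add: comp_def)

lemma comp_S: "s \<in> S \<Longrightarrow> comp s \<subseteq> S"
proof
  fix t assume "s \<in> S" "t \<in> comp s"
  then have "adj\<^sup>*\<^sup>* s t" by (simp add: comp_def)
  then show "t \<in> S" by (cases rule: rtranclp.cases) (use \<open>s \<in> S\<close> in \<open>auto simp: adj_def\<close>)
qed

lemma rtranclp_adj_sym: "adj\<^sup>*\<^sup>* s t \<Longrightarrow> adj\<^sup>*\<^sup>* t s"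
  by (induction rule: rtranclp_induct) (auto intro: converse_rtranclp_into_rtranclp adj_sym)

lemma comp_eq: "t \<in> comp s \<Longrightarrow> comp t = comp s"
  using rtranclp_adj_sym rtranclp_trans unfolding comp_def by fast

lemma comp_closed: "t \<in> comp s \<Longrightarrow> adj t u \<Longrightarrow> u \<in> comp s"
  unfolding comp_def by (auto intro: rtranclp.rtrancl_into_rtrancl)

lemma ex_walk:
  assumes "adj\<^sup>*\<^sup>* s t" "s \<in> S"
  shows "\<exists>xs. set (s # xs) \<subseteq> S \<and> successively adj (s # xs) \<and> last (s # xs) = t"
  using assms(1)
proof (induction rule: rtranclp_induct)
  case base
  show ?case using assms(2) by (intro exI[of _ "[]"]) simp
next
  case (step t u)
  then obtain xs where xs: "set (s # xs) \<subseteq> S" "successively adj (s # xs)" "last (s # xs) = t"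
    by blast
  have "successively adj ((s # xs) @ [u])"
    using xs step(2) by (subst successively_append_iff) auto
  then show ?case
    using xs step(2) by (intro exI[of _ "xs @ [u]"]) (auto simp: adj_def)
qed

text \<open>Three classes would all be met by the concatenation of a walk from \<open>s\<close> to
  \<open>s'\<close> and one from \<open>s'\<close> to \<open>t\<close>. For a single class
  \<open>s' = s\<close> will do.\<close>

lemma two_classes:
  assumes "s \<in> S"
  shows "\<exists>s'\<in>comp s. \<forall>t\<in>comp s. conjugate t s \<or> conjugate t s'"
proof (cases "\<forall>t\<in>comp s. conjugate t s")
  case True
  then show ?thesis using comp_self by blast
next
  case False
  then obtain s' where s': "s' \<in> comp s" "\<not> conjugate s' s" by blast
  have "conjugate t s \<or> conjugate t s'" if t: "t \<in> comp s" for t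
  proof (rule ccontr)
    assume nc: "\<not> (conjugate t s \<or> conjugate t s')"
    have S: "s' \<in> S" "t \<in> S" using comp_S assms s' t by auto
    have "adj\<^sup>*\<^sup>* s s'" "adj\<^sup>*\<^sup>* s' t"
      using s'(1) t comp_eq[OF s'(1)] by (auto simp: comp_def)
    then obtain xs ys where
      xs: "set (s # xs) \<subseteq> S" "successively adj (s # xs)" "last (s # xs) = s'" and
      ys: "set (s' # ys) \<subseteq> S" "successively adj (s' # ys)" "last (s' # ys) = t"
      using ex_walk assms S by meson
    let ?w = "(s # xs) @ ys"
    have w: "set ?w \<subseteq> S" "successively adj ?w"
      using xs ys unfolding successively_append_iff[of adj "s # xs" ys] successively_Cons[of adj s' ys]
      by auto
    have "s' \<in> set ?w" using last_in_set[of "s # xs"] xs(3) by auto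
    moreover have "t \<in> set ?w"
      using last_in_set[of "s' # ys"] ys(3) \<open>s' \<in> set ?w\<close> by auto
    ultimately have "cls ` {s, s', t} \<subseteq> cls ` set ?w" by auto
    then have "card (cls ` {s, s', t}) \<le> card (cls ` set ?w)" by (intro card_mono) auto
    moreover have "cls t \<noteq> cls s" "cls t \<noteq> cls s'" "cls s' \<noteq> cls s"
      using cls_eq_iff[of t s] cls_eq_iff[of t s'] cls_eq_iff[of s' s] nc s' S assms by auto
    then have "card (cls ` {s, s', t}) = 3" by auto
    ultimately show False using no_three_classes[OF w] by simp
  qed
  then show ?thesis using s' by blast
qed

end

section \<open>Simultaneous sign approximation\<close>

text \<open>A finite set of fractions has a maximum, here written with cross products. Numerator 0
  is allowed, so that \<open>0 / 1\<close> is always a candidate.\<close>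

lemma best_lower_fraction:
  fixes p q B :: int
  assumes "p > 0" "q > 0" "B \<ge> 1"
  shows "\<exists>c d. 0 \<le> c \<and> c \<le> B \<and> 1 \<le> d \<and> d \<le> B \<and> c * q \<le> p * d \<and>
    (\<forall>c' d'. 0 \<le> c' \<longrightarrow> c' \<le> B \<longrightarrow> 1 \<le> d' \<longrightarrow> d' \<le> B \<longrightarrow> c' * q \<le> p * d' \<longrightarrow> c' * d \<le> c * d')"
proof -
  let ?A = "{(c, d) \<in> {0..B} \<times> {1..B}. c * q \<le> p * d}"
  let ?r = "\<lambda>(c, d). (of_int c / of_int d :: rat)"
  have A: "finite ?A" "(0, 1) \<in> ?A"
    using assms by (auto intro: finite_subset[of _ "{0..B} \<times> {1..B}"])
  then have "?r ` ?A \<noteq> {}" by blast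
  then have "Max (?r ` ?A) \<in> ?r ` ?A" using A(1) by (intro Max_in) simp_all
  then obtain c d where cd: "(c, d) \<in> ?A" "?r (c, d) = Max (?r ` ?A)" by auto
  have "c' * d \<le> c * d'" if "(c', d') \<in> ?A" for c' d'
  proof -
    have "?r (c', d') \<le> ?r (c, d)" unfolding cd(2) using A that by (intro Max_ge) auto
    then have "(of_int c' / of_int d' :: rat) \<le> of_int c / of_int d" by simp
    moreover have "d > 0" "d' > 0" using cd that by auto
    ultimately have "(of_int (c' * d) :: rat) \<le> of_int (c * d')" by (simp add: field_simps)
    then show ?thesis by (simp only: of_int_le_iff)
  qed
  then show ?thesis using cd by (intro exI[of _ c] exI[of _ d]) auto
qed

text \<open>The mediant of the two best approximations of \<open>p / q\<close> with denominators up to \<open>B\<close>.\<close>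

lemma sgn_approx:
  fixes p q B :: int
  assumes "p > 0" "q > 0" "B \<ge> 1"
  shows "\<exists>p' q'. 1 \<le> p' \<and> p' \<le> 2 * B \<and> 1 \<le> q' \<and> q' \<le> 2 * B \<and>
    (\<forall>a b. \<bar>a\<bar> \<le> B \<longrightarrow> \<bar>b\<bar> \<le> B \<longrightarrow> sgn (a * p + b * q) = sgn (a * p' + b * q'))"
proof -
  obtain c d where cd: "0 \<le> c" "c \<le> B" "1 \<le> d" "d \<le> B" "c * q \<le> p * d"
    and cd_max: "\<And>c' d'. 0 \<le> c' \<Longrightarrow> c' \<le> B \<Longrightarrow> 1 \<le> d' \<Longrightarrow> d' \<le> B \<Longrightarrow> c' * q \<le> p * d' \<Longrightarrow>
      c' * d \<le> c * d'"
    using best_lower_fraction[OF assms] by blast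
  \<comment> \<open>The upper neighbour of \<open>p / q\<close> is \<open>e / f\<close>, found as
    the lower neighbour \<open>f / e\<close> of \<open>q / p\<close>. The value \<open>f = 0\<close>
    stands for infinity, when no fraction with entries in range lies above.\<close>
  obtain f e where fe: "0 \<le> f" "f \<le> B" "1 \<le> e" "e \<le> B" "f * p \<le> q * e"
    and fe_max: "\<And>f' e'. 0 \<le> f' \<Longrightarrow> f' \<le> B \<Longrightarrow> 1 \<le> e' \<Longrightarrow> e' \<le> B \<Longrightarrow> f' * p \<le> q * e' \<Longrightarrow>
      f' * e \<le> f * e'"
    using best_lower_fraction[OF assms(2,1,3)] by blast
  let ?p = "c + e" and ?q = "d + f"
  have opp: "sgn (a * p - b * q) = sgn (a * ?p - b * ?q)"
    if ab: "1 \<le> a" "a \<le> B" "1 \<le> b" "b \<le> B" for a b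
  proof -
    \<comment> \<open>The brackets compare \<open>b / a\<close> with \<open>c / d\<close> and with
      \<open>e / f\<close>. Since \<open>b / a\<close> does not lie strictly between either of these
      and \<open>p / q\<close>, the brackets never have opposite signs, and both vanish exactly if
      \<open>b / a = p / q\<close>.\<close>
    have expand: "a * ?p - b * ?q = (c * a - b * d) + (a * e - f * b)" by (simp add: algebra_simps)
    consider "b * q < a * p" | "b * q = a * p" | "b * q > a * p" by linarith
    then show ?thesis
    proof cases
      case 1
      have "b * d \<le> c * a" using cd_max[of b a] ab 1 by (simp add: mult.commute)
      moreover have "(b * f) * p < (a * e) * p"
      proof -
        have "b * (f * p) \<le> b * (q * e)" using fe(5) ab by (intro mult_left_mono) auto
        also have "\<dots> = (b * q) * e" by simp
        also have "\<dots> < (a * p) * e" using 1 fe by (intro mult_strict_right_mono) auto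
        finally show ?thesis by (simp add: ac_simps)
      qed
      then have "f * b < a * e" using assms by (simp add: mult.commute)
      ultimately show ?thesis using 1 expand by simp
    next
      case 2
      have "b * d \<le> c * a" using cd_max[of b a] ab 2 by (simp add: mult.commute)
      moreover have "a * e \<le> f * b" using fe_max[of a b] ab 2 by (simp add: mult.commute)
      moreover have "(c * a) * q \<le> (b * d) * q"
      proof -
        have "a * (c * q) \<le> a * (p * d)" using cd(5) ab by (intro mult_left_mono) auto
        also have "\<dots> = (b * q) * d" using 2 by simp
        finally show ?thesis by (simp add: ac_simps)
      qed
      then have "c * a \<le> b * d" using assms by simp
      moreover have "(f * b) * p \<le> (a * e) * p"
      proof -
        have "b * (f * p) \<le> b * (q * e)" using fe(5) ab by (intro mult_left_mono) auto
        also have "\<dots> = (a * p) * e" using 2 by simp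
        finally show ?thesis by (simp add: ac_simps)
      qed
      then have "f * b \<le> a * e" using assms by simp
      ultimately show ?thesis using 2 expand by simp
    next
      case 3
      have "a * e \<le> f * b" using fe_max[of a b] ab 3 by (simp add: mult.commute)
      moreover have "(c * a) * q < (b * d) * q"
      proof -
        have "a * (c * q) \<le> a * (p * d)" using cd(5) ab by (intro mult_left_mono) auto
        also have "\<dots> = (a * p) * d" by simp
        also have "\<dots> < (b * q) * d" using 3 cd by (intro mult_strict_right_mono) auto
        finally show ?thesis by (simp add: ac_simps)
      qed
      then have "c * a < b * d" using assms by simp
      ultimately show ?thesis using 3 expand by simp
    qed
  qed
  have pos: "1 \<le> ?p" "?p \<le> 2 * B" "1 \<le> ?q" "?q \<le> 2 * B" using cd fe by auto
  have "sgn (a * p + b * q) = sgn (a * ?p + b * ?q)" if "\<bar>a\<bar> \<le> B" "\<bar>b\<bar> \<le> B" for a b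
  proof -
    have same: "sgn (x * P + y * R) = (if x = 0 \<and> y = 0 then 0 else 1)"
      if "0 \<le> x" "0 \<le> y" "P > 0" "R > 0" for x y P R :: int
    proof (cases "x = 0 \<and> y = 0")
      case False
      then have "0 < x * P + y * R"
        using that by (metis add_nonneg_pos add_pos_nonneg mult_nonneg_nonneg mult_pos_pos
            order.strict_iff_order)
      then show ?thesis using False by simp
    qed simp
    consider "0 \<le> a" "0 \<le> b" | "a \<le> 0" "b \<le> 0" | "0 < a" "b < 0" | "a < 0" "0 < b" by linarith
    then show ?thesis
    proof cases
      case 1
      then show ?thesis using same[of a b p q] same[of a b ?p ?q] assms pos by simp
    next
      case 2
      have neg: "sgn (a * P + b * R) = - sgn ((- a) * P + (- b) * R)" for P R :: int
        by (auto simp: sgn_if)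
      have "0 \<le> - a" "0 \<le> - b" "0 < ?p" "0 < ?q" using 2 pos by auto
      then show ?thesis
        by (simp only: neg[of p q] neg[of ?p ?q] same assms)
    next
      case 3
      then show ?thesis using opp[of a "- b"] that by simp
    next
      case 4
      have neg: "sgn (a * P + b * R) = - sgn ((- a) * P - b * R)" for P R :: int
        by (auto simp: sgn_if)
      have "1 \<le> - a" "- a \<le> B" "1 \<le> b" "b \<le> B" using 4 that by auto
      then show ?thesis
        by (simp only: neg[of p q] neg[of ?p ?q] opp)
    qed
  qed
  then show ?thesis using pos by blast
qed

section \<open>Weight functions\<close>

lemma (in commuting_parts) par_decompose:
  assumes "w \<in> par (J \<union> K)"
  shows "\<exists>x\<in>par J. \<exists>y\<in>par K. w = x \<otimes> y"
proof -
  have "J \<union> K \<subseteq> S" using JS KS by blast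
  then show ?thesis
    using assms
  proof (induction rule: par_induct)
    case one
    show ?case by (intro bexI[of _ \<one>]) auto
  next
    case (step s w)
    then obtain x y where xy: "x \<in> par J" "y \<in> par K" "w = x \<otimes> y" by blast
    have c: "x \<in> carrier W" "y \<in> carrier W" "s \<in> carrier W" using xy step JS KS by auto
    show ?case
    proof (cases "s \<in> J")
      case True
      then have "s \<otimes> x \<in> par J" using par_mult[OF JS] par_gen[OF JS] xy by blast
      then show ?thesis using xy c by (intro bexI[of _ "s \<otimes> x"] bexI[of _ y]) (auto simp: m_assoc)
    next
      case False
      then have s: "s \<in> par K" using step par_gen[OF KS] by blast
      then have "s \<otimes> y \<in> par K" using par_mult[OF KS] xy by blast
      moreover have "s \<otimes> (x \<otimes> y) = x \<otimes> (s \<otimes> y)"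
        using c par_comm[OF xy(1) s] by (simp flip: m_assoc)
      ultimately show ?thesis using xy by blast
    qed
  qed
qed

context finite_coxeter
begin

lemma comp_parts:
  assumes "s \<in> S" "K \<subseteq> S - comp s"
  shows "commuting_parts W S (comp s) K"
proof
  show "comp s \<subseteq> S" using comp_S assms by blast
  show "s' \<otimes> t = t \<otimes> s'" if "s' \<in> comp s" "t \<in> K" for s' t
    using that comp_closed[of s' s t] comp_S[OF assms(1)] assms(2) unfolding adj_def by blast
qed (use assms in auto)

text \<open>Split the conjugating element as \<open>y z\<close> along the component of
  \<open>s\<close>. Were \<open>t\<close> outside it, \<open>y^-1 s y = z t z^-1\<close> would lie
  in both commuting factors and be trivial.\<close>

lemma conj_comp:
  assumes "s \<in> S" "t \<in> S" "conjugate s t"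
  shows "comp s = comp t"
proof (rule ccontr)
  assume ne: "comp s \<noteq> comp t"
  then have t: "t \<in> S - comp s" using comp_eq assms by blast
  interpret P: commuting_parts W S "comp s" "S - comp s"
    using comp_parts assms by blast
  obtain x where x: "x \<in> carrier W" "s \<otimes> x = x \<otimes> t" using assms by (auto simp: conjugate_def)
  have "comp s \<union> (S - comp s) = S" using comp_S assms by blast
  then obtain y z where yz: "y \<in> par (comp s)" "z \<in> par (S - comp s)" "x = y \<otimes> z"
    using P.par_decompose[of x] x par_S by auto
  have c: "y \<in> carrier W" "z \<in> carrier W" "s \<in> carrier W" "t \<in> carrier W"
    using yz assms by auto
  have "inv y \<otimes> (s \<otimes> (y \<otimes> z)) \<otimes> inv z = inv y \<otimes> (y \<otimes> z \<otimes> t) \<otimes> inv z"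
    using x(2) yz(3) by simp
  then have eq: "inv y \<otimes> s \<otimes> y = z \<otimes> t \<otimes> inv z" using c by (simp add: m_assoc)
  have "inv y \<otimes> s \<otimes> y \<in> par (comp s)"
    using yz(1) par_gen[OF P.JS comp_self] par_mult[OF P.JS] par_inv[OF P.JS] by simp
  moreover have "z \<otimes> t \<otimes> inv z \<in> par (S - comp s)"
    using yz(2) par_gen[OF P.KS t] par_mult[OF P.KS] par_inv[OF P.KS] by simp
  ultimately have "inv y \<otimes> s \<otimes> y = \<one>" using P.par_inter eq by simp
  then have "y \<otimes> (inv y \<otimes> s \<otimes> y) \<otimes> inv y = y \<otimes> \<one> \<otimes> inv y" by simp
  then have "s = \<one>" using c by (simp add: m_assoc)
  then show False using S_neq_one assms by blast
qed

text \<open>If \<open>s x = x t\<close> is longer than \<open>x\<close>, additivity on both sides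
  gives \<open>L s + L x = L x + L t\<close>. Otherwise replace \<open>x\<close> by
  \<open>s x\<close>.\<close>

lemma weight_conj:
  assumes L: "pos_weight_function W S L" and st: "s \<in> S" "t \<in> S" "conjugate s t"
  shows "L s = L t"
proof -
  have add: "L (x \<otimes> y) = L x + L y"
    if "x \<in> carrier W" "y \<in> carrier W" "\<ell> (x \<otimes> y) = \<ell> x + \<ell> y" for x y
    using L that unfolding pos_weight_function_def by blast
  have up: "L s = L t" if x: "x \<in> carrier W" "s \<otimes> x = x \<otimes> t" "\<not> inversion x s" for x
  proof -
    have "\<ell> (s \<otimes> x) = \<ell> s + \<ell> x" using len_S_mult(1)[OF x(1) st(1)] x(3) st by simp
    then have "L (s \<otimes> x) = L s + L x" using add[of s x] x st by simp
    moreover have "L (x \<otimes> t) = L x + L t"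
      using add[of x t] x st \<open>\<ell> (s \<otimes> x) = \<ell> s + \<ell> x\<close> by simp
    ultimately show ?thesis using x(2) by simp
  qed
  obtain x where x: "x \<in> carrier W" "s \<otimes> x = x \<otimes> t" using st by (auto simp: conjugate_def)
  show ?thesis
  proof (cases "inversion x s")
    case False
    then show ?thesis using up x by blast
  next
    case True
    have "s \<otimes> x \<otimes> t = x" unfolding x(2) using x(1) st by simp
    then have "s \<otimes> (s \<otimes> x) = s \<otimes> x \<otimes> t" using x(1) st by simp
    then show ?thesis
      using up[of "s \<otimes> x"] x(1) st True inversion_Refl_mult[of x s] by simp
  qed
qed

text \<open>The weight of \<open>w\<close> is the sum of the class function over the inversions of \<open>w\<close>.\<close>

lemma ex_weight:
  fixes g :: "'a \<Rightarrow> int"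
  assumes g: "\<And>s t. s \<in> S \<Longrightarrow> t \<in> S \<Longrightarrow> conjugate s t \<Longrightarrow> g s = g t" and pos: "\<And>s. s \<in> S \<Longrightarrow> g s > 0"
  shows "\<exists>L. pos_weight_function W S L \<and> (\<forall>s\<in>S. L s = g s)"
proof -
  \<comment> \<open>\<open>g\<close> extended to all reflections through a conjugate generator; the
    fact \<open>gR\<close> below shows independence of the choice.\<close>
  define gR where "gR t = g (SOME s. s \<in> S \<and> conjugate t s)" for t
  have gR: "gR t = g s" if "t \<in> carrier W" "s \<in> S" "conjugate t s" for s t
  proof -
    let ?s = "SOME s. s \<in> S \<and> conjugate t s"
    have "?s \<in> S \<and> conjugate t ?s" by (rule someI[of _ s]) (use that in simp)
    then show ?thesis
      using g[of ?s s] that conj_trans[of ?s t s] conj_sym[of t ?s] by (simp add: gR_def)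
  qed
  define N where "N w = {t \<in> Refl. inversion w t}" for w
  have finN: "finite (N w)" for w
    by (rule finite_subset[OF _ fin]) (auto simp: N_def)
  define L where "L w = (\<Sum>t\<in>N w. gR t)" for w
  have step: "L (s \<otimes> w) = g s + L w" if s: "s \<in> S" "w \<in> carrier W" "\<not> inversion w s" for s w
  proof -
    let ?c = "\<lambda>t. s \<otimes> t \<otimes> s"
    have c: "?c t \<in> Refl" "?c (?c t) = t" if "t \<in> Refl" for t
      using Refl_conj[OF that, of s] that s by (simp_all add: m_assoc)
    have inv: "inversion (s \<otimes> w) t \<longleftrightarrow> (t = s) \<noteq> inversion w (?c t)" if "t \<in> Refl" for t
      using inversion_mult[of s w t] s that by simp
    have ssS: "?c s = s" using s by (simp add: m_assoc)
    have "N (s \<otimes> w) = insert s (?c ` N w)"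
    proof (rule Set.equalityI; rule Set.subsetI)
      fix t assume "t \<in> N (s \<otimes> w)"
      then have t: "t \<in> Refl" "(t = s) \<noteq> inversion w (?c t)" using inv by (auto simp: N_def)
      show "t \<in> insert s (?c ` N w)"
      proof (cases "t = s")
        case False
        then have "?c t \<in> N w" using t c by (simp add: N_def)
        then show ?thesis using c(2)[OF t(1)] by (metis image_eqI insertCI)
      qed simp
    next
      fix t assume "t \<in> insert s (?c ` N w)"
      then consider "t = s" | r where "r \<in> N w" "t = ?c r" by blast
      then show "t \<in> N (s \<otimes> w)"
      proof cases
        case 1
        then show ?thesis using s ssS inv[of s] by (auto simp: N_def)
      next
        case 2
        then have r: "r \<in> Refl" "inversion w r" by (auto simp: N_def)
        have "t \<noteq> s"
        proof
          assume "t = s"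
          then have "r = s" using c(2)[OF r(1)] 2(2) ssS by simp
          then show False using r s by simp
        qed
        then show ?thesis using inv[of t] r c 2(2) by (simp add: N_def)
      qed
    qed
    moreover have "s \<notin> ?c ` N w"
    proof
      assume "s \<in> ?c ` N w"
      then obtain r where "r \<in> N w" "s = ?c r" by blast
      then have "r = s" using c(2)[of r] ssS by (simp add: N_def)
      then show False using \<open>r \<in> N w\<close> s by (simp add: N_def)
    qed
    ultimately have "L (s \<otimes> w) = gR s + (\<Sum>t\<in>?c ` N w. gR t)"
      using finN by (simp add: L_def)
    also have "(\<Sum>t\<in>?c ` N w. gR t) = (\<Sum>t\<in>N w. gR (?c t))"
    proof -
      have "inj_on ?c (N w)" by (rule inj_onI) (metis (no_types, lifting) N_def c(2) mem_Collect_eq)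
      then show ?thesis by (simp add: sum.reindex)
    qed
    also have "\<dots> = L w"
      unfolding L_def
    proof (rule sum.cong[OF HOL.refl])
      fix t assume "t \<in> N w"
      then have t: "t \<in> Refl" by (simp add: N_def)
      obtain y r where y: "y \<in> carrier W" "r \<in> S" "t = y \<otimes> r \<otimes> inv y"
        using Refl_E[OF t] by metis
      have "conjugate t r" unfolding conjugate_def using y by (intro bexI[of _ y]) (auto simp: m_assoc)
      moreover have "conjugate (?c t) r"
        unfolding conjugate_def using y s by (intro bexI[of _ "s \<otimes> y"]) (auto simp: m_assoc)
      ultimately show "gR (?c t) = gR t" using gR[of t r] gR[of "?c t" r] y(2) t c(1)[OF t] by simp
    qed
    finally show ?thesis using gR[of s s] s by simp
  qed
  have "N \<one> = {}" by (auto simp: N_def)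
  then have L1: "L \<one> = 0" by (simp add: L_def)
  have "L (x \<otimes> y) = L x + L y"
    if "x \<in> carrier W" "y \<in> carrier W" "\<ell> (x \<otimes> y) = \<ell> x + \<ell> y" for x y
    using that
  proof (induction rule: len_induct)
    case (step s u)
    have u: "\<ell> (s \<otimes> u) = \<ell> u + 1" using len_S_mult(1)[of u s] step by simp
    have a: "s \<otimes> u \<otimes> y = s \<otimes> (u \<otimes> y)" using step by (simp add: m_assoc)
    have "\<ell> (u \<otimes> y) \<le> \<ell> u + \<ell> y" using len_mult_le step by simp
    then have "\<not> inversion (u \<otimes> y) s" "\<ell> (u \<otimes> y) = \<ell> u + \<ell> y"
      using len_S_mult(1)[of "u \<otimes> y" s] step u a by (auto split: if_splits)
    then show ?case
      using \<open>\<And>w s. s \<in> S \<Longrightarrow> w \<in> carrier W \<Longrightarrow> \<not> inversion w s \<Longrightarrow> L (s \<otimes> w) = g s + L w\<close> step a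
      by simp
  qed (simp add: L1)
  moreover have "L s = g s" if "s \<in> S" for s
    using step[of s \<one>] that L1 by simp
  ultimately show ?thesis using pos by (intro exI[of _ L]) (auto simp: pos_weight_function_def)
qed

lemma ex_small_weight:
  assumes L: "pos_weight_function W S L" and B: "B \<ge> 1"
  shows "\<exists>L'. pos_weight_function W S L' \<and> (\<forall>s\<in>S. 1 \<le> L' s \<and> L' s \<le> 2 * B) \<and>
    (\<forall>s\<in>S. \<exists>s1\<in>comp s. \<exists>s2\<in>comp s.
      (\<forall>t\<in>comp s. L t = L s1 \<and> L' t = L' s1 \<or> L t = L s2 \<and> L' t = L' s2) \<and>
      (\<forall>a b. \<bar>a\<bar> \<le> B \<longrightarrow> \<bar>b\<bar> \<le> B \<longrightarrow>
        sgn (a * L s1 + b * L s2) = sgn (a * L' s1 + b * L' s2)))"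
proof -
  \<comment> \<open>The data are chosen once for each component, taken as a set, rather than for
    each generator, where conjugate generators could receive different values.\<close>
  define R where "R K d \<longleftrightarrow> (case d of (s1, s2, p, q) \<Rightarrow>
      s1 \<in> K \<and> s2 \<in> K \<and> (\<forall>t\<in>K. L t = L s1 \<or> L t = L s2) \<and>
      1 \<le> p \<and> p \<le> 2 * B \<and> 1 \<le> q \<and> q \<le> 2 * B \<and>
      (\<forall>a b. \<bar>a\<bar> \<le> B \<longrightarrow> \<bar>b\<bar> \<le> B \<longrightarrow> sgn (a * L s1 + b * L s2) = sgn (a * p + b * q)))" for K d
  have Lpos: "L s > 0" if "s \<in> S" for s using L that by (simp add: pos_weight_function_def)
  have "\<exists>d. R (comp s) d" if s: "s \<in> S" for s
  proof -
    obtain s' where s': "s' \<in> comp s" "\<forall>t\<in>comp s. conjugate t s \<or> conjugate t s'"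
      using two_classes[OF s] by blast
    have S: "t \<in> S" if "t \<in> comp s" for t using that comp_S[OF s] by blast
    have "L t = L s \<or> L t = L s'" if "t \<in> comp s" for t
      using s'(2) that weight_conj[OF L] S s s'(1) by blast
    moreover obtain p q where "1 \<le> p" "p \<le> 2 * B" "1 \<le> q" "q \<le> 2 * B"
      "\<forall>a b. \<bar>a\<bar> \<le> B \<longrightarrow> \<bar>b\<bar> \<le> B \<longrightarrow> sgn (a * L s + b * L s') = sgn (a * p + b * q)"
      using sgn_approx[OF Lpos[OF s] Lpos[OF S[OF s'(1)]] B] by blast
    ultimately have "R (comp s) (s, s', p, q)" using s' by (simp add: R_def)
    then show ?thesis by blast
  qed
  then have "\<forall>K\<in>comp ` S. \<exists>d. R K d" by blast
  then obtain D where D: "\<forall>K\<in>comp ` S. R K (D K)" by (rule bchoice[THEN exE])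
  define g where "g t = (case D (comp t) of (s1, s2, p, q) \<Rightarrow> if L t = L s1 then p else q)" for t
  have g: "\<exists>s1\<in>comp s. \<exists>s2\<in>comp s. (\<forall>t\<in>comp s. L t = L s1 \<and> g t = g s1 \<or> L t = L s2 \<and> g t = g s2) \<and>
      (\<forall>a b. \<bar>a\<bar> \<le> B \<longrightarrow> \<bar>b\<bar> \<le> B \<longrightarrow> sgn (a * L s1 + b * L s2) = sgn (a * g s1 + b * g s2)) \<and>
      1 \<le> g s \<and> g s \<le> 2 * B"
    if s: "s \<in> S" for s
  proof -
    obtain s1 s2 p q where d: "D (comp s) = (s1, s2, p, q)" by (cases "D (comp s)") auto
    have "R (comp s) (s1, s2, p, q)" using D s d by auto
    then have R: "s1 \<in> comp s" "s2 \<in> comp s" "\<And>t. t \<in> comp s \<Longrightarrow> L t = L s1 \<or> L t = L s2"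
      "1 \<le> p" "p \<le> 2 * B" "1 \<le> q" "q \<le> 2 * B"
      "\<And>a b. \<bar>a\<bar> \<le> B \<Longrightarrow> \<bar>b\<bar> \<le> B \<Longrightarrow> sgn (a * L s1 + b * L s2) = sgn (a * p + b * q)"
      by (auto simp: R_def)
    have gt: "g t = (if L t = L s1 then p else q)" if "t \<in> comp s" for t
      using comp_eq[OF that] d by (simp add: g_def)
    \<comment> \<open>If both representatives have the same weight, \<open>g\<close> cannot tell
      them apart. The sign condition at \<open>(1, -1)\<close>, admissible as
      \<open>B \<ge> 1\<close>, gives them the same new value.\<close>
    have "p = q" if "L s1 = L s2"
    proof -
      have "sgn (1 * L s1 + (- 1) * L s2) = sgn (1 * p + (- 1) * q)" by (rule R(8)) (use B in auto)
      then have "sgn (p - q) = 0" using that by simp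
      then show ?thesis by (simp add: sgn_0_0)
    qed
    then have g12: "g s1 = p" "g s2 = q" using gt R by auto
    show ?thesis
    proof (rule bexI[of _ s1], rule bexI[of _ s2], intro conjI ballI)
      fix t assume "t \<in> comp s"
      then show "L t = L s1 \<and> g t = g s1 \<or> L t = L s2 \<and> g t = g s2"
        using R(3) gt g12 by auto
    qed (use R g12 gt[OF comp_self] in auto)
  qed
  have g_conj: "g s = g t" if "s \<in> S" "t \<in> S" "conjugate s t" for s t
    using conj_comp[OF that] weight_conj[OF L that] by (simp add: g_def)
  have g_pos: "g s > 0" if "s \<in> S" for s
  proof -
    have "1 \<le> g s" using g[OF that] by blast
    then show ?thesis by simp
  qed
  obtain L' where L': "pos_weight_function W S L'" "\<forall>s\<in>S. L' s = g s"
    using ex_weight[of g, OF g_conj g_pos] by blast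
  show ?thesis
  proof (intro exI[of _ L'] conjI ballI)
    fix s assume s: "s \<in> S"
    have L'g: "L' t = g t" if "t \<in> comp s" for t using that comp_S[OF s] L' by blast
    obtain s1 s2 where s12: "s1 \<in> comp s" "s2 \<in> comp s"
      "\<forall>t\<in>comp s. L t = L s1 \<and> g t = g s1 \<or> L t = L s2 \<and> g t = g s2"
      "\<forall>a b. \<bar>a\<bar> \<le> B \<longrightarrow> \<bar>b\<bar> \<le> B \<longrightarrow> sgn (a * L s1 + b * L s2) = sgn (a * g s1 + b * g s2)"
      "1 \<le> g s" "g s \<le> 2 * B"
      using g[OF s] by blast
    then show "\<exists>s1\<in>comp s. \<exists>s2\<in>comp s.
      (\<forall>t\<in>comp s. L t = L s1 \<and> L' t = L' s1 \<or> L t = L s2 \<and> L' t = L' s2) \<and>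
      (\<forall>a b. \<bar>a\<bar> \<le> B \<longrightarrow> \<bar>b\<bar> \<le> B \<longrightarrow>
        sgn (a * L s1 + b * L s2) = sgn (a * L' s1 + b * L' s2))"
      using s12(3,4) L'g s12(1,2)
      by (intro bexI[OF _ s12(1)] bexI[OF _ s12(2)]) auto
    show "1 \<le> L' s" "L' s \<le> 2 * B" using s12(5,6) L' s by auto
  qed (rule L'(1))
qed

end

section \<open>Integral group rings and their homomorphisms\<close>

definition frag_map :: "('g \<Rightarrow> 'h) \<Rightarrow> ('g \<Rightarrow>\<^sub>0 int) \<Rightarrow> ('h \<Rightarrow>\<^sub>0 int)"
  where "frag_map f = frag_extend (\<lambda>g. frag_of (f g))"

lemma frag_map_of [simp]: "frag_map f (frag_of g) = frag_of (f g)"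
  by (simp add: frag_map_def)

lemma frag_map_add: "frag_map f (x + y) = frag_map f x + frag_map f y"
  and frag_map_diff: "frag_map f (x - y) = frag_map f x - frag_map f y"
  by (simp_all add: frag_map_def frag_extend_add frag_extend_diff)

lemma frag_map_zero [simp]: "frag_map f 0 = 0"
  by (simp add: frag_map_def)

lemma frag_induct [case_names zero one diff]:
  assumes "P 0" "\<And>x. P (frag_of x)" "\<And>x y. P x \<Longrightarrow> P y \<Longrightarrow> P (x - y)"
  shows "P c"
  by (rule frag_induction[of c UNIV]) (use assms in auto)

lemma frag_map_mult:
  fixes x y :: "'g::monoid_add \<Rightarrow>\<^sub>0 int" and f :: "'g \<Rightarrow> 'h::monoid_add"
  assumes "\<And>a b. f (a + b) = f a + f b"
  shows "frag_map f (x * y) = frag_map f x * frag_map f y"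
proof (induction x rule: frag_induct)
  case (one g)
  show ?case
    by (induction y rule: frag_induct)
      (simp_all add: mult_single assms right_diff_distrib frag_map_diff)
qed (simp_all add: left_diff_distrib frag_map_diff)

lemma frag_map_inverse:
  assumes "\<And>g. f (h g) = g"
  shows "frag_map f (frag_map h x) = x"
  by (induction x rule: frag_induct) (simp_all add: assms frag_map_diff)

lemma lookup_frag_map:
  assumes "\<And>g. f (h g) = g" "\<And>g. h (f g) = g"
  shows "co (frag_map f x) g = co x (h g)"
proof (induction x rule: frag_induct)
  case (one g')
  have "g = f g' \<longleftrightarrow> h g = g'" using assms by metis
  then show ?case by simp
qed (simp_all add: frag_map_diff lookup_minus)

lemma lookup_frag_map_uminus:
  "co (frag_map uminus x) g = co x (- g)" for g :: "'g::group_add"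
  by (rule lookup_frag_map) simp_all

lemma convolution_frag_extend:
  fixes x y :: "'g::monoid_add \<Rightarrow>\<^sub>0 int"
  shows "frag_extend (\<lambda>g. frag_extend (\<lambda>h. frag_of (g + h)) y) x = x * y"
proof (induction x rule: frag_induct)
  case (one g)
  have "frag_extend (\<lambda>h. frag_of (g + h)) y = frag_of g * y"
    by (induction y rule: frag_induct)
      (simp_all add: mult_single right_diff_distrib frag_extend_diff)
  then show ?case by simp
qed (simp_all add: left_diff_distrib frag_extend_diff)

lemma group_ring_additive:
  fixes G :: "('g::monoid_add, 'c) monoid_scheme"
  assumes "carrier G = UNIV" "monoid.mult G = (+)" "monoid.one G = 0"
  shows "group_ring G =
    \<lparr>carrier = UNIV, monoid.mult = (*), monoid.one = 1, ring.zero = 0, ring.add = (+)\<rparr>"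
  unfolding group_ring_def assms convolution_frag_extend by (simp add: single_one)

section \<open>The ordered group of integer sequences\<close>

abbreviation \<Gamma>\<^sub>0 :: "(nat \<Rightarrow> int) monoid"
  where "\<Gamma>\<^sub>0 \<equiv> \<lparr>carrier = UNIV, monoid.mult = (+), monoid.one = 0\<rparr>"

definition lex_pos :: "(nat \<Rightarrow> int) \<Rightarrow> bool"
  where "lex_pos g \<longleftrightarrow> (\<exists>i. (\<forall>j<i. g j = 0) \<and> 0 < g i)"

lemma lex_pos_zero [simp]: "\<not> lex_pos 0"
  by (simp add: lex_pos_def)

lemma lex_pos_add:
  assumes "lex_pos g" "lex_pos h"
  shows "lex_pos (g + h)"
proof -
  obtain i j where "\<forall>k<i. g k = 0" "0 < g i" "\<forall>k<j. h k = 0" "0 < h j"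
    using assms by (auto simp: lex_pos_def)
  then show ?thesis
    unfolding lex_pos_def
    by (intro exI[of _ "min i j"]) (cases i j rule: linorder_cases; simp)
qed

text \<open>A sequence may have infinitely many non-zero entries, but a non-zero one has a first
  such entry, which decides its sign.\<close>

lemma lex_pos_cases: "g = 0 \<or> lex_pos g \<or> lex_pos (- g)"
proof (cases "g = 0")
  case False
  then have "\<exists>i. g i \<noteq> 0" by (auto simp: fun_eq_iff)
  define i where "i = (LEAST i. g i \<noteq> 0)"
  have "g i \<noteq> 0" unfolding i_def using \<open>\<exists>i. g i \<noteq> 0\<close> by (rule LeastI_ex)
  moreover have "\<forall>j<i. g j = 0" using not_less_Least unfolding i_def by blast
  ultimately show ?thesis
    unfolding lex_pos_def by (cases "0 < g i") (auto intro!: exI[of _ i])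
qed simp

lemma lex_pos_minus: "lex_pos g \<Longrightarrow> \<not> lex_pos (- g)"
  using lex_pos_add[of g "- g"] by auto

lemma \<Gamma>\<^sub>0_comm_group: "comm_group \<Gamma>\<^sub>0"
proof (rule comm_groupI)
  fix x :: "nat \<Rightarrow> int" assume "x \<in> carrier \<Gamma>\<^sub>0"
  show "\<exists>y\<in>carrier \<Gamma>\<^sub>0. y \<otimes>\<^bsub>\<Gamma>\<^sub>0\<^esub> x = \<one>\<^bsub>\<Gamma>\<^sub>0\<^esub>" by (rule bexI[of _ "- x"]) auto
qed (auto simp: ac_simps)

interpretation \<Gamma>\<^sub>0: comm_group \<Gamma>\<^sub>0
  by (rule \<Gamma>\<^sub>0_comm_group)

lemma \<Gamma>\<^sub>0_inv [simp]: "inv\<^bsub>\<Gamma>\<^sub>0\<^esub> g = - g"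
  by (rule \<Gamma>\<^sub>0.inv_equality) auto

lemma \<Gamma>\<^sub>0_ordered: "ordered_abelian_group \<Gamma>\<^sub>0 {g. lex_pos g}"
proof
  show "carrier \<Gamma>\<^sub>0 = {g. lex_pos g} \<union> {\<one>\<^bsub>\<Gamma>\<^sub>0\<^esub>} \<union> m_inv \<Gamma>\<^sub>0 ` {g. lex_pos g}"
  proof -
    have "g \<in> uminus ` {g. lex_pos g}" if "lex_pos (- g)" for g
      using that by (intro image_eqI[of _ _ "- g"]) auto
    then show ?thesis using lex_pos_cases by (auto simp: image_def)
  qed
  show "{g. lex_pos g} \<inter> m_inv \<Gamma>\<^sub>0 ` {g. lex_pos g} = {}"
    using lex_pos_minus by auto
qed (use lex_pos_add in auto)

type_synonym zg = "(nat \<Rightarrow> int) \<Rightarrow>\<^sub>0 int"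

definition neg_part :: "zg set"
  where "neg_part = {p. \<forall>g\<in>Poly_Mapping.keys p. lex_pos (- g)}"

lemma neg_part_split: "\<exists>m :: zg. frag_map uminus m = m \<and> x - m \<in> neg_part"
proof -
  \<comment> \<open>The non-negative half of \<open>x\<close>, reflected: a negative exponent
    \<open>g\<close> receives the coefficient of \<open>x\<close> at \<open>- g\<close>, so the
    difference to \<open>x\<close> lives on negative exponents.\<close>
  let ?f = "\<lambda>g. if lex_pos (- g) then co x (- g) else co x g"
  have "finite {g. ?f g \<noteq> 0}"
  proof (rule finite_subset)
    show "{g. ?f g \<noteq> 0} \<subseteq> Poly_Mapping.keys x \<union> uminus ` Poly_Mapping.keys x"
    proof
      fix g assume "g \<in> {g. ?f g \<noteq> 0}"
      then have "g \<in> Poly_Mapping.keys x \<or> - g \<in> Poly_Mapping.keys x"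
        by (auto simp: in_keys_iff split: if_splits)
      then show "g \<in> Poly_Mapping.keys x \<union> uminus ` Poly_Mapping.keys x"
        using image_eqI[of g uminus "- g"] by auto
    qed
  qed simp
  then have m: "co (Abs_poly_mapping ?f) = ?f"
    by (rule lookup_Abs_poly_mapping)
  show ?thesis
  proof (intro exI[of _ "Abs_poly_mapping ?f"] conjI)
    show "frag_map uminus (Abs_poly_mapping ?f) = Abs_poly_mapping ?f"
    proof (rule poly_mapping_eqI)
      fix g
      show "co (frag_map uminus (Abs_poly_mapping ?f)) g =
          co (Abs_poly_mapping ?f) g"
        unfolding lookup_frag_map_uminus m
        using lex_pos_cases[of g] lex_pos_minus[of g] by auto
    qed
    show "x - Abs_poly_mapping ?f \<in> neg_part"
      by (auto simp: neg_part_def in_keys_iff lookup_minus m split: if_splits)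
  qed
qed

lemma neg_part_bar:
  assumes "p \<in> neg_part" "frag_map uminus p = p"
  shows "p = 0"
proof (rule poly_mapping_eqI, rule ccontr)
  fix g assume "co p g \<noteq> co 0 g"
  then have g: "co p g \<noteq> 0" by simp
  moreover have "co p g = co p (- g)"
    using lookup_frag_map_uminus[of p g] assms(2) by simp
  ultimately have "g \<in> Poly_Mapping.keys p" "- g \<in> Poly_Mapping.keys p"
    by (simp_all add: in_keys_iff)
  then have "lex_pos (- g)" "lex_pos (- (- g))"
    using assms(1) unfolding neg_part_def by blast+
  then show False using lex_pos_minus by blast
qed

lemma keys_mult_subset:
  fixes a b :: "'g::monoid_add \<Rightarrow>\<^sub>0 int"
  assumes "g \<in> Poly_Mapping.keys (a * b)"
  shows "\<exists>x\<in>Poly_Mapping.keys a. \<exists>y\<in>Poly_Mapping.keys b. g = x + y"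
  using subsetD[OF keys_mult assms] by blast

section \<open>Specialization to two weight functions\<close>

text \<open>The factor 2 in the assumption on \<open>B\<close> makes room for differences of two
  exponents of the same structure constant.\<close>

locale two_weights = finite_coxeter W S for W (structure) and S +
  fixes L L' :: "'a \<Rightarrow> int" and B :: int
  assumes L: "pos_weight_function W S L" and L': "pos_weight_function W S L'"
    and B: "w \<in> carrier W \<Longrightarrow> 2 * int (\<ell> w) \<le> B"
    and signs: "s \<in> S \<Longrightarrow> \<exists>s1\<in>comp s. \<exists>s2\<in>comp s.
      (\<forall>t\<in>comp s. L t = L s1 \<and> L' t = L' s1 \<or> L t = L s2 \<and> L' t = L' s2) \<and>
      (\<forall>a b. \<bar>a\<bar> \<le> B \<longrightarrow> \<bar>b\<bar> \<le> B \<longrightarrow>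
        sgn (a * L s1 + b * L s2) = sgn (a * L' s1 + b * L' s2))"
begin

text \<open>Coordinates \<open>0\<close> and \<open>1\<close> are the two specializations; the others are never used.\<close>

definition V :: "'a \<Rightarrow> nat \<Rightarrow> int"
  where "V s = (\<lambda>i. if i = 0 then L s else if i = 1 then L' s else 0)"

lemma L_pos: "s \<in> S \<Longrightarrow> 0 < L s" "s \<in> S \<Longrightarrow> 0 < L' s"
  using L L' by (auto simp: pos_weight_function_def)

lemma V_pos: "s \<in> S \<Longrightarrow> lex_pos (V s)"
  unfolding lex_pos_def by (rule exI[of _ 0]) (simp add: V_def L_pos)

lemma V_conj: "s \<in> S \<Longrightarrow> t \<in> S \<Longrightarrow> conjugate s t \<Longrightarrow> V s = V t"
  unfolding V_def by (simp only: weight_conj[OF L, of s t] weight_conj[OF L', of s t])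

sublocale hecke_kl W S "\<lambda>s. frag_of (V s)" "\<lambda>s. frag_of (- V s)" "frag_map uminus" neg_part
proof
  show "frag_of (V s) * frag_of (- V s) = 1" if "s \<in> S" for s
    by (simp add: mult_single)
  show "frag_of (V s) = frag_of (V t) \<and> frag_of (- V s) = frag_of (- V t)"
    if "s \<in> S" "t \<in> S" "x \<in> carrier W" "s \<otimes> x = x \<otimes> t" for s t x
  proof -
    have "conjugate s t" unfolding conjugate_def using that(3,4) by blast
    then show ?thesis using V_conj[of s t] that(1,2) by simp
  qed
  show "frag_map uminus (x * y) = frag_map uminus x * frag_map uminus y" for x y :: zg
    by (rule frag_map_mult) simp
  show "frag_map uminus 1 = (1 :: zg)"
    using frag_map_of[of uminus "0 :: nat \<Rightarrow> int"] by (simp add: single_one)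
  show "x + y \<in> neg_part" if "x \<in> neg_part" "y \<in> neg_part" for x y
    using that keys_add[of x y] unfolding neg_part_def by blast
  show "x * y \<in> neg_part" if xy: "x \<in> neg_part" "y \<in> neg_part" for x y
    unfolding neg_part_def
  proof (intro CollectI ballI)
    fix g assume "g \<in> Poly_Mapping.keys (x * y)"
    then obtain a c where "a \<in> Poly_Mapping.keys x" "c \<in> Poly_Mapping.keys y" "g = a + c"
      using keys_mult_subset by blast
    then show "lex_pos (- g)"
      using xy lex_pos_add[of "- a" "- c"] by (auto simp: neg_part_def)
  qed
  show "frag_of (- V s) \<in> neg_part" if "s \<in> S" for s
    using V_pos[OF that] by (simp add: neg_part_def)
qed (auto simp: frag_map_add frag_map_inverse neg_part_bar neg_part_split, auto simp: neg_part_def)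

definition GG :: "(nat \<Rightarrow> int) set"
  where "GG = {g. 0 < g 0 \<and> 0 < g 1}"

definition box :: "'a \<Rightarrow> 'a \<Rightarrow> nat \<Rightarrow> (nat \<Rightarrow> int) set"
  where "box s1 s2 n = {g. \<exists>a b. \<bar>a\<bar> \<le> int n \<and> \<bar>b\<bar> \<le> int n \<and> g = (\<lambda>i. a * V s1 i + b * V s2 i)}"

lemma box_minus: "g \<in> box s1 s2 n \<Longrightarrow> - g \<in> box s1 s2 n"
proof -
  assume "g \<in> box s1 s2 n"
  then obtain a b where "\<bar>a\<bar> \<le> int n" "\<bar>b\<bar> \<le> int n" "g = (\<lambda>i. a * V s1 i + b * V s2 i)"
    by (auto simp: box_def)
  then show ?thesis
    unfolding box_def by (intro CollectI exI[of _ "- a"] exI[of _ "- b"]) auto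
qed

lemma box_add:
  assumes "g \<in> box s1 s2 n" "h \<in> box s1 s2 m"
  shows "g + h \<in> box s1 s2 (n + m)"
proof -
  obtain a b c d where "\<bar>a\<bar> \<le> int n" "\<bar>b\<bar> \<le> int n" "g = (\<lambda>i. a * V s1 i + b * V s2 i)"
    "\<bar>c\<bar> \<le> int m" "\<bar>d\<bar> \<le> int m" "h = (\<lambda>i. c * V s1 i + d * V s2 i)"
    using assms by (auto simp: box_def)
  then show ?thesis
    unfolding box_def
    by (intro CollectI exI[of _ "a + c"] exI[of _ "b + d"]) (auto simp: algebra_simps)
qed

lemma box_mono:
  assumes "g \<in> box s1 s2 n" "n \<le> m"
  shows "g \<in> box s1 s2 m"
proof -
  obtain a b where ab: "\<bar>a\<bar> \<le> int n" "\<bar>b\<bar> \<le> int n" "g = (\<lambda>i. a * V s1 i + b * V s2 i)"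
    using assms(1) by (auto simp: box_def)
  moreover have "\<bar>a\<bar> \<le> int m" "\<bar>b\<bar> \<le> int m" using ab(1,2) assms(2) by linarith+
  ultimately show ?thesis unfolding box_def by blast
qed

definition Bxs :: "'a \<Rightarrow> 'a \<Rightarrow> nat \<Rightarrow> zg set"
  where "Bxs s1 s2 n = {p. Poly_Mapping.keys p \<subseteq> box s1 s2 n}"

definition reps :: "'a \<Rightarrow> 'a \<Rightarrow> 'a \<Rightarrow> bool"
  where "reps s s1 s2 \<longleftrightarrow> s1 \<in> comp s \<and> s2 \<in> comp s \<and>
    (\<forall>t\<in>comp s. L t = L s1 \<and> L' t = L' s1 \<or> L t = L s2 \<and> L' t = L' s2) \<and>
    (\<forall>a b. \<bar>a\<bar> \<le> B \<longrightarrow> \<bar>b\<bar> \<le> B \<longrightarrow>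
      sgn (a * L s1 + b * L s2) = sgn (a * L' s1 + b * L' s2))"

lemma ex_reps: "s \<in> S \<Longrightarrow> \<exists>s1 s2. reps s s1 s2"
  using signs unfolding reps_def by blast

lemma filtered:
  assumes s: "s \<in> S" and r: "reps s s1 s2"
  shows "hecke_kl_filtered W S (\<lambda>s. frag_of (V s)) (\<lambda>s. frag_of (- V s)) (frag_map uminus)
    neg_part (comp s) (Bxs s1 s2)"
proof
  show "comp s \<subseteq> S" using comp_S s by blast
  have zero: "0 \<in> box s1 s2 n" for n
    unfolding box_def by (intro CollectI exI[of _ 0]) auto
  show "1 \<in> Bxs s1 s2 0"
    using zero[of 0] by (auto simp: Bxs_def)
  show "x + y \<in> Bxs s1 s2 n" if "x \<in> Bxs s1 s2 n" "y \<in> Bxs s1 s2 n" for x y n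
    using that keys_add[of x y] by (auto simp: Bxs_def)
  show "- x \<in> Bxs s1 s2 n" if "x \<in> Bxs s1 s2 n" for x n
    using that by (simp add: Bxs_def)
  show "x \<in> Bxs s1 s2 n'" if "x \<in> Bxs s1 s2 n" "n \<le> n'" for x n n'
    using that box_mono unfolding Bxs_def by blast
  show "x * y \<in> Bxs s1 s2 (n + n')" if "x \<in> Bxs s1 s2 n" "y \<in> Bxs s1 s2 n'" for x y n n'
    unfolding Bxs_def
  proof (intro CollectI subsetI)
    fix g assume "g \<in> Poly_Mapping.keys (x * y)"
    then obtain a c where "a \<in> Poly_Mapping.keys x" "c \<in> Poly_Mapping.keys y" "g = a + c"
      using keys_mult_subset by blast
    then show "g \<in> box s1 s2 (n + n')" using that box_add unfolding Bxs_def by blast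
  qed
  have V: "V t \<in> box s1 s2 1" if t: "t \<in> comp s" for t
  proof -
    have "L t = L s1 \<and> L' t = L' s1 \<or> L t = L s2 \<and> L' t = L' s2"
      using r t unfolding reps_def by blast
    then consider "V t = V s1" | "V t = V s2" unfolding V_def by fastforce
    then show ?thesis
    proof cases
      case 1
      then show ?thesis unfolding box_def by (intro CollectI exI[of _ 1] exI[of _ 0]) auto
    next
      case 2
      then show ?thesis
        unfolding box_def by (intro CollectI exI[of _ "0::int"] exI[of _ "1::int"]) auto
    qed
  qed
  show "frag_of (V t) \<in> Bxs s1 s2 1" if "t \<in> comp s" for t
    using V that by (simp add: Bxs_def)
  show "frag_of (- V t) \<in> Bxs s1 s2 1" if "t \<in> comp s" for t
    using V box_minus that by (simp add: Bxs_def)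
  show "m \<in> Bxs s1 s2 n"
    if m: "frag_map uminus m = m" and p: "p \<in> neg_part" and mp: "m + p \<in> Bxs s1 s2 n" for m p n
    unfolding Bxs_def
  proof (intro CollectI subsetI)
    fix g assume g: "g \<in> Poly_Mapping.keys m"
    have sym: "co m (- g) = co m g"
      using lookup_frag_map_uminus[of m g] m by simp
    \<comment> \<open>At a non-negative exponent \<open>p\<close> has coefficient 0, so
      \<open>m\<close> and \<open>m + p\<close> agree there; the negative exponents of
      \<open>m\<close> follow by symmetry.\<close>
    have nonneg: "h \<in> box s1 s2 n" if "h \<in> Poly_Mapping.keys m" "\<not> lex_pos (- h)" for h
    proof -
      have "co p h = 0" using p that by (auto simp: neg_part_def in_keys_iff)
      then have "h \<in> Poly_Mapping.keys (m + p)" using that by (simp add: in_keys_iff lookup_add)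
      then show ?thesis using mp by (auto simp: Bxs_def)
    qed
    show "g \<in> box s1 s2 n"
    proof (cases "lex_pos (- g)")
      case True
      then have "\<not> lex_pos (- (- g))" using lex_pos_minus by blast
      moreover have "- g \<in> Poly_Mapping.keys m" using g sym by (simp add: in_keys_iff)
      ultimately show ?thesis using nonneg[of "- g"] box_minus[of "- g"] by simp
    qed (use nonneg g in blast)
  qed
qed (simp add: Bxs_def)

text \<open>Entries 0 and 1 of \<open>g\<close> have the same sign and all later ones vanish. So the
  leading entry is entry 0, and entry 1 is positive with it.\<close>

lemma box_pos:
  assumes "reps s s1 s2" "g \<in> box s1 s2 n" "int n \<le> B" "lex_pos g"
  shows "g \<in> GG"
proof -
  obtain a b where ab: "\<bar>a\<bar> \<le> int n" "\<bar>b\<bar> \<le> int n" "g = (\<lambda>i. a * V s1 i + b * V s2 i)"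
    using assms(2) by (auto simp: box_def)
  have g: "g 0 = a * L s1 + b * L s2" "g 1 = a * L' s1 + b * L' s2" "\<And>i. 1 < i \<Longrightarrow> g i = 0"
    using ab(3) by (auto simp: V_def)
  have sg: "sgn (g 0) = sgn (g 1)"
    using assms(1,3) ab(1,2) unfolding g reps_def by auto
  obtain i where i: "\<forall>j<i. g j = 0" "0 < g i" using assms(4) by (auto simp: lex_pos_def)
  consider "i = 0" | "i = 1" | "i > 1" by linarith
  then show ?thesis
  proof cases
    case 1
    then show ?thesis using i sg by (auto simp: GG_def sgn_if split: if_splits)
  next
    case 2
    then show ?thesis using i sg by (auto simp: GG_def sgn_if split: if_splits)
  next
    case 3
    then show ?thesis using i g(3) by force
  qed
qed

section \<open>Positivity of the exponents under both specializations\<close>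

lemma KL_comp:
  assumes s: "s \<in> S" and w: "w \<in> par (comp s)" "y \<noteq> w" "g \<in> Poly_Mapping.keys (co (KL w) y)"
  shows "- g \<in> GG"
proof -
  obtain s1 s2 where r: "reps s s1 s2" using ex_reps s by blast
  interpret F: hecke_kl_filtered W S "\<lambda>s. frag_of (V s)" "\<lambda>s. frag_of (- V s)" "frag_map uminus"
    neg_part "comp s" "Bxs s1 s2"
    by (rule filtered[OF s r])
  have wc: "w \<in> carrier W" using par_carrier[OF comp_S[OF s] w(1)] .
  have "co (KL w) y \<noteq> 0" using w(3) by auto
  then have y: "y \<in> carrier W" using KL_support[OF wc w(2)] bless_imp by blast
  have "g \<in> box s1 s2 (\<ell> w - \<ell> y)"
    using F.KL_Bx[OF w(1) y] w(3) by (auto simp: Bxs_def)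
  moreover have "lex_pos (- g)"
    using KL_Neg[OF wc w(2)] w(3) by (auto simp: neg_part_def)
  moreover have "int (\<ell> w - \<ell> y) \<le> B" using B[OF wc] by simp
  ultimately show ?thesis using box_pos[OF r box_minus] by blast
qed

lemma parts:
  assumes "s \<in> S" "K \<subseteq> S - comp s"
  shows "hecke_kl_parts W S (\<lambda>s. frag_of (V s)) (\<lambda>s. frag_of (- V s)) (frag_map uminus)
    neg_part (comp s) K"
  using comp_parts[OF assms] by (intro hecke_kl_parts.intro hecke_kl_axioms)

lemma GG_add: "g \<in> GG \<Longrightarrow> h \<in> GG \<Longrightarrow> g + h \<in> GG"
  by (simp add: GG_def)

text \<open>Split off one component at a time. An exponent of a product is a sum of exponents of the
  two factors. A factor at its top element contributes 0, any other the negative of a member of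
  \<open>GG\<close>, and \<open>GG\<close> is closed under addition.\<close>

lemma KL_exponents_closed:
  assumes "M \<subseteq> S" "\<And>s. s \<in> M \<Longrightarrow> comp s \<subseteq> M" "w \<in> par M" "y \<noteq> w"
    "g \<in> Poly_Mapping.keys (co (KL w) y)"
  shows "- g \<in> GG"
  using assms
proof (induction "card M" arbitrary: M w y g rule: less_induct)
  case less
  show ?case
  proof (cases "M = {}")
    case True
    then have "w = \<one>" using less.prems(3) by (auto simp: par_def)
    then show ?thesis using less.prems by (simp add: KL_one lookup_T)
  next
    case False
    then obtain s where s: "s \<in> M" "s \<in> S" using less.prems by blast
    let ?M = "M - comp s"
    interpret P: hecke_kl_parts W S "\<lambda>s. frag_of (V s)" "\<lambda>s. frag_of (- V s)" "frag_map uminus"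
      neg_part "comp s" ?M
      by (rule parts) (use s less.prems in auto)
    have "finite M" using less.prems(1) finite_subset by blast
    then have card: "card ?M < card M"
      using s(1) comp_self[of s] by (intro psubset_card_mono) blast+
    have closed: "comp t \<subseteq> ?M" if "t \<in> ?M" for t
      using less.prems(2)[of t] that comp_eq[of _ t] comp_eq[of _ s] comp_self[of t] by blast
    have "M = comp s \<union> ?M" using less.prems(2)[OF s(1)] by blast
    then obtain a c where ac: "a \<in> par (comp s)" "c \<in> par ?M" "w = a \<otimes> c"
      using P.par_decompose[of w] less.prems(3) by auto
    have "co (KL w) y \<noteq> 0" using less.prems(5) by auto
    then obtain a' c' where ac': "a' \<in> par (comp s)" "c' \<in> par ?M" "y = a' \<otimes> c'"
      "co (KL w) y = co (KL a) a' * co (KL c) c'"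
      using P.lookup_KL_par_cases[OF ac(1,2)] ac(3) by blast
    have IH: "- h \<in> GG" if "c' \<noteq> c" "h \<in> Poly_Mapping.keys (co (KL c) c')" for h
      using less.hyps[OF card _ closed ac(2) that] less.prems(1) by blast
    have A: "- h \<in> GG" if "a' \<noteq> a" "h \<in> Poly_Mapping.keys (co (KL a) a')" for h
      using KL_comp[OF s(2) ac(1) that] .
    have tops: "co (KL a) a = 1" "co (KL c) c = 1" using KL_top ac by auto
    obtain h k where hk: "h \<in> Poly_Mapping.keys (co (KL a) a')" "k \<in> Poly_Mapping.keys (co (KL c) c')"
      "g = h + k"
      using keys_mult_subset less.prems(5) unfolding ac'(4) by blast
    show ?thesis
    proof (cases "a' = a")
      case True
      then have "h = 0" using hk tops by simp
      moreover have "c' \<noteq> c" using True ac ac' less.prems(4) by blast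
      ultimately show ?thesis using IH hk by simp
    next
      case False
      then have h: "- h \<in> GG" using A hk by blast
      show ?thesis
      proof (cases "c' = c")
        case True
        then have "k = 0" using hk tops by simp
        then show ?thesis using h hk by simp
      next
        case False
        then show ?thesis using h IH[OF _ hk(2)] GG_add[of "- h" "- k"] hk(3) by simp
      qed
    qed
  qed
qed

lemma KL_exponents:
  assumes "w \<in> carrier W" "y \<noteq> w" "g \<in> Poly_Mapping.keys (co (KL w) y)"
  shows "- g \<in> GG"
  by (rule KL_exponents_closed[of S w y g]) (use assms comp_S par_S in auto)

text \<open>By \<open>MM_par\<close> the coefficient already occurs for the factor \<open>x\<close>
  of \<open>u\<close> in the component of \<open>s\<close>. So its exponents lie in a box spanned by
  two parameters, and differences double the size of the box.\<close>

lemma MM_exponents: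
  assumes s: "s \<in> S" and u: "u \<in> carrier W" and up: "\<not> inversion u s"
    and g: "g \<in> Poly_Mapping.keys (MM s u v)" "h \<in> Poly_Mapping.keys (MM s u v)" "lex_pos (h - g)"
  shows "h - g \<in> GG"
proof -
  interpret P: hecke_kl_parts W S "\<lambda>s. frag_of (V s)" "\<lambda>s. frag_of (- V s)" "frag_map uminus"
    neg_part "comp s" "S - comp s"
    by (rule parts) (use s in auto)
  have "S = comp s \<union> (S - comp s)" using comp_S[OF s] by blast
  then obtain x y where xy: "x \<in> par (comp s)" "y \<in> par (S - comp s)" "u = x \<otimes> y"
    using P.par_decompose[of u] u par_S by auto
  have xc: "x \<in> carrier W" using xy by blast
  have up': "\<not> inversion x s"
    using P.inversion_par_mult[OF xy(1,2), of s] par_gen[OF P.JS comp_self] up xy(3) by simp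
  have "MM s (x \<otimes> y) v \<noteq> 0" using g(1) xy(3) by auto
  then obtain z where z: "z \<in> Zset s x" "MM s u v = MM s x z"
    using P.MM_par[OF comp_self xy(1,2) up'] xy(3) by blast
  obtain s1 s2 where r: "reps s s1 s2" using ex_reps s by blast
  interpret F: hecke_kl_filtered W S "\<lambda>s. frag_of (V s)" "\<lambda>s. frag_of (- V s)" "frag_map uminus"
    neg_part "comp s" "Bxs s1 s2"
    by (rule filtered[OF s r])
  \<comment> \<open>\<open>z\<close> has the descent \<open>s\<close>, so its length is at least 1.
    This absorbs the 1 in \<open>\<ell> x + 1 - \<ell> z\<close>, and the doubled bound stays within
    \<open>B\<close>.\<close>
  have "z \<noteq> \<one>" using z(1) s by (auto simp: Zset_def)
  then have "1 \<le> \<ell> z" using len_eq_0_iff Zset_carrier[OF z(1)] by (metis One_nat_def Suc_leI neq0_conv)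
  then have le: "\<ell> x + 1 - \<ell> z \<le> \<ell> x" by simp
  have "Poly_Mapping.keys (MM s u v) \<subseteq> box s1 s2 (\<ell> x + 1 - \<ell> z)"
    using F.MM_Bx[OF comp_self xy(1) up', of z] unfolding z(2) Bxs_def by blast
  then have "g \<in> box s1 s2 (\<ell> x)" "h \<in> box s1 s2 (\<ell> x)"
    using box_mono[OF _ le] g(1,2) by blast+
  then have "h + (- g) \<in> box s1 s2 (\<ell> x + \<ell> x)" by (intro box_add box_minus)
  moreover have "int (\<ell> x + \<ell> x) \<le> B" using B[OF xc] by simp
  ultimately show ?thesis using box_pos[OF r _ _ g(3)] by simp
qed

end

section \<open>The generic Hecke algebra over the integer sequences\<close>

lemma \<Gamma>\<^sub>0_group_ring:
  "group_ring \<Gamma>\<^sub>0 = \<lparr>carrier = UNIV, monoid.mult = (*), monoid.one = 1, ring.zero = 0, ring.add = (+)\<rparr>"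
  by (rule group_ring_additive) simp_all

lemma laurent_ring_eq:
  "laurent_ring = \<lparr>carrier = UNIV, monoid.mult = (*), monoid.one = 1, ring.zero = 0, ring.add = (+)\<rparr>"
  unfolding laurent_ring_def
  by (rule group_ring_additive) (simp_all add: integer_group_def)

lemma cring_comm_ring_1:
  "cring \<lparr>carrier = (UNIV :: 'r::comm_ring_1 set), monoid.mult = (*), monoid.one = 1,
    ring.zero = 0, ring.add = (+)\<rparr>"
proof (rule cringI)
  show "abelian_group \<lparr>carrier = (UNIV :: 'r set), monoid.mult = (*), monoid.one = 1,
      ring.zero = 0, ring.add = (+)\<rparr>"
  proof (rule abelian_groupI)
    fix x :: 'r
    show "\<exists>y\<in>carrier \<lparr>carrier = (UNIV :: 'r set), monoid.mult = (*), monoid.one = 1,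
        ring.zero = 0, ring.add = (+)\<rparr>.
      y \<oplus>\<^bsub>\<lparr>carrier = (UNIV :: 'r set), monoid.mult = (*), monoid.one = 1,
        ring.zero = 0, ring.add = (+)\<rparr>\<^esub> x =
      \<zero>\<^bsub>\<lparr>carrier = (UNIV :: 'r set), monoid.mult = (*), monoid.one = 1,
        ring.zero = 0, ring.add = (+)\<rparr>\<^esub>"
      by (rule bexI[of _ "- x"]) auto
  qed (auto simp: algebra_simps)
  show "comm_monoid \<lparr>carrier = (UNIV :: 'r set), monoid.mult = (*), monoid.one = 1,
      ring.zero = 0, ring.add = (+)\<rparr>"
    by (rule comm_monoidI) (auto simp: algebra_simps)
qed (auto simp: algebra_simps)

context two_weights
begin

definition HH :: "(zg, 'a \<Rightarrow>\<^sub>0 zg) module"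
  where "HH = \<lparr>carrier = Hc, monoid.mult = mult, monoid.one = T \<one>, ring.zero = 0, ring.add = (+),
    module.smult = scale\<rparr>"

lemma HH_simps [simp]:
  "carrier HH = Hc" "monoid.mult HH = mult" "monoid.one HH = T \<one>" "ring.zero HH = 0"
  "ring.add HH = (+)" "module.smult HH = scale"
  by (simp_all add: HH_def)

lemma T_basis_eq [simp]: "T_basis \<Gamma>\<^sub>0 w = T w"
  by (simp add: T_basis_def T_def single_one)

lemma HH_abelian: "abelian_group HH"
proof (rule abelian_groupI)
  fix x assume "x \<in> carrier HH"
  then show "\<exists>y\<in>carrier HH. y \<oplus>\<^bsub>HH\<^esub> x = \<zero>\<^bsub>HH\<^esub>"
    by (intro bexI[of _ "- x"]) auto
qed (auto simp: ac_simps)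

lemma HH_ring: "ring HH"
proof (rule ringI)
  show "monoid HH" by (rule monoidI) (auto simp: mult_assoc)
qed (auto simp: HH_abelian mult_add_left mult_add_right)

interpretation HH: ring HH
  by (rule HH_ring)

lemma HH_minus: "a \<in> Hc \<Longrightarrow> b \<in> Hc \<Longrightarrow> a \<ominus>\<^bsub>HH\<^esub> b = a - b"
proof -
  assume a: "a \<in> Hc" "b \<in> Hc"
  have "\<ominus>\<^bsub>HH\<^esub> b = - b" by (rule HH.minus_equality) (use a in auto)
  then show ?thesis by (simp add: a_minus_def)
qed

lemma HH_finsum:
  assumes "finite I" "\<And>i. i \<in> I \<Longrightarrow> f i \<in> Hc"
  shows "(\<Oplus>\<^bsub>HH\<^esub>i\<in>I. f i) = sum f I"
  using assms
proof (induction I rule: finite_induct)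
  case (insert i I)
  then show ?case by (subst HH.finsum_insert) auto
qed simp

lemma HH_module: "module (group_ring \<Gamma>\<^sub>0) HH"
  unfolding \<Gamma>\<^sub>0_group_ring
  by (rule moduleI)
    (auto simp: HH_abelian cring_comm_ring_1 add_scale scale_add scale_scale)

lemma HH_inv:
  assumes "w \<in> carrier W"
  shows "inv\<^bsub>HH\<^esub> (T (inv w)) = hbar (T w)"
proof -
  have "is_inverse (T (inv w)) (hbar (T w))"
    using Tbar_is_inverse hbar_T assms by simp
  then show ?thesis
    using assms by (intro HH.inv_char) (auto simp: is_inverse_def)
qed

lemma hecke: "hecke_algebra W S \<Gamma>\<^sub>0 {g. lex_pos g} V HH hbar"
proof (intro hecke_algebra.intro hecke_algebra_axioms.intro)
  show "coxeter_system W S" by (rule coxeter_system_axioms)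
  show "ordered_abelian_group \<Gamma>\<^sub>0 {g. lex_pos g}" by (rule \<Gamma>\<^sub>0_ordered)
  show "V s = V t" if "s \<in> S" "t \<in> S" "x \<in> carrier W" "t = x \<otimes> s \<otimes> inv x" for s t x
  proof -
    have "t \<otimes> x = x \<otimes> s" using that by (simp add: m_assoc)
    then have "conjugate t s" unfolding conjugate_def using that(3) by blast
    then show ?thesis using V_conj[OF that(2,1)] by simp
  qed
  show "module (group_ring \<Gamma>\<^sub>0) HH" by (rule HH_module)
  show "ring HH" by (rule HH_ring)
  show "T_basis \<Gamma>\<^sub>0 s \<otimes>\<^bsub>HH\<^esub> T_basis \<Gamma>\<^sub>0 w = T_basis \<Gamma>\<^sub>0 (s \<otimes> w)"
    if "s \<in> S" "w \<in> carrier W" "\<ell> w < \<ell> (s \<otimes> w)" for s w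
    using that inversion_iff_len_S[of w s] by (simp add: T_S_mult_T)
  show "T_basis \<Gamma>\<^sub>0 s \<otimes>\<^bsub>HH\<^esub> T_basis \<Gamma>\<^sub>0 w = T_basis \<Gamma>\<^sub>0 (s \<otimes> w) \<oplus>\<^bsub>HH\<^esub>
      (frag_of (V s) - frag_of (inv\<^bsub>\<Gamma>\<^sub>0\<^esub> V s)) \<odot>\<^bsub>HH\<^esub> T_basis \<Gamma>\<^sub>0 w"
    if "s \<in> S" "w \<in> carrier W" "\<ell> (s \<otimes> w) < \<ell> w" for s w
    using that inversion_iff_len_S[of w s] by (simp add: T_S_mult_T \<xi>_def)
  show "hbar \<in> ring_hom HH HH"
    by (rule ring_hom_memI) (auto simp: hbar_mult hbar_add hbar_T)
  show "hbar (frag_of g \<odot>\<^bsub>HH\<^esub> \<one>\<^bsub>HH\<^esub>) = frag_of (inv\<^bsub>\<Gamma>\<^sub>0\<^esub> g) \<odot>\<^bsub>HH\<^esub> \<one>\<^bsub>HH\<^esub>" if "g \<in> carrier \<Gamma>\<^sub>0" for g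
    by (simp add: hbar_scale hbar_T)
  show "hbar (T_basis \<Gamma>\<^sub>0 w) = inv\<^bsub>HH\<^esub> (T_basis \<Gamma>\<^sub>0 (inv w))" if "w \<in> carrier W" for w
    using HH_inv that by simp
  show "carrier HH = {h. Poly_Mapping.keys h \<subseteq> carrier W \<and>
      (\<forall>w. co h w \<in> carrier (group_ring \<Gamma>\<^sub>0))}"
    unfolding \<Gamma>\<^sub>0_group_ring by (simp add: Hc_def)
  show "co (c \<odot>\<^bsub>HH\<^esub> a) w = c \<otimes>\<^bsub>group_ring \<Gamma>\<^sub>0\<^esub> co a w" for c a w
    unfolding \<Gamma>\<^sub>0_group_ring by simp
qed (simp_all add: V_pos mult_scale_left mult_scale_right hbar_hbar)

interpretation A: hecke_algebra W S \<Gamma>\<^sub>0 "{g. lex_pos g}" V HH hbar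
  by (rule hecke)

lemma finite_bless [simp, intro]: "finite {y. y \<prec>\<^sub>B w}"
  by (rule finite_subset[OF _ fin]) (use bless_imp in blast)

lemma neg_set: "m_inv \<Gamma>\<^sub>0 ` {g. lex_pos g} = {g. lex_pos (- g)}"
proof -
  have "g \<in> uminus ` {g. lex_pos g}" if "lex_pos (- g)" for g
    using that by (intro image_eqI[of _ _ "- g"]) auto
  then show ?thesis by (auto simp: image_def)
qed

lemma C_eq:
  assumes w: "w \<in> carrier W"
  shows "A.C w = KL w"
proof -
  let ?N = "m_inv \<Gamma>\<^sub>0 ` {g. lex_pos g}"
  let ?exp = "\<lambda>P. T_basis \<Gamma>\<^sub>0 w \<oplus>\<^bsub>HH\<^esub> (\<Oplus>\<^bsub>HH\<^esub>y\<in>{y. y \<prec>\<^sub>B w}. P y \<odot>\<^bsub>HH\<^esub> T_basis \<Gamma>\<^sub>0 y)"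
  have ww: "\<not> w \<prec>\<^sub>B w" using bless_imp by blast
  have co_exp: "co (?exp P) x = (if x = w then 1 else if x \<prec>\<^sub>B w then P x else 0)" for P x
  proof -
    have "(\<Oplus>\<^bsub>HH\<^esub>y\<in>{y. y \<prec>\<^sub>B w}. P y \<odot>\<^bsub>HH\<^esub> T_basis \<Gamma>\<^sub>0 y) = (\<Sum>y\<in>{y. y \<prec>\<^sub>B w}. scale (P y) (T y))"
      using bless_imp by (subst HH_finsum) auto
    moreover have "co (\<Sum>y\<in>{y. y \<prec>\<^sub>B w}. scale (P y) (T y)) x =
        (\<Sum>y\<in>{y. y \<prec>\<^sub>B w}. if y = x then P x else 0)"
      unfolding lookup_sum by (rule sum.cong) (auto simp: lookup_T)
    ultimately show ?thesis using ww by (auto simp: lookup_add lookup_T)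
  qed
  \<comment> \<open>The value at \<open>w\<close> is reset to 0: the top coefficient 1 has exponent
    0, while \<open>P\<close> must have negative exponents everywhere.\<close>
  let ?P = "\<lambda>y. if y = w then 0 else co (KL w) y"
  have "KL w = ?exp ?P"
  proof (rule poly_mapping_eqI)
    show "co (KL w) x = co (?exp ?P) x" for x
      unfolding co_exp using KL_top[OF w] KL_support[OF w, of x] by auto
  qed
  moreover have "\<forall>y. Poly_Mapping.keys (?P y) \<subseteq> ?N"
    unfolding neg_set using KL_Neg[OF w] by (simp add: neg_part_def subset_iff)
  ultimately have "\<exists>P. (\<forall>y. Poly_Mapping.keys (P y) \<subseteq> ?N) \<and> KL w = ?exp P"
    by (intro exI[of _ ?P] conjI)
  then have KL: "KL w \<in> carrier HH \<and> hbar (KL w) = KL w \<and>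
      (\<exists>P. (\<forall>y. Poly_Mapping.keys (P y) \<subseteq> ?N) \<and> KL w = ?exp P)"
    using KL_Hc[OF w] KL_bar[OF w] by simp
  have "c = KL w" if c: "c \<in> carrier HH \<and> hbar c = c \<and>
      (\<exists>P. (\<forall>y. Poly_Mapping.keys (P y) \<subseteq> ?N) \<and> c = ?exp P)" for c
  proof -
    obtain P where P: "\<And>y. Poly_Mapping.keys (P y) \<subseteq> ?N" "c = ?exp P" using c by blast
    have co_c: "co c x = (if x = w then 1 else if x \<prec>\<^sub>B w then P x else 0)" for x
      unfolding P(2) by (rule co_exp)
    have "P x \<in> neg_part" for x using P(1) unfolding neg_set neg_part_def by blast
    then have "KL w = c" by (intro KL_eqI) (use w c co_c in auto)
    then show ?thesis by simp
  qed
  with KL show ?thesis unfolding A.C_def by (rule the_equality)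
qed

lemma M_eq:
  assumes s: "s \<in> S" and w: "w \<in> carrier W" "\<not> inversion w s"
  shows "A.M s y w = MM s w y"
proof -
  have Z: "{z. z \<prec>\<^sub>B w \<and> s \<otimes> z \<prec>\<^sub>B z} = Zset s w"
    using bless_S_iff[OF s] bless_imp unfolding Zset_def by blast
  have nz: "\<not> (z \<prec>\<^sub>B w \<and> s \<otimes> z \<prec>\<^sub>B z) \<longleftrightarrow> z \<notin> Zset s w" for z using Z by blast
  have sum: "(\<Oplus>\<^bsub>HH\<^esub>z\<in>Zset s w. m z \<odot>\<^bsub>HH\<^esub> A.C z) = (\<Sum>z\<in>Zset s w. scale (m z) (KL z))" for m
    using Zset_carrier[of _ s w] C_eq KL_Hc by (subst HH_finsum) (auto cong: sum.cong)
  have iff: "(\<forall>z. m z \<in> carrier (group_ring \<Gamma>\<^sub>0)) \<and>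
      (\<forall>z. \<not> (z \<prec>\<^sub>B w \<and> s \<otimes> z \<prec>\<^sub>B z) \<longrightarrow> m z = 0) \<and>
      T_basis \<Gamma>\<^sub>0 s \<otimes>\<^bsub>HH\<^esub> A.C w = A.C (s \<otimes> w) \<ominus>\<^bsub>HH\<^esub> frag_of (inv\<^bsub>\<Gamma>\<^sub>0\<^esub> (V s)) \<odot>\<^bsub>HH\<^esub> A.C w
        \<oplus>\<^bsub>HH\<^esub> (\<Oplus>\<^bsub>HH\<^esub>z\<in>{z. z \<prec>\<^sub>B w \<and> s \<otimes> z \<prec>\<^sub>B z}. m z \<odot>\<^bsub>HH\<^esub> A.C z) \<longleftrightarrow> is_MM s w m" for m
    unfolding Z nz sum is_MM_def \<Gamma>\<^sub>0_group_ring
    using s w by (simp add: C_eq HH_minus)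
  have "(THE m. is_MM s w m) = MM s w"
    by (rule the_equality[of "is_MM s w", OF MM_is_MM[OF s w] is_MM_unique[OF _ MM_is_MM[OF s w]]])
  then show ?thesis unfolding A.M_def iff by simp
qed

lemma Gamma_plus_W_GG: "A.Gamma_plus_W \<subseteq> GG"
proof -
  have "\<gamma> \<in> GG" if \<gamma>: "\<gamma> \<in> A.Gamma_a" for \<gamma>
  proof -
    obtain y w where yw: "w \<in> carrier W" "y \<prec>\<^sub>B w"
      "co (A.Pstar y w) (inv\<^bsub>\<Gamma>\<^sub>0\<^esub> \<gamma>) \<noteq> 0"
      using \<gamma> unfolding A.Gamma_a_def by blast
    have "y \<noteq> w" using bless_imp[OF yw(2)] by blast
    moreover have "- \<gamma> \<in> Poly_Mapping.keys (co (KL w) y)"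
      using yw(3) by (simp add: A.Pstar_def C_eq[OF yw(1)] in_keys_iff)
    ultimately show ?thesis using KL_exponents[OF yw(1)] by fastforce
  qed
  moreover have "\<delta> \<in> GG" if \<delta>: "\<delta> \<in> A.Gamma_b" for \<delta>
  proof -
    obtain s y w r n \<gamma> i where sw: "s \<in> S" "y \<prec>\<^sub>B w" "w \<prec>\<^sub>B s \<otimes> w"
      and eq: "A.M s y w = (\<Sum>j = 1..(r::nat). frag_cmul (n j) (frag_of (\<gamma> j)))"
      and n: "\<forall>j\<in>{1..r}. n j \<noteq> 0 \<and> \<gamma> j \<in> carrier \<Gamma>\<^sub>0"
      and step: "\<forall>j\<in>{2..r}. inv\<^bsub>\<Gamma>\<^sub>0\<^esub> (\<gamma> (j - 1)) \<otimes>\<^bsub>\<Gamma>\<^sub>0\<^esub> \<gamma> j \<in> {g. lex_pos g}"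
      and i: "i \<in> {2..r}" "\<delta> = inv\<^bsub>\<Gamma>\<^sub>0\<^esub> (\<gamma> (i - 1)) \<otimes>\<^bsub>\<Gamma>\<^sub>0\<^esub> \<gamma> i"
      using \<delta> unfolding A.Gamma_b_def by (elim CollectE exE conjE) (rule that; assumption)
    have w: "w \<in> carrier W" "\<not> inversion w s"
      using bless_imp[OF sw(2)] bless_S_iff' sw by blast+
    \<comment> \<open>The group elements increase strictly, so they are distinct and no terms of the
      sum merge: each one is an exponent of the structure constant.\<close>
    have less: "lex_pos (\<gamma> k - \<gamma> j)" if "1 \<le> j" "j < k" "k \<le> r" for j k
      using that(2,3)
    proof (induction k rule: less_induct)
      case (less k)
      have k: "lex_pos (\<gamma> k - \<gamma> (k - 1))"
        using step less.prems that(1) by (auto simp: add.commute[of "- _"] dest!: bspec[of _ _ k])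
      show ?case
      proof (cases "j = k - 1")
        case False
        then have "k - 1 < k" "j < k - 1" "k - 1 \<le> r" using less.prems by auto
        then have "lex_pos (\<gamma> (k - 1) - \<gamma> j)" by (rule less.IH)
        have "\<gamma> k - \<gamma> j = (\<gamma> k - \<gamma> (k - 1)) + (\<gamma> (k - 1) - \<gamma> j)" 
          by (metis add_diff_eq diff_add_cancel)
        then show ?thesis using lex_pos_add[OF k \<open>lex_pos (\<gamma> (k - 1) - \<gamma> j)\<close>] by (simp only:)
      next
        case True
        then show ?thesis using k by (simp only:)
      qed
    qed
    have inj: "\<gamma> j \<noteq> \<gamma> k" if "j \<in> {1..r}" "k \<in> {1..r}" "j \<noteq> k" for j k
      using less[of j k] less[of k j] that by (cases j k rule: linorder_cases) auto
    have key: "\<gamma> k \<in> Poly_Mapping.keys (MM s w y)" if k: "k \<in> {1..r}" for k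
    proof -
      have "co (MM s w y) (\<gamma> k) = (\<Sum>j = 1..r. if j = k then n k else 0)"
        unfolding M_eq[OF sw(1) w, symmetric] eq lookup_sum
        using inj k by (intro sum.cong) (auto simp: lookup_single)
      then have "co (MM s w y) (\<gamma> k) = n k" using k by simp
      then show ?thesis using n k by (simp add: in_keys_iff)
    qed
    have "\<gamma> i - \<gamma> (i - 1) \<in> GG"
    proof (rule MM_exponents[OF sw(1) w])
      show "\<gamma> (i - 1) \<in> Poly_Mapping.keys (MM s w y)" "\<gamma> i \<in> Poly_Mapping.keys (MM s w y)"
        using i(1) by (auto intro!: key)
      show "lex_pos (\<gamma> i - \<gamma> (i - 1))" using i(1) by (intro less) auto
    qed
    then show ?thesis using i(2) by (simp add: add.commute[of "- _"])
  qed
  ultimately show ?thesis unfolding A.Gamma_plus_W_def by blast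
qed

text \<open>Evaluation at position \<open>k\<close> is additive on sequences and so extends to the
  group rings; positions 0 and 1 serve \<open>L\<close> and \<open>L'\<close>.\<close>

lemma specializes_coordinate:
  fixes k :: nat and M :: "'a \<Rightarrow> int"
  assumes V: "\<And>s. s \<in> S \<Longrightarrow> V s k = M s" and G: "\<And>g. g \<in> GG \<Longrightarrow> 0 < g k"
  shows "specializes W S \<Gamma>\<^sub>0 {g. lex_pos g} V HH hbar M"
proof -
  let ?\<sigma> = "frag_map (\<lambda>g :: nat \<Rightarrow> int. g k)"
  have "?\<sigma> 1 = 1"
    using frag_map_of[of "\<lambda>g :: nat \<Rightarrow> int. g k" 0] by (simp add: single_one)
  then have "?\<sigma> \<in> ring_hom (group_ring \<Gamma>\<^sub>0) laurent_ring"
    unfolding \<Gamma>\<^sub>0_group_ring laurent_ring_eq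
    by (intro ring_hom_memI) (simp_all add: frag_map_mult frag_map_add)
  moreover have "\<forall>s\<in>S. ?\<sigma> (frag_of (V s)) = vpow (M s)" using V by simp
  moreover have "\<forall>\<gamma>\<in>A.Gamma_plus_W. \<exists>n>0. ?\<sigma> (frag_of \<gamma>) = vpow n"
    using Gamma_plus_W_GG G by (intro ballI) (auto intro!: exI[of _ "_ k"])
  ultimately show ?thesis unfolding specializes_def by blast
qed

lemma equivalent: "equivalent_weights W S L L'"
proof -
  have "specializes W S \<Gamma>\<^sub>0 {g. lex_pos g} V HH hbar L"
    by (rule specializes_coordinate[of 0]) (auto simp: V_def GG_def)
  moreover have "specializes W S \<Gamma>\<^sub>0 {g. lex_pos g} V HH hbar L'"
    by (rule specializes_coordinate[of 1]) (auto simp: V_def GG_def)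
  ultimately have "Gamma_equivalent TYPE(nat \<Rightarrow> int) W S L L'"
    unfolding Gamma_equivalent_def using hecke by blast
  then show ?thesis
    unfolding equivalent_weights_def using L L'
    by (intro disjI2 exI[of _ 1] exI[of _ "\<lambda>i. if i = 0 then L else L'"]) auto
qed

end

theorem proposition2p14:
  fixes W :: "('w, 'b) monoid_scheme" and S :: "'w set" and w0 :: 'w
  assumes "coxeter_system W S"
    and "finite (carrier W)"
    and "w0 \<in> carrier W"
    and "\<forall>w\<in>carrier W. cox_length W S w \<le> cox_length W S w0"
  shows "\<exists>N::nat. N \<le> 8 * cox_length W S w0 ^ 3 \<and>
    (\<forall>L. pos_weight_function W S L \<longrightarrow>
      (\<exists>L'. pos_weight_function W S L' \<and> equivalent_weights W S L L' \<and>
        (\<forall>s\<in>S. 1 \<le> L' s \<and> L' s \<le> int N)))"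
proof -
  interpret coxeter_system W S by (rule assms(1))
  interpret finite_coxeter W S by unfold_locales (rule assms(2))
  let ?l = "cox_length W S w0"
  show ?thesis
  proof (cases "S = {}")
    \<comment> \<open>Without generators the group is trivial and \<open>w0\<close> has length 0, so
      the bound forces \<open>N = 0\<close>; the range condition is then vacuous.\<close>
    case True
    have "equivalent_weights W S L L" for L
      unfolding equivalent_weights_def by blast
    then show ?thesis using True by (intro exI[of _ 0]) auto
  next
    case False
    then obtain s where s: "s \<in> S" by blast
    then have l: "1 \<le> ?l" using assms(4) len_S[OF s] S_carrier[OF s] by fastforce
    define B where "B = 2 * int ?l"
    have B: "1 \<le> B" "\<And>w. w \<in> carrier W \<Longrightarrow> 2 * int (cox_length W S w) \<le> B"
      using l assms(4) by (auto simp: B_def)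
    \<comment> \<open>The mediant has entries up to \<open>2 * B\<close>, which is four times the
      length of \<open>w0\<close>. As that length is at least 1, the cubic bound follows.\<close>
    show ?thesis
    proof (intro exI[of _ "4 * ?l"] conjI allI impI)
      have "?l * 1 \<le> ?l * ?l ^ 2" using l by (intro mult_left_mono) auto
      then show "4 * ?l \<le> 8 * ?l ^ 3" by (simp add: power3_eq_cube power2_eq_square)
      fix L assume L: "pos_weight_function W S L"
      obtain L' where L'1: "pos_weight_function W S L'" "\<forall>s\<in>S. 1 \<le> L' s \<and> L' s \<le> 2 * B"
        and signs: "\<forall>s\<in>S. \<exists>s1\<in>comp s. \<exists>s2\<in>comp s.
          (\<forall>t\<in>comp s. L t = L s1 \<and> L' t = L' s1 \<or> L t = L s2 \<and> L' t = L' s2) \<and>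
          (\<forall>a b. \<bar>a\<bar> \<le> B \<longrightarrow> \<bar>b\<bar> \<le> B \<longrightarrow>
            sgn (a * L s1 + b * L s2) = sgn (a * L' s1 + b * L' s2))"
        using ex_small_weight[OF L B(1)] by blast
      interpret two_weights W S L L' B
        using L L'1(1) B(2) signs by unfold_locales blast+
      show "\<exists>L'. pos_weight_function W S L' \<and> equivalent_weights W S L L' \<and>
          (\<forall>s\<in>S. 1 \<le> L' s \<and> L' s \<le> int (4 * ?l))"
        using L'1 equivalent by (intro exI[of _ L']) (simp add: B_def)
    qed
  qed
qed

end
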